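(* Let $k$ be a field. Let $Q=\operatorname{Spec}(A)$ be an affine algebraic rack over $k$ with unit $e\in Q$, let $\nabla=\triangleright^\sharp$ and $\nabla^{-1}=(\triangleright^{-1})^\sharp\colon A\to A\otimes_k A$ be the corack operations of $A$, and let $\mathfrak{q}:=\operatorname{Der}_k(A,k)$ be the vector space of $k$-derivations of $A$ into $k$. Define $[\cdot,\cdot],\{\cdot,\cdot\}\colon\mathfrak{q}^2\to\mathfrak{q}$ by $$[D,E]:=(D\otimes E)\circ\nabla,\qquad \{D,E\}:=(D\otimes E)\circ\nabla^{-1}.$$ Then $[\cdot,\cdot]$ is a left Leibniz bracket and $\{\cdot,\cdot\}$ is a right Leibniz bracket on $\mathfrak{q}$ (in particular, both take values in $\mathfrak{q}$), and the assignments $Q\mapsto(\mathfrak{q},[\cdot,\cdot])$ (resp. $Q\mapsto(\mathfrak{q},\{\cdot,\cdot\})$) and $\varphi\mapsto(d\varphi)_e$ define a covariant functor from the category of affine algebraic racks over $k$ to the category of left Leibniz algebras over $k$ (resp. right Leibniz algebras over $k$). Furthermore, if $Q=\operatorname{Conj}(G)$ is the conjugation quandle scheme of an affine algebraic group $G$ over $k$, then $(\mathfrak{q},[\cdot,\cdot])$ is the Lie algebra of $G$. On the other hand, if $k=\mathbb{R}$ or $\mathbb{C}$ and $Q(k)$ is a Lie rack, then $(\mathfrak{q},[\cdot,\cdot])$ is the Leibniz algebra of $Q(k)$ as a Lie rack.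
   Context: Schemes are of finite type over $k$; $k$-algebras are finitely generated, commutative and associative. A pointed rack is a set $Q$ with an element $e$ and binary operations $\triangleright,\triangleright^{-1}$ such that for all $x,y,z$: $(x\triangleright y)\triangleright^{-1}x=y=x\triangleright(y\triangleright^{-1}x)$; $x\triangleright(y\triangleright z)=(x\triangleright y)\triangleright(x\triangleright z)$; $(x\triangleright^{-1}y)\triangleright^{-1}z=(x\triangleright^{-1}z)\triangleright^{-1}(y\triangleright^{-1}z)$; $e\triangleright x=x$; $x\triangleright e=e$. Write $L_x(y)=x\triangleright y$; it is bijective with inverse $y\mapsto y\triangleright^{-1}x$. An affine algebraic rack over $k$ is a pointed rack object in the category of affine schemes over $k$: an affine scheme $Q=\operatorname{Spec}(A)$ with morphisms $\triangleright,\triangleright^{-1}\colon Q\times_k Q\to Q$ and $e\colon\operatorname{Spec}(k)\to Q$ satisfying these axioms as commutative diagrams (equivalently, making $Q(R)$ a pointed rack for every $k$-algebra $R$). Morphisms are scheme morphisms compatible with $\triangleright,\triangleright^{-1},e$. For a morphism $\varphi\colon\operatorname{Spec}(B)\to\operatorname{Spec}(A)$, $\varphi^\sharp\colon A\to B$ is the induced ring map. So $\nabla f(x,y)=f(x\triangleright y)$ and $\nabla^{-1}f(x,y)=f(x\triangleright^{-1}y)$. Put $\varepsilon:=e^\sharp\colon A\to k$. $\operatorname{Der}_k(A,k)$ is the set of $k$-linear $D\colon A\to k$ with $D(fg)=D(f)\varepsilon(g)+\varepsilon(f)D(g)$. $D\otimes E$ is regarded as the map $A\otimes_kA\to k$,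 $a\otimes b\mapsto D(a)E(b)$. For a morphism $\varphi$ of affine algebraic racks, $(d\varphi)_e(D)=D\circ\varphi^\sharp$. A left Leibniz algebra is a vector space with bilinear bracket satisfying $[X,[Y,Z]]=[[X,Y],Z]+[Y,[X,Z]]$; a right Leibniz algebra is one with bilinear bracket satisfying $\{\{X,Y\},Z\}=\{\{X,Z\},Y\}+\{X,\{Y,Z\}\}$. Homomorphisms are linear maps preserving brackets. For an algebraic group $G$, $\operatorname{Conj}(G)$ has the same underlying scheme and identity as $G$, with $g\triangleright h=ghg^{-1}$ and $h\triangleright^{-1}g=g^{-1}hg$ on $R$-points. The Lie algebra of $G=\operatorname{Spec}(A)$ is $\operatorname{Der}_k(A,k)$ with its usual Lie bracket $(D\otimes E-E\otimes D)\circ\Delta$, where $\Delta$ is the comultiplication of $A$. A (real or complex) Lie rack is a pointed rack object in smooth manifolds. Its Leibniz algebra is $T_eQ$ with bracket $[X,Y]=\operatorname{ad}_X(Y)$, where $\operatorname{Ad}\colon Q\to\operatorname{GL}(T_eQ)$, $\operatorname{Ad}_x=(dL_x)_e$, and $\operatorname{ad}=(d\operatorname{Ad})_e\colon T_eQ\to\operatorname{End}(T_eQ)$. In the last assertion, the Lie rack structure on $Q(k)$ is the one coming from the algebraic rack $Q$, i.e. the manifold structure and operations are induced by the scheme $Q$ and its morphisms, and the tangent space of $Q(k)$ at $e$ is identified with $T_eQ\cong\mathfrak{q}$. *)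

theory Defs
  imports
    "HOL-Analysis.Analysis"
    "HOL-Algebra.Algebraic_Closure_Type"
    "HOL-Algebra.Subrings"
    "HOL-Algebra.Module"
    "HOL-Library.Poly_Mapping"
begin

no_notation Polynomials.var (\<open>X\<index>\<close>)  (* frees X for variables *)

section \<open>Algebras over a field\<close>

text \<open>The ground field is a type \<open>'k\<close> of class \<open>field\<close>; algebras over it are \<open>HOL-Algebra\<close> algebras,
  with arbitrary carriers, over the ring \<^const>\<open>ring_of_type_algebra\<close>. All maps out of a carrier
  are \<^const>\<open>extensional\<close>, so that equality of maps is equality in HOL.\<close>

abbreviation base_field :: "'k::field ring" where
  "base_field \<equiv> ring_of_type_algebra"

definition base_algebra :: "('k::field, 'k) module" where
  "base_algebra =
     \<lparr>carrier = UNIV, monoid.mult = (*), one = 1, ring.zero = 0, add = (+), smult = (*)\<rparr>"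

definition finitely_generated_algebra :: "('k::field, 'a) module \<Rightarrow> bool" where
  "finitely_generated_algebra A \<longleftrightarrow>
     (\<exists>S. finite S \<and> S \<subseteq> carrier A \<and>
        (\<forall>B. subring B A \<and> (\<forall>c. \<forall>b\<in>B. c \<odot>\<^bsub>A\<^esub> b \<in> B) \<and> S \<subseteq> B \<longrightarrow> B = carrier A))"

definition fg_algebra :: "('k::field, 'a) module \<Rightarrow> bool" where
  "fg_algebra A \<longleftrightarrow> Module.algebra base_field A \<and> finitely_generated_algebra A"

definition alg_hom :: "('k::field, 'a) module \<Rightarrow> ('k, 'b) module \<Rightarrow> ('a \<Rightarrow> 'b) set" where
  "alg_hom A B = {h \<in> ring_hom A B \<inter> extensional (carrier A).
     \<forall>c. \<forall>a\<in>carrier A. h (c \<odot>\<^bsub>A\<^esub> a) = c \<odot>\<^bsub>B\<^esub> h a}"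


section \<open>Tensor products of algebras\<close>

text \<open>\<open>free_product_algebra A B\<close> is the free vector space on \<open>carrier A \<times> carrier B\<close>, multiplied by
  \<open>(a, b) (a', b') = (a a', b b')\<close>. The span of the bilinearity relations below is stable under
  multiplication by basis elements, so it coincides with the ideal they generate, and the quotient
  ring is the usual tensor product over \<open>k\<close>.\<close>

definition free_product_algebra ::
    "('k::field, 'a) module \<Rightarrow> ('k, 'b) module \<Rightarrow> (('a \<times> 'b) \<Rightarrow>\<^sub>0 'k) ring" where
  "free_product_algebra A B =
     \<lparr>carrier = {f. Poly_Mapping.keys f \<subseteq> carrier A \<times> carrier B},
      monoid.mult = (\<lambda>f g. \<Sum>p\<in>Poly_Mapping.keys f. \<Sum>q\<in>Poly_Mapping.keys g.
         Poly_Mapping.single (fst p \<otimes>\<^bsub>A\<^esub> fst q, snd p \<otimes>\<^bsub>B\<^esub> snd q)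
           (Poly_Mapping.lookup f p * Poly_Mapping.lookup g q)),
      one = Poly_Mapping.single (\<one>\<^bsub>A\<^esub>, \<one>\<^bsub>B\<^esub>) 1,
      ring.zero = 0,
      add = (+)\<rparr>"

definition tensor_relations ::
    "('k::field, 'a) module \<Rightarrow> ('k, 'b) module \<Rightarrow> (('a \<times> 'b) \<Rightarrow>\<^sub>0 'k) set" where
  "tensor_relations A B =
     {Poly_Mapping.single (a \<oplus>\<^bsub>A\<^esub> a', b) 1 - Poly_Mapping.single (a, b) 1
        - Poly_Mapping.single (a', b) 1
      | a a' b. a \<in> carrier A \<and> a' \<in> carrier A \<and> b \<in> carrier B} \<union>
     {Poly_Mapping.single (a, b \<oplus>\<^bsub>B\<^esub> b') 1 - Poly_Mapping.single (a, b) 1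
        - Poly_Mapping.single (a, b') 1
      | a b b'. a \<in> carrier A \<and> b \<in> carrier B \<and> b' \<in> carrier B} \<union>
     {Poly_Mapping.single (c \<odot>\<^bsub>A\<^esub> a, b) 1 - Poly_Mapping.single (a, b) c
      | c a b. a \<in> carrier A \<and> b \<in> carrier B} \<union>
     {Poly_Mapping.single (a, c \<odot>\<^bsub>B\<^esub> b) 1 - Poly_Mapping.single (a, b) c
      | c a b. a \<in> carrier A \<and> b \<in> carrier B}"

definition tensor_ideal ::
    "('k::field, 'a) module \<Rightarrow> ('k, 'b) module \<Rightarrow> (('a \<times> 'b) \<Rightarrow>\<^sub>0 'k) set" where
  "tensor_ideal A B = genideal (free_product_algebra A B) (tensor_relations A B)"

definition tensor ::
    "('k::field, 'a) module \<Rightarrow> ('k, 'b) module \<Rightarrow> ('k, (('a \<times> 'b) \<Rightarrow>\<^sub>0 'k) set) module" where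
  "tensor A B =
     (let F = free_product_algebra A B; I = tensor_ideal A B; T = F Quot I in
      \<lparr>carrier = carrier T, monoid.mult = monoid.mult T, one = one T, ring.zero = ring.zero T,
       add = add T,
       smult = (\<lambda>c t. a_r_coset F I (Poly_Mapping.single (\<one>\<^bsub>A\<^esub>, \<one>\<^bsub>B\<^esub>) c) \<otimes>\<^bsub>T\<^esub> t)\<rparr>)"

definition pure_tensor ::
    "('k::field, 'a) module \<Rightarrow> ('k, 'b) module \<Rightarrow> 'a \<Rightarrow> 'b \<Rightarrow> (('a \<times> 'b) \<Rightarrow>\<^sub>0 'k) set" where
  "pure_tensor A B a b =
     a_r_coset (free_product_algebra A B) (tensor_ideal A B) (Poly_Mapping.single (a, b) 1)"

text \<open>For linear maps \<open>x: A \<rightarrow> R\<close> and \<open>y: B \<rightarrow> R\<close> into an algebra, \<open>tensor_map A B R x y\<close> is the linear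
  map \<open>A \<otimes> B \<rightarrow> R\<close> with \<open>a \<otimes> b \<mapsto> x a \<cdot> y b\<close>. If \<open>x\<close> and \<open>y\<close> are points \<open>Spec R \<rightarrow> Spec A\<close> and
  \<open>Spec R \<rightarrow> Spec B\<close>, it is the comorphism of \<open>(x, y): Spec R \<rightarrow> Spec A \<times> Spec B\<close>; for functionals
  \<open>D\<close>, \<open>E\<close> (with \<open>R = k\<close>) it is the functional \<open>D \<otimes> E\<close>.\<close>

definition tensor_map ::
    "('k::field, 'a) module \<Rightarrow> ('k, 'b) module \<Rightarrow> ('k, 'r) module \<Rightarrow>
     ('a \<Rightarrow> 'r) \<Rightarrow> ('b \<Rightarrow> 'r) \<Rightarrow> (('a \<times> 'b) \<Rightarrow>\<^sub>0 'k) set \<Rightarrow> 'r" where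
  "tensor_map A B R x y = (\<lambda>t\<in>carrier (tensor A B).
     the_elem ((\<lambda>f. \<Oplus>\<^bsub>R\<^esub>p\<in>Poly_Mapping.keys f.
        Poly_Mapping.lookup f p \<odot>\<^bsub>R\<^esub> (x (fst p) \<otimes>\<^bsub>R\<^esub> y (snd p))) ` t))"

definition tensor_inl ::
    "('k::field, 'a) module \<Rightarrow> ('k, 'b) module \<Rightarrow> 'a \<Rightarrow> (('a \<times> 'b) \<Rightarrow>\<^sub>0 'k) set" where
  "tensor_inl A B = (\<lambda>a\<in>carrier A. pure_tensor A B a \<one>\<^bsub>B\<^esub>)"

definition tensor_inr ::
    "('k::field, 'a) module \<Rightarrow> ('k, 'b) module \<Rightarrow> 'b \<Rightarrow> (('a \<times> 'b) \<Rightarrow>\<^sub>0 'k) set" where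
  "tensor_inr A B = (\<lambda>b\<in>carrier B. pure_tensor A B \<one>\<^bsub>A\<^esub> b)"


section \<open>Affine algebraic racks\<close>

text \<open>An affine scheme \<open>Spec A\<close> is given by its coordinate algebra \<open>A\<close>, and a morphism
  \<open>Spec B \<rightarrow> Spec A\<close> by its comorphism \<open>A \<rightarrow> B\<close>. An \<open>R\<close>-valued point is an element of \<open>alg_hom A R\<close>.
  \<open>point_op A R m x y\<close> is the composite of \<open>(x, y): Spec R \<rightarrow> Spec A \<times> Spec A\<close> with the operation whose
  comorphism is \<open>m: A \<rightarrow> A \<otimes> A\<close>; \<open>point_unit\<close> is the composite \<open>Spec R \<rightarrow> Spec k \<rightarrow> Spec A\<close>.
  A commutative diagram of morphisms out of \<open>Spec A\<close>, \<open>Spec A \<times> Spec A\<close> or \<open>Spec A \<times> Spec A \<times> Spec A\<close> is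
  written as an equation between the composites formed from the projections of the respective
  product, whose comorphisms are the canonical maps below.\<close>

definition point_op ::
    "('k::field, 'a) module \<Rightarrow> ('k, 'r) module \<Rightarrow> ('a \<Rightarrow> (('a \<times> 'a) \<Rightarrow>\<^sub>0 'k) set) \<Rightarrow>
     ('a \<Rightarrow> 'r) \<Rightarrow> ('a \<Rightarrow> 'r) \<Rightarrow> 'a \<Rightarrow> 'r" where
  "point_op A R m x y = compose (carrier A) (tensor_map A A R x y) m"

definition point_unit ::
    "('k::field, 'a) module \<Rightarrow> ('k, 'r) module \<Rightarrow> ('a \<Rightarrow> 'k) \<Rightarrow> 'a \<Rightarrow> 'r" where
  "point_unit A R \<epsilon> = (\<lambda>a\<in>carrier A. \<epsilon> a \<odot>\<^bsub>R\<^esub> \<one>\<^bsub>R\<^esub>)"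

abbreviation "proj1_of2 A \<equiv> tensor_inl A A"
abbreviation "proj2_of2 A \<equiv> tensor_inr A A"
abbreviation "proj1_of3 A \<equiv> compose (carrier A) (tensor_inl (tensor A A) A) (tensor_inl A A)"
abbreviation "proj2_of3 A \<equiv> compose (carrier A) (tensor_inl (tensor A A) A) (tensor_inr A A)"
abbreviation "proj3_of3 A \<equiv> tensor_inr (tensor A A) A"

record (overloaded) ('k, 'a) rack_scheme =
  coord :: "('k, 'a) module"
  nabla :: "'a \<Rightarrow> (('a \<times> 'a) \<Rightarrow>\<^sub>0 'k) set"
  nabla_inv :: "'a \<Rightarrow> (('a \<times> 'a) \<Rightarrow>\<^sub>0 'k) set"
  counit :: "'a \<Rightarrow> 'k"

definition affine_rack :: "('k::field, 'a) rack_scheme \<Rightarrow> bool" where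
  "affine_rack Q \<longleftrightarrow>
     (let A = coord Q; A2 = tensor A A; A3 = tensor A2 A;
          x = proj1_of2 A; y = proj2_of2 A;
          x' = proj1_of3 A; y' = proj2_of3 A; z' = proj3_of3 A;
          i = (\<lambda>a\<in>carrier A. a); e = point_unit A A (counit Q);
          op1 = point_op A A (nabla Q);
          op2 = point_op A A2 (nabla Q); opi2 = point_op A A2 (nabla_inv Q);
          op3 = point_op A A3 (nabla Q); opi3 = point_op A A3 (nabla_inv Q)
      in
        fg_algebra A \<and>
        nabla Q \<in> alg_hom A A2 \<and> nabla_inv Q \<in> alg_hom A A2 \<and> counit Q \<in> alg_hom A base_algebra \<and>
        opi2 (op2 x y) x = y \<and>
        op2 x (opi2 y x) = y \<and>
        op3 x' (op3 y' z') = op3 (op3 x' y') (op3 x' z') \<and>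
        opi3 (opi3 x' y') z' = opi3 (opi3 x' z') (opi3 y' z') \<and>
        op1 e i = i \<and>
        op1 i e = e)"

text \<open>Morphisms \<open>Q \<rightarrow> Q'\<close>, represented by their comorphisms.\<close>

definition rack_hom ::
    "('k::field, 'a) rack_scheme \<Rightarrow> ('k, 'b) rack_scheme \<Rightarrow> ('b \<Rightarrow> 'a) set" where
  "rack_hom Q Q' =
     (let A = coord Q; A' = coord Q'; A2 = tensor A A;
          x = proj1_of2 A; y = proj2_of2 A
      in {h \<in> alg_hom A' A.
            compose (carrier A') (point_op A A2 (nabla Q) x y) h =
              point_op A' A2 (nabla Q') (compose (carrier A') x h) (compose (carrier A') y h) \<and>
            compose (carrier A') (point_op A A2 (nabla_inv Q) x y) h =
              point_op A' A2 (nabla_inv Q') (compose (carrier A') x h) (compose (carrier A') y h) \<and>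
            compose (carrier A') (counit Q) h = counit Q'})"


section \<open>Affine algebraic groups and conjugation\<close>

record (overloaded) ('k, 'a) group_scheme =
  gcoord :: "('k, 'a) module"
  comult :: "'a \<Rightarrow> (('a \<times> 'a) \<Rightarrow>\<^sub>0 'k) set"
  gcounit :: "'a \<Rightarrow> 'k"
  antipode :: "'a \<Rightarrow> 'a"

definition affine_group :: "('k::field, 'a) group_scheme \<Rightarrow> bool" where
  "affine_group G \<longleftrightarrow>
     (let A = gcoord G; A2 = tensor A A; A3 = tensor A2 A;
          x' = proj1_of3 A; y' = proj2_of3 A; z' = proj3_of3 A;
          i = (\<lambda>a\<in>carrier A. a); e = point_unit A A (gcounit G);
          mul1 = point_op A A (comult G); mul3 = point_op A A3 (comult G)
      in
        fg_algebra A \<and>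
        comult G \<in> alg_hom A A2 \<and> gcounit G \<in> alg_hom A base_algebra \<and> antipode G \<in> alg_hom A A \<and>
        mul3 (mul3 x' y') z' = mul3 x' (mul3 y' z') \<and>
        mul1 e i = i \<and> mul1 i e = i \<and>
        mul1 (antipode G) i = e \<and> mul1 i (antipode G) = e)"

text \<open>\<open>x \<triangleright> y = x y x\<^sup>-\<^sup>1\<close> and \<open>x \<triangleright>\<^sup>-\<^sup>1 y = y\<^sup>-\<^sup>1 x y\<close>, evaluated at the two projections \<open>x\<close>, \<open>y\<close>.\<close>

definition Conj :: "('k::field, 'a) group_scheme \<Rightarrow> ('k, 'a) rack_scheme" where
  "Conj G =
     (let A = gcoord G; x = proj1_of2 A; y = proj2_of2 A;
          mul = point_op A (tensor A A) (comult G);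
          invs = (\<lambda>p. compose (carrier A) p (antipode G))
      in \<lparr>coord = A,
          nabla = mul (mul x y) (invs x),
          nabla_inv = mul (mul (invs y) x) y,
          counit = gcounit G\<rparr>)"


section \<open>Leibniz algebras\<close>

text \<open>Vector spaces with a bracket extend the record \<^typ>\<open>('k, 'v) module\<close>; as usual for modules
  in \<open>HOL-Algebra\<close>, its fields \<^const>\<open>monoid.mult\<close> and \<^const>\<open>one\<close> play no role.\<close>

record ('k, 'v) bracket_module = "('k, 'v) module" +
  bracket :: "'v \<Rightarrow> 'v \<Rightarrow> 'v"

definition bilinear_bracket :: "('k::field, 'v) bracket_module \<Rightarrow> bool" where
  "bilinear_bracket L \<longleftrightarrow>
     Module.module base_field L \<and>
     (\<forall>x\<in>carrier L. \<forall>y\<in>carrier L. bracket L x y \<in> carrier L) \<and>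
     (\<forall>x\<in>carrier L. \<forall>y\<in>carrier L. \<forall>z\<in>carrier L.
        bracket L (x \<oplus>\<^bsub>L\<^esub> y) z = bracket L x z \<oplus>\<^bsub>L\<^esub> bracket L y z \<and>
        bracket L x (y \<oplus>\<^bsub>L\<^esub> z) = bracket L x y \<oplus>\<^bsub>L\<^esub> bracket L x z) \<and>
     (\<forall>c. \<forall>x\<in>carrier L. \<forall>y\<in>carrier L.
        bracket L (c \<odot>\<^bsub>L\<^esub> x) y = c \<odot>\<^bsub>L\<^esub> bracket L x y \<and>
        bracket L x (c \<odot>\<^bsub>L\<^esub> y) = c \<odot>\<^bsub>L\<^esub> bracket L x y)"

definition left_leibniz :: "('k::field, 'v) bracket_module \<Rightarrow> bool" where
  "left_leibniz L \<longleftrightarrow> bilinear_bracket L \<and>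
     (\<forall>x\<in>carrier L. \<forall>y\<in>carrier L. \<forall>z\<in>carrier L.
        bracket L x (bracket L y z) =
          bracket L (bracket L x y) z \<oplus>\<^bsub>L\<^esub> bracket L y (bracket L x z))"

definition right_leibniz :: "('k::field, 'v) bracket_module \<Rightarrow> bool" where
  "right_leibniz L \<longleftrightarrow> bilinear_bracket L \<and>
     (\<forall>x\<in>carrier L. \<forall>y\<in>carrier L. \<forall>z\<in>carrier L.
        bracket L (bracket L x y) z =
          bracket L (bracket L x z) y \<oplus>\<^bsub>L\<^esub> bracket L x (bracket L y z))"

definition leibniz_hom ::
    "('k::field, 'v) bracket_module \<Rightarrow> ('k, 'w) bracket_module \<Rightarrow> ('v \<Rightarrow> 'w) set" where
  "leibniz_hom L M = {h \<in> (carrier L \<rightarrow>\<^sub>E carrier M).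
     (\<forall>x\<in>carrier L. \<forall>y\<in>carrier L.
        h (x \<oplus>\<^bsub>L\<^esub> y) = h x \<oplus>\<^bsub>M\<^esub> h y \<and> h (bracket L x y) = bracket M (h x) (h y)) \<and>
     (\<forall>c. \<forall>x\<in>carrier L. h (c \<odot>\<^bsub>L\<^esub> x) = c \<odot>\<^bsub>M\<^esub> h x)}"

definition leibniz_iso ::
    "('k::field, 'v) bracket_module \<Rightarrow> ('k, 'w) bracket_module \<Rightarrow> ('v \<Rightarrow> 'w) set" where
  "leibniz_iso L M = {h \<in> leibniz_hom L M. bij_betw h (carrier L) (carrier M)}"


section \<open>Tangent algebras\<close>

definition derivations :: "('k::field, 'a) module \<Rightarrow> ('a \<Rightarrow> 'k) \<Rightarrow> ('a \<Rightarrow> 'k) set" where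
  "derivations A \<epsilon> = {D \<in> extensional (carrier A).
     (\<forall>f\<in>carrier A. \<forall>g\<in>carrier A. D (f \<oplus>\<^bsub>A\<^esub> g) = D f + D g) \<and>
     (\<forall>c. \<forall>f\<in>carrier A. D (c \<odot>\<^bsub>A\<^esub> f) = c * D f) \<and>
     (\<forall>f\<in>carrier A. \<forall>g\<in>carrier A. D (f \<otimes>\<^bsub>A\<^esub> g) = D f * \<epsilon> g + \<epsilon> f * D g)}"

text \<open>The space of functionals \<open>V\<close> on \<open>S\<close> with pointwise operations and the bracket \<open>b\<close>.\<close>

definition functional_algebra ::
    "'s set \<Rightarrow> ('s \<Rightarrow> 'k::field) set \<Rightarrow> (('s \<Rightarrow> 'k) \<Rightarrow> ('s \<Rightarrow> 'k) \<Rightarrow> 's \<Rightarrow> 'k) \<Rightarrow>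
     ('k, 's \<Rightarrow> 'k) bracket_module" where
  "functional_algebra S V b =
     \<lparr>carrier = V, monoid.mult = (\<lambda>_ _. undefined), one = undefined,
      ring.zero = (\<lambda>f\<in>S. 0),
      add = (\<lambda>D E. \<lambda>f\<in>S. D f + E f),
      smult = (\<lambda>c D. \<lambda>f\<in>S. c * D f),
      bracket = (\<lambda>D\<in>V. \<lambda>E\<in>V. b D E)\<rparr>"

definition left_tangent :: "('k::field, 'a) rack_scheme \<Rightarrow> ('k, 'a \<Rightarrow> 'k) bracket_module" where
  "left_tangent Q = (let A = coord Q in
     functional_algebra (carrier A) (derivations A (counit Q))
       (\<lambda>D E. compose (carrier A) (tensor_map A A base_algebra D E) (nabla Q)))"

definition right_tangent :: "('k::field, 'a) rack_scheme \<Rightarrow> ('k, 'a \<Rightarrow> 'k) bracket_module" where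
  "right_tangent Q = (let A = coord Q in
     functional_algebra (carrier A) (derivations A (counit Q))
       (\<lambda>D E. compose (carrier A) (tensor_map A A base_algebra D E) (nabla_inv Q)))"

definition differential_at_unit ::
    "('k::field, 'a) rack_scheme \<Rightarrow> ('k, 'b) rack_scheme \<Rightarrow> ('b \<Rightarrow> 'a) \<Rightarrow>
     ('a \<Rightarrow> 'k) \<Rightarrow> 'b \<Rightarrow> 'k" where
  "differential_at_unit Q Q' h =
     (\<lambda>D\<in>derivations (coord Q) (counit Q). compose (carrier (coord Q')) D h)"

definition lie_algebra_of :: "('k::field, 'a) group_scheme \<Rightarrow> ('k, 'a \<Rightarrow> 'k) bracket_module" where
  "lie_algebra_of G = (let A = gcoord G in
     functional_algebra (carrier A) (derivations A (gcounit G))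
       (\<lambda>D E. \<lambda>f\<in>carrier A.
          tensor_map A A base_algebra D E (comult G f) -
          tensor_map A A base_algebra E D (comult G f)))"


section \<open>Categories and functors\<close>

record ('o, 'm) cat =
  Ob :: "'o set"
  Hom :: "'o \<Rightarrow> 'o \<Rightarrow> 'm set"
  Ident :: "'o \<Rightarrow> 'm"
  Comp :: "'o \<Rightarrow> 'o \<Rightarrow> 'o \<Rightarrow> 'm \<Rightarrow> 'm \<Rightarrow> 'm"
    \<comment> \<open>\<open>Comp C X Y Z g f\<close> is \<open>g \<circ> f\<close> for \<open>f: X \<rightarrow> Y\<close> and \<open>g: Y \<rightarrow> Z\<close>\<close>

definition is_category :: "('o, 'm) cat \<Rightarrow> bool" where
  "is_category C \<longleftrightarrow>
     (\<forall>X\<in>Ob C. Ident C X \<in> Hom C X X) \<and>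
     (\<forall>X\<in>Ob C. \<forall>Y\<in>Ob C. \<forall>Z\<in>Ob C. \<forall>f\<in>Hom C X Y. \<forall>g\<in>Hom C Y Z.
        Comp C X Y Z g f \<in> Hom C X Z) \<and>
     (\<forall>X\<in>Ob C. \<forall>Y\<in>Ob C. \<forall>f\<in>Hom C X Y.
        Comp C X X Y f (Ident C X) = f \<and> Comp C X Y Y (Ident C Y) f = f) \<and>
     (\<forall>W\<in>Ob C. \<forall>X\<in>Ob C. \<forall>Y\<in>Ob C. \<forall>Z\<in>Ob C.
        \<forall>f\<in>Hom C W X. \<forall>g\<in>Hom C X Y. \<forall>h\<in>Hom C Y Z.
          Comp C W Y Z h (Comp C W X Y g f) = Comp C W X Z (Comp C X Y Z h g) f)"

definition is_functor ::
    "('o, 'm) cat \<Rightarrow> ('p, 'n) cat \<Rightarrow> ('o \<Rightarrow> 'p) \<Rightarrow> ('o \<Rightarrow> 'o \<Rightarrow> 'm \<Rightarrow> 'n) \<Rightarrow> bool" where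
  "is_functor C D F \<Phi> \<longleftrightarrow>
     is_category C \<and> is_category D \<and>
     (\<forall>X\<in>Ob C. F X \<in> Ob D) \<and>
     (\<forall>X\<in>Ob C. \<forall>Y\<in>Ob C. \<forall>f\<in>Hom C X Y. \<Phi> X Y f \<in> Hom D (F X) (F Y)) \<and>
     (\<forall>X\<in>Ob C. \<Phi> X X (Ident C X) = Ident D (F X)) \<and>
     (\<forall>X\<in>Ob C. \<forall>Y\<in>Ob C. \<forall>Z\<in>Ob C. \<forall>f\<in>Hom C X Y. \<forall>g\<in>Hom C Y Z.
        \<Phi> X Z (Comp C X Y Z g f) = Comp D (F X) (F Y) (F Z) (\<Phi> Y Z g) (\<Phi> X Y f))"

text \<open>The objects are the affine algebraic racks whose coordinate algebra has its carrier in the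
  (arbitrary) type \<open>'a\<close>. Since arrows are comorphisms, they compose in the opposite order.\<close>

definition rack_category :: "(('k::field, 'a) rack_scheme, 'a \<Rightarrow> 'a) cat" where
  "rack_category =
     \<lparr>Ob = {Q. affine_rack Q},
      Hom = rack_hom,
      Ident = (\<lambda>Q. \<lambda>a\<in>carrier (coord Q). a),
      Comp = (\<lambda>X Y Z g f. compose (carrier (coord Z)) f g)\<rparr>"

definition bracket_category ::
    "(('k::field, 'v) bracket_module \<Rightarrow> bool) \<Rightarrow> (('k, 'v) bracket_module, 'v \<Rightarrow> 'v) cat" where
  "bracket_category P =
     \<lparr>Ob = {L. P L},
      Hom = leibniz_hom,
      Ident = (\<lambda>L. \<lambda>x\<in>carrier L. x),
      Comp = (\<lambda>X Y Z g f. compose (carrier X) g f)\<rparr>"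

abbreviation "left_leibniz_category \<equiv> bracket_category left_leibniz"
abbreviation "right_leibniz_category \<equiv> bracket_category right_leibniz"


section \<open>Manifolds over the real or complex numbers\<close>

text \<open>The ground field is a type \<open>'k\<close> of class \<open>real_normed_field\<close>, to be instantiated with
  \<^typ>\<open>real\<close> or \<^typ>\<open>complex\<close>. As in \<^const>\<open>Euclidean_space\<close>, the space \<open>k\<^sup>n\<close> consists of the sequences
  vanishing from index \<open>n\<close> on. Smoothness means continuous partial derivatives over \<open>k\<close> of all
  orders, which for \<^typ>\<open>complex\<close> is holomorphy; thus manifolds over \<^typ>\<open>complex\<close> are complex manifolds.\<close>

definition kspace :: "nat \<Rightarrow> (nat \<Rightarrow> 'k::real_normed_field) set" where
  "kspace n = {x. \<forall>i\<ge>n. x i = 0}"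

abbreviation kspace_topology :: "nat \<Rightarrow> (nat \<Rightarrow> 'k::real_normed_field) topology" where
  "kspace_topology n \<equiv> top_of_set (kspace n)"

definition partial_deriv ::
    "nat \<Rightarrow> ((nat \<Rightarrow> 'k) \<Rightarrow> 'k) \<Rightarrow> (nat \<Rightarrow> 'k::real_normed_field) \<Rightarrow> 'k" where
  "partial_deriv i F x = deriv (\<lambda>t. F (x(i := t))) (x i)"

primrec times_differentiable_on ::
    "nat \<Rightarrow> nat \<Rightarrow> (nat \<Rightarrow> 'k::real_normed_field) set \<Rightarrow> ((nat \<Rightarrow> 'k) \<Rightarrow> 'k) \<Rightarrow> bool" where
  "times_differentiable_on 0 n S F \<longleftrightarrow> continuous_on S F"
| "times_differentiable_on (Suc r) n S F \<longleftrightarrow> continuous_on S F \<and>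
     (\<forall>i<n. (\<forall>x\<in>S. (\<lambda>t. F (x(i := t))) field_differentiable at (x i)) \<and>
        times_differentiable_on r n S (partial_deriv i F))"

text \<open>Used for \<open>S\<close> open in \<open>k\<^sup>n\<close>.\<close>

definition smooth_on_kspace ::
    "nat \<Rightarrow> (nat \<Rightarrow> 'k::real_normed_field) set \<Rightarrow> ((nat \<Rightarrow> 'k) \<Rightarrow> 'k) \<Rightarrow> bool" where
  "smooth_on_kspace n S F \<longleftrightarrow> (\<forall>r. times_differentiable_on r n S F)"

text \<open>A chart \<open>(U, \<phi>, n)\<close> is a map \<open>\<phi>: U \<rightarrow> k\<^sup>n\<close>. Components of a manifold may differ in dimension.\<close>

type_synonym ('p, 'k) chart = "'p set \<times> ('p \<Rightarrow> nat \<Rightarrow> 'k) \<times> nat"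

definition manifold :: "'p topology \<Rightarrow> ('p, 'k::real_normed_field) chart set \<Rightarrow> bool" where
  "manifold T \<A> \<longleftrightarrow>
     Hausdorff_space T \<and> second_countable T \<and>
     topspace T = (\<Union>(U, \<phi>, n)\<in>\<A>. U) \<and>
     (\<forall>(U, \<phi>, n)\<in>\<A>. openin T U \<and> openin (kspace_topology n) (\<phi> ` U) \<and>
        homeomorphic_map (subtopology T U) (top_of_set (\<phi> ` U)) \<phi>) \<and>
     (\<forall>(U, \<phi>, m)\<in>\<A>. \<forall>(V, \<psi>, n)\<in>\<A>. \<forall>j<n.
        smooth_on_kspace m (\<phi> ` (U \<inter> V)) (\<lambda>u. \<psi> (inv_into U \<phi> u) j))"

definition smooth_map ::
    "'p topology \<Rightarrow> ('p, 'k::real_normed_field) chart set \<Rightarrow> 'q topology \<Rightarrow> ('q, 'k) chart set \<Rightarrow>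
     ('p \<Rightarrow> 'q) \<Rightarrow> bool" where
  "smooth_map T \<A> T' \<A>' f \<longleftrightarrow> continuous_map T T' f \<and>
     (\<forall>(U, \<phi>, m)\<in>\<A>. \<forall>(V, \<psi>, n)\<in>\<A>'. \<forall>j<n.
        smooth_on_kspace m (\<phi> ` {p \<in> U. f p \<in> V}) (\<lambda>u. \<psi> (f (inv_into U \<phi> u)) j))"

definition product_atlas ::
    "('p, 'k::real_normed_field) chart set \<Rightarrow> ('q, 'k) chart set \<Rightarrow> ('p \<times> 'q, 'k) chart set" where
  "product_atlas \<A> \<A>' =
     {(U \<times> V, \<lambda>(p, q) i. if i < m then \<phi> p i else \<psi> q (i - m), m + n)
      | U \<phi> m V \<psi> n. (U, \<phi>, m) \<in> \<A> \<and> (V, \<psi>, n) \<in> \<A>'}"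

text \<open>Scalar functions that are smooth on a neighbourhood of \<open>p\<close>.\<close>

definition smooth_near ::
    "'p topology \<Rightarrow> ('p, 'k::real_normed_field) chart set \<Rightarrow> 'p \<Rightarrow> ('p \<Rightarrow> 'k) set" where
  "smooth_near T \<A> p = {g. \<exists>W. openin T W \<and> p \<in> W \<and>
     (\<forall>(U, \<phi>, n)\<in>\<A>. smooth_on_kspace n (\<phi> ` (U \<inter> W)) (\<lambda>u. g (inv_into U \<phi> u)))}"

text \<open>Tangent vectors at \<open>p\<close> are the directional derivatives at \<open>p\<close>, in the coordinates of a chart
  around \<open>p\<close>, as operators on the functions that are smooth near \<open>p\<close>.\<close>

definition directional_derivative ::
    "'p topology \<Rightarrow> ('p, 'k::real_normed_field) chart set \<Rightarrow> 'p set \<Rightarrow> ('p \<Rightarrow> nat \<Rightarrow> 'k) \<Rightarrow> 'p \<Rightarrow>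
     (nat \<Rightarrow> 'k) \<Rightarrow> ('p \<Rightarrow> 'k) \<Rightarrow> 'k" where
  "directional_derivative T \<A> U \<phi> p v = (\<lambda>g\<in>smooth_near T \<A> p.
     deriv (\<lambda>t. g (inv_into U \<phi> (\<lambda>i. \<phi> p i + t * v i))) 0)"

definition tangent_space ::
    "'p topology \<Rightarrow> ('p, 'k::real_normed_field) chart set \<Rightarrow> 'p \<Rightarrow> (('p \<Rightarrow> 'k) \<Rightarrow> 'k) set" where
  "tangent_space T \<A> p =
     {directional_derivative T \<A> U \<phi> p v | U \<phi> n v. (U, \<phi>, n) \<in> \<A> \<and> p \<in> U \<and> v \<in> kspace n}"

text \<open>The differential of a self-map \<open>F\<close> at \<open>p\<close>.\<close>

definition manifold_differential ::
    "'p topology \<Rightarrow> ('p, 'k::real_normed_field) chart set \<Rightarrow> ('p \<Rightarrow> 'p) \<Rightarrow> 'p \<Rightarrow>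
     (('p \<Rightarrow> 'k) \<Rightarrow> 'k) \<Rightarrow> ('p \<Rightarrow> 'k) \<Rightarrow> 'k" where
  "manifold_differential T \<A> F p X = (\<lambda>g\<in>smooth_near T \<A> (F p). X (g \<circ> F))"


section \<open>Lie racks\<close>

definition pointed_rack ::
    "'p set \<Rightarrow> ('p \<Rightarrow> 'p \<Rightarrow> 'p) \<Rightarrow> ('p \<Rightarrow> 'p \<Rightarrow> 'p) \<Rightarrow> 'p \<Rightarrow> bool" where
  "pointed_rack M rop irop e \<longleftrightarrow>
     e \<in> M \<and>
     (\<forall>x\<in>M. \<forall>y\<in>M. rop x y \<in> M \<and> irop x y \<in> M) \<and>
     (\<forall>x\<in>M. \<forall>y\<in>M. irop (rop x y) x = y \<and> rop x (irop y x) = y) \<and>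
     (\<forall>x\<in>M. \<forall>y\<in>M. \<forall>z\<in>M. rop x (rop y z) = rop (rop x y) (rop x z)) \<and>
     (\<forall>x\<in>M. \<forall>y\<in>M. \<forall>z\<in>M. irop (irop x y) z = irop (irop x z) (irop y z)) \<and>
     (\<forall>x\<in>M. rop e x = x \<and> rop x e = e)"

definition lie_rack ::
    "'p topology \<Rightarrow> ('p, 'k::real_normed_field) chart set \<Rightarrow> ('p \<Rightarrow> 'p \<Rightarrow> 'p) \<Rightarrow> ('p \<Rightarrow> 'p \<Rightarrow> 'p) \<Rightarrow> 'p \<Rightarrow>
     bool" where
  "lie_rack T \<A> rop irop e \<longleftrightarrow>
     manifold T \<A> \<and> pointed_rack (topspace T) rop irop e \<and>
     smooth_map (prod_topology T T) (product_atlas \<A> \<A>) T \<A> (\<lambda>(x, y). rop x y) \<and>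
     smooth_map (prod_topology T T) (product_atlas \<A> \<A>) T \<A> (\<lambda>(x, y). irop x y)"

definition lie_rack_Ad ::
    "'p topology \<Rightarrow> ('p, 'k::real_normed_field) chart set \<Rightarrow> ('p \<Rightarrow> 'p \<Rightarrow> 'p) \<Rightarrow> 'p \<Rightarrow>
     'p \<Rightarrow> (('p \<Rightarrow> 'k) \<Rightarrow> 'k) \<Rightarrow> ('p \<Rightarrow> 'k) \<Rightarrow> 'k" where
  "lie_rack_Ad T \<A> rop e x = manifold_differential T \<A> (rop x) e"

text \<open>The derivative along \<open>X\<close> of the map \<open>Ad: Q \<rightarrow> End (T\<^sub>e Q)\<close>. The target is a finite-dimensional
  vector space, whose dual is spanned by the coordinates \<open>S \<mapsto> S Y g\<close> (\<open>Y \<in> T\<^sub>e Q\<close>, \<open>g\<close> smooth near \<open>e\<close>);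
  the derivative is computed coordinatewise.\<close>

definition lie_rack_ad ::
    "'p topology \<Rightarrow> ('p, 'k::real_normed_field) chart set \<Rightarrow> ('p \<Rightarrow> 'p \<Rightarrow> 'p) \<Rightarrow> 'p \<Rightarrow>
     (('p \<Rightarrow> 'k) \<Rightarrow> 'k) \<Rightarrow> (('p \<Rightarrow> 'k) \<Rightarrow> 'k) \<Rightarrow> ('p \<Rightarrow> 'k) \<Rightarrow> 'k" where
  "lie_rack_ad T \<A> rop e X Y = (\<lambda>g\<in>smooth_near T \<A> e. X (\<lambda>x. lie_rack_Ad T \<A> rop e x Y g))"

definition lie_rack_leibniz ::
    "'p topology \<Rightarrow> ('p, 'k::real_normed_field) chart set \<Rightarrow> ('p \<Rightarrow> 'p \<Rightarrow> 'p) \<Rightarrow> 'p \<Rightarrow>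
     ('k, ('p \<Rightarrow> 'k) \<Rightarrow> 'k) bracket_module" where
  "lie_rack_leibniz T \<A> rop e =
     functional_algebra (smooth_near T \<A> e) (tangent_space T \<A> e) (lie_rack_ad T \<A> rop e)"


section \<open>The rational points as a Lie rack\<close>

definition kpoints :: "('k::real_normed_field, 'a) module \<Rightarrow> ('a \<Rightarrow> 'k) set" where
  "kpoints A = alg_hom A base_algebra"

text \<open>Pointwise convergence, i.e. the coarsest topology making all regular functions continuous.\<close>

definition kpoints_topology :: "('k::real_normed_field, 'a) module \<Rightarrow> ('a \<Rightarrow> 'k) topology" where
  "kpoints_topology A = top_of_set (kpoints A)"

text \<open>Functions on an open set of \<open>Q(k)\<close> that are locally smooth functions of finitely many regular
  functions: the restrictions of smooth functions for any closed embedding of \<open>Q(k)\<close> in some \<open>k\<^sup>m\<close>.\<close>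

definition kpoints_smooth ::
    "('k::real_normed_field, 'a) module \<Rightarrow> ('a \<Rightarrow> 'k) set \<Rightarrow> (('a \<Rightarrow> 'k) \<Rightarrow> 'k) \<Rightarrow> bool" where
  "kpoints_smooth A U g \<longleftrightarrow>
     (\<forall>p\<in>U. \<exists>m f W F V. (\<forall>i<m. f i \<in> carrier A) \<and>
        openin (kspace_topology m) W \<and> smooth_on_kspace m W F \<and>
        openin (kpoints_topology A) V \<and> p \<in> V \<and> V \<subseteq> U \<and>
        (\<forall>q\<in>V. (\<lambda>i::nat. if i < m then q (f i) else 0) \<in> W \<and>
               g q = F (\<lambda>i. if i < m then q (f i) else 0)))"

text \<open>The charts induced by the scheme: diffeomorphisms onto open subsets of \<open>k\<^sup>n\<close>, in the sense
  that the coordinates are smooth functions on \<open>Q(k)\<close> and all regular functions are smooth in these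
  coordinates. These are the charts of \<open>Q(k)\<close> as an embedded submanifold of some \<open>k\<^sup>m\<close>; they cover
  \<open>Q(k)\<close> iff it is one.\<close>

definition kpoints_atlas :: "('k::real_normed_field, 'a) module \<Rightarrow> ('a \<Rightarrow> 'k, 'k) chart set" where
  "kpoints_atlas A = {(U, \<phi>, n).
     openin (kpoints_topology A) U \<and> inj_on \<phi> U \<and> openin (kspace_topology n) (\<phi> ` U) \<and>
     (\<forall>i<n. kpoints_smooth A U (\<lambda>p. \<phi> p i)) \<and>
     (\<forall>f\<in>carrier A. smooth_on_kspace n (\<phi> ` U) (\<lambda>u. inv_into U \<phi> u f))}"

definition kpoints_lie_rack :: "('k::real_normed_field, 'a) rack_scheme \<Rightarrow> bool" where
  "kpoints_lie_rack Q \<longleftrightarrow> (let A = coord Q in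
     lie_rack (kpoints_topology A) (kpoints_atlas A)
       (point_op A base_algebra (nabla Q)) (point_op A base_algebra (nabla_inv Q)) (counit Q))"

definition kpoints_leibniz ::
    "('k::real_normed_field, 'a) rack_scheme \<Rightarrow> ('k, (('a \<Rightarrow> 'k) \<Rightarrow> 'k) \<Rightarrow> 'k) bracket_module" where
  "kpoints_leibniz Q = (let A = coord Q in
     lie_rack_leibniz (kpoints_topology A) (kpoints_atlas A)
       (point_op A base_algebra (nabla Q)) (counit Q))"

text \<open>The canonical map from the tangent space of \<open>Q(k)\<close> at \<open>e\<close> to the derivations of \<open>A\<close>: a tangent
  vector is applied to the regular functions. It need not be onto, e.g. for non-reduced \<open>A\<close>.\<close>

definition kpoints_tangent_map ::
    "('k::real_normed_field, 'a) rack_scheme \<Rightarrow> ((('a \<Rightarrow> 'k) \<Rightarrow> 'k) \<Rightarrow> 'k) \<Rightarrow> 'a \<Rightarrow> 'k" where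
  "kpoints_tangent_map Q =
     (\<lambda>X\<in>tangent_space (kpoints_topology (coord Q)) (kpoints_atlas (coord Q)) (counit Q).
        \<lambda>f\<in>carrier (coord Q). X (\<lambda>p. p f))"

definition kpoints_tangent_identified :: "('k::real_normed_field, 'a) rack_scheme \<Rightarrow> bool" where
  "kpoints_tangent_identified Q \<longleftrightarrow>
     bij_betw (kpoints_tangent_map Q)
       (tangent_space (kpoints_topology (coord Q)) (kpoints_atlas (coord Q)) (counit Q))
       (derivations (coord Q) (counit Q))"

end

theory Submission
  imports Defs
begin

text \<open>Write \<open>[D, E] = (D \<otimes> E) \<circ> \<nabla>\<close>. The Leibniz identity is self-distributivity
  \<open>x \<triangleright> (y \<triangleright> z) = (x \<triangleright> y) \<triangleright> (x \<triangleright> z)\<close>, read as an equation between maps \<open>A \<rightarrow> A \<otimes> A \<otimes> A\<close> and tested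
  against the functional \<open>D \<otimes> E \<otimes> F\<close>. The left side becomes \<open>[D, [E, F]]\<close>. On the right side \<open>x\<close> occurs
  twice, so \<open>D\<close> is applied to a product and splits by the product rule; where \<open>D\<close> is not applied, the
  counit \<open>\<epsilon>\<close> remains and \<open>e \<triangleright> y = y\<close> removes that operation. This leaves
  \<open>[[D, E], F] + [E, [D, F]]\<close> (\<open>left_jacobi\<close>). For \<open>\<triangleright>\<^sup>-\<^sup>1\<close> the repeated variable is \<open>z\<close> and the unit laws
  follow from cancellation (\<open>right_jacobi\<close>). That the brackets are again derivations is the product
  rule in both slots, with cross terms killed by \<open>x \<triangleright> e = e\<close> and \<open>e \<triangleright>\<^sup>-\<^sup>1 x = e\<close>
  (\<open>convolution_derivation\<close>). All these are identities of functionals on tensor products, checked on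
  pure tensors; the point that needs an argument is that a pair of linear maps induces a
  well-defined map on the tensor product (\<open>L_ideal\<close>). Testing the definition of a rack morphism against
  \<open>D \<otimes> E\<close> gives functoriality (\<open>intertwines_pairing\<close>).

  For a group scheme, the points in every algebra form a group (\<open>group_points\<close>) on which \<open>Conj\<close>
  is conjugation, so the rack axioms are group theory applied to the projections. In \<open>x y x\<^sup>-\<^sup>1\<close> the derivation
  \<open>D\<close> splits over the two occurrences of \<open>x\<close>, and \<open>D \<circ> S = - D\<close> turns the second term into
  \<open>- (E \<otimes> D) \<circ> \<Delta>\<close> (\<open>bracket_Conj\<close>).

  For the Lie rack \<open>Q(k)\<close> the key is that the differentials of regular functions span the cotangent
  space at \<open>e\<close>: chart coordinates are smooth functions of regular functions, so by the chain rule every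
  smooth germ \<open>g\<close> has one regular function \<open>f\<close> with \<open>X g = X f\<close> for all tangent vectors \<open>X\<close>, and
  \<open>X (g \<circ> L) = X (f \<circ> L)\<close> for every self-map \<open>L\<close> that is given by regular functions and fixes \<open>e\<close>
  (\<open>germ_regular\<close>). Left translations \<open>L\<^sub>x\<close> are such maps, since \<open>x \<triangleright> e = e\<close>. Hence
  \<open>Ad\<^sub>x Y g = Y (f \<circ> L\<^sub>x) = (x \<otimes> Y) (\<nabla> f)\<close> is a regular function of \<open>x\<close>, and applying \<open>X\<close> gives
  \<open>(X \<otimes> Y) (\<nabla> f)\<close>: the bracket of the derivations defined by \<open>X\<close> and \<open>Y\<close>, evaluated at \<open>f\<close>
  (\<open>ad_tangent_map\<close>). Since tangent vectors at \<open>e\<close> correspond to derivations, every operation on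
  derivations lifts to tangent vectors in the same way (\<open>tangent_lift\<close>).\<close>

section \<open>The ground field as an algebra\<close>

lemma base_field_simps [simp]:
  "carrier base_field = UNIV" "r \<otimes>\<^bsub>base_field\<^esub> s = r * s" "\<one>\<^bsub>base_field\<^esub> = 1"
  "\<zero>\<^bsub>base_field\<^esub> = 0" "r \<oplus>\<^bsub>base_field\<^esub> s = r + s"
  by (simp_all add: ring_of_type_algebra_def)

lemma base_algebra_simps [simp]:
  "carrier base_algebra = UNIV" "r \<otimes>\<^bsub>base_algebra\<^esub> s = r * s" "\<one>\<^bsub>base_algebra\<^esub> = 1"
  "\<zero>\<^bsub>base_algebra\<^esub> = 0" "r \<oplus>\<^bsub>base_algebra\<^esub> s = r + s" "r \<odot>\<^bsub>base_algebra\<^esub> s = r * s"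
  by (simp_all add: base_algebra_def)

lemma algebra_base_algebra: "algebra base_field base_algebra"
proof (rule algebraI)
  show "cring (base_field :: 'a ring)" by (rule cring_from_type_algebra)
  show "cring (base_algebra :: ('a, 'a) module)"
    by unfold_locales
      (auto simp: algebra_simps Units_def intro: exI[of _ "- x" for x] intro!: add.right_inverse add.left_inverse)
qed (auto simp: algebra_simps)

lemma keys_add_subset:
  "Poly_Mapping.keys f \<subseteq> K \<Longrightarrow> Poly_Mapping.keys g \<subseteq> K \<Longrightarrow> Poly_Mapping.keys (f + g) \<subseteq> K"
  using Poly_Mapping.keys_add[of f g] by blast

section \<open>The free algebra on pairs\<close>

lemma poly_mapping_carrier_induct [consumes 1, case_names zero add single]:
  fixes f :: "'p \<Rightarrow>\<^sub>0 'c::comm_monoid_add"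
  assumes "Poly_Mapping.keys f \<subseteq> K" "P 0"
    "\<And>f g. Poly_Mapping.keys f \<subseteq> K \<Longrightarrow> Poly_Mapping.keys g \<subseteq> K \<Longrightarrow> P f \<Longrightarrow> P g \<Longrightarrow> P (f + g)"
    "\<And>p c. p \<in> K \<Longrightarrow> P (Poly_Mapping.single p c)"
  shows "P f"
proof -
  have gen: "P (\<Sum>p\<in>S. Poly_Mapping.single p (Poly_Mapping.lookup f p)) \<and>
      Poly_Mapping.keys (\<Sum>p\<in>S. Poly_Mapping.single p (Poly_Mapping.lookup f p)) \<subseteq> K"
    if "finite S" "S \<subseteq> K" for S
    using that
  proof (induction S rule: finite_induct)
    case empty
    then show ?case by (simp add: assms(2))
  next
    case (insert p S)
    have "Poly_Mapping.keys (Poly_Mapping.single p (Poly_Mapping.lookup f p)) \<subseteq> K"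
      using insert.prems by (auto split: if_splits)
    moreover have "Poly_Mapping.keys (Poly_Mapping.single p (Poly_Mapping.lookup f p) +
        (\<Sum>p\<in>S. Poly_Mapping.single p (Poly_Mapping.lookup f p))) \<subseteq> K"
      using calculation insert by (intro order_trans[OF Poly_Mapping.keys_add]) auto
    ultimately show ?case using insert by (auto intro!: assms(3,4))
  qed
  have "f = (\<Sum>p\<in>Poly_Mapping.keys f. Poly_Mapping.single p (Poly_Mapping.lookup f p))"
    by (rule poly_mapping_eqI)
       (auto simp: lookup_sum lookup_single when_def in_keys_iff if_distrib sum.delta cong: if_cong)
  with gen[of "Poly_Mapping.keys f"] assms(1) show ?thesis by simp
qed

lemma carrier_free_product [simp]:
  "f \<in> carrier (free_product_algebra A B) \<longleftrightarrow> Poly_Mapping.keys f \<subseteq> carrier A \<times> carrier B"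
  by (simp add: free_product_algebra_def)

lemma free_product_simps [simp]:
  "f \<oplus>\<^bsub>free_product_algebra A B\<^esub> g = f + g" "\<zero>\<^bsub>free_product_algebra A B\<^esub> = 0"
  "\<one>\<^bsub>free_product_algebra A B\<^esub> = Poly_Mapping.single (\<one>\<^bsub>A\<^esub>, \<one>\<^bsub>B\<^esub>) 1"
  by (simp_all add: free_product_algebra_def)

text \<open>The product is defined by sums over the supports. Enlarging the index sets to a common
  superset is what makes it visibly additive in each factor.\<close>

lemma free_product_mult_eq:
  assumes "finite S" "Poly_Mapping.keys f \<subseteq> S" "finite T" "Poly_Mapping.keys g \<subseteq> T"
  shows "f \<otimes>\<^bsub>free_product_algebra A B\<^esub> g =
    (\<Sum>p\<in>S. \<Sum>q\<in>T. Poly_Mapping.single (fst p \<otimes>\<^bsub>A\<^esub> fst q, snd p \<otimes>\<^bsub>B\<^esub> snd q)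
           (Poly_Mapping.lookup f p * Poly_Mapping.lookup g q))"
proof -
  have inner: "(\<Sum>q\<in>Poly_Mapping.keys g. Poly_Mapping.single (fst p \<otimes>\<^bsub>A\<^esub> fst q, snd p \<otimes>\<^bsub>B\<^esub> snd q)
           (Poly_Mapping.lookup f p * Poly_Mapping.lookup g q)) =
    (\<Sum>q\<in>T. Poly_Mapping.single (fst p \<otimes>\<^bsub>A\<^esub> fst q, snd p \<otimes>\<^bsub>B\<^esub> snd q)
           (Poly_Mapping.lookup f p * Poly_Mapping.lookup g q))" for p
    using assms by (intro sum.mono_neutral_left) (auto simp: in_keys_iff)
  show ?thesis
    unfolding free_product_algebra_def monoid.simps inner
    using assms by (intro sum.mono_neutral_left) (auto simp: in_keys_iff)
qed

lemma free_product_mult_add_left: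
  "(f + f') \<otimes>\<^bsub>free_product_algebra A B\<^esub> g =
    f \<otimes>\<^bsub>free_product_algebra A B\<^esub> g + f' \<otimes>\<^bsub>free_product_algebra A B\<^esub> g"
  by (subst (1 2 3) free_product_mult_eq[of "Poly_Mapping.keys f \<union> Poly_Mapping.keys f'" _ "Poly_Mapping.keys g"])
     (simp_all add: Poly_Mapping.keys_add lookup_add algebra_simps single_add sum.distrib)

lemma free_product_mult_add_right:
  "g \<otimes>\<^bsub>free_product_algebra A B\<^esub> (f + f') =
    g \<otimes>\<^bsub>free_product_algebra A B\<^esub> f + g \<otimes>\<^bsub>free_product_algebra A B\<^esub> f'"
  by (subst (1 2 3) free_product_mult_eq[of "Poly_Mapping.keys g" _ "Poly_Mapping.keys f \<union> Poly_Mapping.keys f'"])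
     (simp_all add: Poly_Mapping.keys_add lookup_add algebra_simps single_add sum.distrib)

lemma free_product_mult_zero [simp]:
  "0 \<otimes>\<^bsub>free_product_algebra A B\<^esub> f = 0" "f \<otimes>\<^bsub>free_product_algebra A B\<^esub> 0 = 0"
  by (simp_all add: free_product_algebra_def)

lemma free_product_mult_single [simp]:
  "Poly_Mapping.single (a, b) c \<otimes>\<^bsub>free_product_algebra A B\<^esub> Poly_Mapping.single (a', b') d =
    Poly_Mapping.single (a \<otimes>\<^bsub>A\<^esub> a', b \<otimes>\<^bsub>B\<^esub> b') (c * d)"
  by (subst free_product_mult_eq[of "{(a, b)}" _ "{(a', b')}"]) auto

lemma free_product_mult_closed:
  assumes A: "algebra base_field A" and B: "algebra base_field B"
    and "Poly_Mapping.keys f \<subseteq> carrier A \<times> carrier B" "Poly_Mapping.keys g \<subseteq> carrier A \<times> carrier B"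
  shows "Poly_Mapping.keys (f \<otimes>\<^bsub>free_product_algebra A B\<^esub> g) \<subseteq> carrier A \<times> carrier B"
proof -
  interpret A: algebra base_field A by fact
  interpret B: algebra base_field B by fact
  show ?thesis using assms(3)
  proof (induction f rule: poly_mapping_carrier_induct)
    case (single p c)
    from assms(4) show ?case
    proof (induction g rule: poly_mapping_carrier_induct)
      case (single q d)
      with \<open>p \<in> _\<close> show ?case by (cases p; cases q) (auto split: if_splits)
    qed (simp_all add: free_product_mult_add_right keys_add_subset)
  qed (simp_all add: free_product_mult_add_left keys_add_subset)
qed

lemma cring_free_product:
  assumes A: "algebra base_field A" and B: "algebra base_field B"
  shows "cring (free_product_algebra A B)"
proof -
  interpret A: algebra base_field A by fact
  interpret B: algebra base_field B by fact
  let ?F = "free_product_algebra A B"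
  note closed = free_product_mult_closed[OF A B]
  have assoc: "(f \<otimes>\<^bsub>?F\<^esub> g) \<otimes>\<^bsub>?F\<^esub> h = f \<otimes>\<^bsub>?F\<^esub> (g \<otimes>\<^bsub>?F\<^esub> h)"
    if f: "Poly_Mapping.keys f \<subseteq> carrier A \<times> carrier B" and g: "Poly_Mapping.keys g \<subseteq> carrier A \<times> carrier B"
      and h: "Poly_Mapping.keys h \<subseteq> carrier A \<times> carrier B" for f g h
    using f
  proof (induction f rule: poly_mapping_carrier_induct)
    case (single p c)
    note p = this
    from g show ?case
    proof (induction g rule: poly_mapping_carrier_induct)
      case (single q d)
      note q = this
      from h show ?case
      proof (induction h rule: poly_mapping_carrier_induct)
        case (single r e)
        with p q show ?case
          by (cases p; cases q; cases r) (auto simp: A.m_assoc B.m_assoc mult.assoc)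
      qed (auto simp: free_product_mult_add_right)
    qed (auto simp: free_product_mult_add_right free_product_mult_add_left)
  qed (auto simp: free_product_mult_add_left)
  have comm: "f \<otimes>\<^bsub>?F\<^esub> g = g \<otimes>\<^bsub>?F\<^esub> f"
    if f: "Poly_Mapping.keys f \<subseteq> carrier A \<times> carrier B" and g: "Poly_Mapping.keys g \<subseteq> carrier A \<times> carrier B"
      for f g
    using f
  proof (induction f rule: poly_mapping_carrier_induct)
    case (single p c)
    note p = this
    from g show ?case
    proof (induction g rule: poly_mapping_carrier_induct)
      case (single q d)
      with p show ?case by (cases p; cases q) (auto simp: A.m_comm B.m_comm mult.commute)
    qed (auto simp: free_product_mult_add_right free_product_mult_add_left)
  qed (auto simp: free_product_mult_add_right free_product_mult_add_left)
  have one: "Poly_Mapping.single (\<one>\<^bsub>A\<^esub>, \<one>\<^bsub>B\<^esub>) 1 \<otimes>\<^bsub>?F\<^esub> f = f"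
    if f: "Poly_Mapping.keys f \<subseteq> carrier A \<times> carrier B" for f
    using f
    by (induction f rule: poly_mapping_carrier_induct) (auto simp: free_product_mult_add_right)
  show ?thesis
  proof (rule cringI)
    show "abelian_group ?F"
    proof (rule abelian_groupI)
      show "\<exists>y\<in>carrier ?F. y \<oplus>\<^bsub>?F\<^esub> f = \<zero>\<^bsub>?F\<^esub>" if "f \<in> carrier ?F" for f
        using that by (intro bexI[of _ "- f"]) auto
    qed (auto simp: keys_add_subset ac_simps)
    show "comm_monoid ?F"
    proof (rule comm_monoidI)
      fix f g h assume "f \<in> carrier ?F" "g \<in> carrier ?F" "h \<in> carrier ?F"
      then have fgh: "Poly_Mapping.keys f \<subseteq> carrier A \<times> carrier B"
          "Poly_Mapping.keys g \<subseteq> carrier A \<times> carrier B"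
          "Poly_Mapping.keys h \<subseteq> carrier A \<times> carrier B" by simp_all
      show "f \<otimes>\<^bsub>?F\<^esub> g \<in> carrier ?F" using closed[OF fgh(1,2)] by simp
      show "f \<otimes>\<^bsub>?F\<^esub> g \<otimes>\<^bsub>?F\<^esub> h = f \<otimes>\<^bsub>?F\<^esub> (g \<otimes>\<^bsub>?F\<^esub> h)" by (rule assoc[OF fgh])
      show "\<one>\<^bsub>?F\<^esub> \<otimes>\<^bsub>?F\<^esub> f = f" using one[OF fgh(1)] by simp
      show "f \<otimes>\<^bsub>?F\<^esub> g = g \<otimes>\<^bsub>?F\<^esub> f" by (rule comm[OF fgh(1,2)])
    qed (auto split: if_splits)
  qed (auto simp: free_product_mult_add_left)
qed

section \<open>Linear maps and algebra homomorphisms\<close>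

definition linear_maps :: "('k::field, 'a) module \<Rightarrow> ('k, 'r) module \<Rightarrow> ('a \<Rightarrow> 'r) set" where
  "linear_maps A R = {x \<in> carrier A \<rightarrow> carrier R.
     (\<forall>a\<in>carrier A. \<forall>b\<in>carrier A. x (a \<oplus>\<^bsub>A\<^esub> b) = x a \<oplus>\<^bsub>R\<^esub> x b) \<and>
     (\<forall>c. \<forall>a\<in>carrier A. x (c \<odot>\<^bsub>A\<^esub> a) = c \<odot>\<^bsub>R\<^esub> x a)}"

lemma linear_mapsD:
  assumes "x \<in> linear_maps A R"
  shows "a \<in> carrier A \<Longrightarrow> x a \<in> carrier R"
    and "a \<in> carrier A \<Longrightarrow> b \<in> carrier A \<Longrightarrow> x (a \<oplus>\<^bsub>A\<^esub> b) = x a \<oplus>\<^bsub>R\<^esub> x b"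
    and "a \<in> carrier A \<Longrightarrow> x (c \<odot>\<^bsub>A\<^esub> a) = c \<odot>\<^bsub>R\<^esub> x a"
  using assms by (auto simp: linear_maps_def)

lemma linear_maps_zero:
  assumes A: "algebra base_field A" and R: "algebra base_field R" and x: "x \<in> linear_maps A R"
  shows "x \<zero>\<^bsub>A\<^esub> = \<zero>\<^bsub>R\<^esub>"
proof -
  interpret A: algebra base_field A by fact
  interpret R: algebra base_field R by fact
  have "0 \<odot>\<^bsub>A\<^esub> \<zero>\<^bsub>A\<^esub> = \<zero>\<^bsub>A\<^esub>"
    using A.smult_l_null[OF A.zero_closed] by (simp only: base_field_simps)
  moreover have "0 \<odot>\<^bsub>R\<^esub> x \<zero>\<^bsub>A\<^esub> = \<zero>\<^bsub>R\<^esub>"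
    using R.smult_l_null[OF linear_mapsD(1)[OF x A.zero_closed]] by (simp only: base_field_simps)
  ultimately show ?thesis
    using linear_mapsD(3)[OF x A.zero_closed, of 0] by (simp only:)
qed

lemma alg_homD:
  assumes "h \<in> alg_hom A B"
  shows "a \<in> carrier A \<Longrightarrow> h a \<in> carrier B"
    and "a \<in> carrier A \<Longrightarrow> b \<in> carrier A \<Longrightarrow> h (a \<oplus>\<^bsub>A\<^esub> b) = h a \<oplus>\<^bsub>B\<^esub> h b"
    and "a \<in> carrier A \<Longrightarrow> b \<in> carrier A \<Longrightarrow> h (a \<otimes>\<^bsub>A\<^esub> b) = h a \<otimes>\<^bsub>B\<^esub> h b"
    and "h \<one>\<^bsub>A\<^esub> = \<one>\<^bsub>B\<^esub>"
    and "a \<in> carrier A \<Longrightarrow> h (c \<odot>\<^bsub>A\<^esub> a) = c \<odot>\<^bsub>B\<^esub> h a"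
    and "h \<in> extensional (carrier A)"
  using assms by (auto simp: alg_hom_def ring_hom_def)

lemma alg_homI:
  assumes "\<And>a. a \<in> carrier A \<Longrightarrow> h a \<in> carrier B"
    and "\<And>a b. a \<in> carrier A \<Longrightarrow> b \<in> carrier A \<Longrightarrow> h (a \<oplus>\<^bsub>A\<^esub> b) = h a \<oplus>\<^bsub>B\<^esub> h b"
    and "\<And>a b. a \<in> carrier A \<Longrightarrow> b \<in> carrier A \<Longrightarrow> h (a \<otimes>\<^bsub>A\<^esub> b) = h a \<otimes>\<^bsub>B\<^esub> h b"
    and "h \<one>\<^bsub>A\<^esub> = \<one>\<^bsub>B\<^esub>"
    and "\<And>c a. a \<in> carrier A \<Longrightarrow> h (c \<odot>\<^bsub>A\<^esub> a) = c \<odot>\<^bsub>B\<^esub> h a"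
    and "h \<in> extensional (carrier A)"
  shows "h \<in> alg_hom A B"
  using assms by (auto simp: alg_hom_def ring_hom_def)

lemma alg_hom_linear: "h \<in> alg_hom A B \<Longrightarrow> h \<in> linear_maps A B"
  by (auto simp: alg_hom_def linear_maps_def ring_hom_def)

lemma alg_hom_compose:
  assumes "g \<in> alg_hom A B" "h \<in> alg_hom B C" and A: "algebra base_field A"
  shows "compose (carrier A) h g \<in> alg_hom A C"
proof -
  interpret A: algebra base_field A by fact
  show ?thesis
    using alg_homD[OF assms(1)] alg_homD[OF assms(2)] by (intro alg_homI) (auto simp: compose_def)
qed

section \<open>Tensor products and their universal property\<close>

text \<open>The linear extension of \<open>(a, b) \<mapsto> x a \<cdot> y b\<close> to the free vector space; \<^const>\<open>tensor_map\<close> is what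
  it induces on cosets.\<close>

definition free_product_extend ::
    "('k::field, 'r) module \<Rightarrow> ('a \<Rightarrow> 'r) \<Rightarrow> ('b \<Rightarrow> 'r) \<Rightarrow> (('a \<times> 'b) \<Rightarrow>\<^sub>0 'k) \<Rightarrow> 'r" where
  "free_product_extend R x y f =
     (\<Oplus>\<^bsub>R\<^esub>p\<in>Poly_Mapping.keys f. Poly_Mapping.lookup f p \<odot>\<^bsub>R\<^esub> (x (fst p) \<otimes>\<^bsub>R\<^esub> y (snd p)))"

locale tensor_algebras =
  fixes A :: "('k::field, 'a) module" and B :: "('k, 'b) module"
  assumes A: "algebra base_field A" and B: "algebra base_field B"
begin

sublocale A: algebra base_field A by (rule A)
sublocale B: algebra base_field B by (rule B)

abbreviation "F \<equiv> free_product_algebra A B"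
abbreviation "K \<equiv> carrier A \<times> carrier B"

sublocale F: cring F by (rule cring_free_product[OF A B])

lemma F_minus: "Poly_Mapping.keys f \<subseteq> K \<Longrightarrow> \<ominus>\<^bsub>F\<^esub> f = - f"
  using F.minus_equality[of "- f" f] by simp

lemma mult_diff_right:
  "g \<otimes>\<^bsub>F\<^esub> (f - f') = g \<otimes>\<^bsub>F\<^esub> f - g \<otimes>\<^bsub>F\<^esub> f'"
  using free_product_mult_add_right[of A B g "f - f'" f'] by (simp add: algebra_simps)

lemma tensor_relations_carrier: "tensor_relations A B \<subseteq> carrier F"
  unfolding tensor_relations_def
  by (auto split: if_splits dest!: subsetD[OF keys_diff])

lemma ideal_tensor_ideal: "ideal (tensor_ideal A B) F"
  unfolding tensor_ideal_def by (rule F.genideal_ideal[OF tensor_relations_carrier])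

sublocale I: ideal "tensor_ideal A B" F by (rule ideal_tensor_ideal)

abbreviation cls where "cls f \<equiv> a_r_coset F (tensor_ideal A B) f"

lemma carrier_tensor: "carrier (tensor A B) = cls ` {f. Poly_Mapping.keys f \<subseteq> K}"
  by (auto simp: tensor_def Let_def FactRing_def A_RCOSETS_def')

lemma tensor_ops:
  "monoid.mult (tensor A B) = monoid.mult (F Quot tensor_ideal A B)"
  "one (tensor A B) = one (F Quot tensor_ideal A B)"
  "ring.zero (tensor A B) = ring.zero (F Quot tensor_ideal A B)"
  "add (tensor A B) = add (F Quot tensor_ideal A B)"
  "carrier (tensor A B) = carrier (F Quot tensor_ideal A B)"
  by (simp_all add: tensor_def Let_def)

lemma cls_mult:
  assumes "Poly_Mapping.keys f \<subseteq> K" "Poly_Mapping.keys g \<subseteq> K"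
  shows "cls f \<otimes>\<^bsub>tensor A B\<^esub> cls g = cls (f \<otimes>\<^bsub>F\<^esub> g)"
  using ring_hom_mult[OF I.rcos_ring_hom] assms by (simp add: tensor_ops)

lemma cls_add:
  assumes "Poly_Mapping.keys f \<subseteq> K" "Poly_Mapping.keys g \<subseteq> K"
  shows "cls f \<oplus>\<^bsub>tensor A B\<^esub> cls g = cls (f + g)"
  using ring_hom_add[OF I.rcos_ring_hom] assms by (simp add: tensor_ops)

lemma cls_one: "\<one>\<^bsub>tensor A B\<^esub> = cls (Poly_Mapping.single (\<one>\<^bsub>A\<^esub>, \<one>\<^bsub>B\<^esub>) 1)"
  using ring_hom_one[OF I.rcos_ring_hom] by (simp add: tensor_ops)

lemma cls_smult:
  assumes "Poly_Mapping.keys f \<subseteq> K"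
  shows "c \<odot>\<^bsub>tensor A B\<^esub> cls f = cls (Poly_Mapping.single (\<one>\<^bsub>A\<^esub>, \<one>\<^bsub>B\<^esub>) c \<otimes>\<^bsub>F\<^esub> f)"
proof -
  have "c \<odot>\<^bsub>tensor A B\<^esub> cls f = cls (Poly_Mapping.single (\<one>\<^bsub>A\<^esub>, \<one>\<^bsub>B\<^esub>) c) \<otimes>\<^bsub>tensor A B\<^esub> cls f"
    by (simp add: tensor_def Let_def)
  also have "\<dots> = cls (Poly_Mapping.single (\<one>\<^bsub>A\<^esub>, \<one>\<^bsub>B\<^esub>) c \<otimes>\<^bsub>F\<^esub> f)"
    using assms by (intro cls_mult) (auto split: if_splits)
  finally show ?thesis .
qed

lemma cls_eqI:
  assumes "f - g \<in> tensor_ideal A B" "Poly_Mapping.keys f \<subseteq> K" "Poly_Mapping.keys g \<subseteq> K"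
  shows "cls f = cls g"
proof -
  have "f \<ominus>\<^bsub>F\<^esub> g = f - g" using assms by (simp add: a_minus_def F_minus)
  then show ?thesis using assms F.quotient_eq_iff_same_a_r_cos[OF ideal_tensor_ideal, of f g] by simp
qed

lemma cring_tensor: "cring (tensor A B)"
proof -
  interpret Q: cring "F Quot tensor_ideal A B"
    by (rule I.quotient_is_cring[OF F.is_cring])
  show ?thesis
  proof (rule cringI)
    show "abelian_group (tensor A B)"
    proof (rule abelian_groupI)
      fix s assume "s \<in> carrier (tensor A B)"
      then show "\<exists>t\<in>carrier (tensor A B). t \<oplus>\<^bsub>tensor A B\<^esub> s = \<zero>\<^bsub>tensor A B\<^esub>"
        unfolding tensor_ops using Q.l_neg Q.a_inv_closed by blast
    qed (simp_all add: tensor_ops Q.a_ac)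
    show "comm_monoid (tensor A B)"
      by (rule comm_monoidI) (simp_all add: tensor_ops Q.m_ac)
  qed (simp_all add: tensor_ops Q.l_distr)
qed

lemma keys_single_one: "Poly_Mapping.keys (Poly_Mapping.single (\<one>\<^bsub>A\<^esub>, \<one>\<^bsub>B\<^esub>) c) \<subseteq> K"
  by (auto split: if_splits)

lemma algebra_tensor: "algebra base_field (tensor A B)"
proof (rule algebraI)
  show "cring (base_field :: 'k ring)" by (rule cring_from_type_algebra)
  show T: "cring (tensor A B)" by (rule cring_tensor)
  interpret T: cring "tensor A B" by fact
  note closed = free_product_mult_closed[OF A B]
  fix c d s t
  assume "s \<in> carrier (tensor A B)" "t \<in> carrier (tensor A B)"
  then obtain f g where fg: "s = cls f" "t = cls g" "Poly_Mapping.keys f \<subseteq> K" "Poly_Mapping.keys g \<subseteq> K"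
    by (auto simp: carrier_tensor)
  note simps = fg cls_smult cls_add cls_mult cls_one closed keys_single_one keys_add_subset
  show "c \<odot>\<^bsub>tensor A B\<^esub> s \<in> carrier (tensor A B)"
    using fg by (auto simp: cls_smult carrier_tensor closed keys_single_one intro!: imageI)
  show "(c \<oplus>\<^bsub>base_field\<^esub> d) \<odot>\<^bsub>tensor A B\<^esub> s = c \<odot>\<^bsub>tensor A B\<^esub> s \<oplus>\<^bsub>tensor A B\<^esub> d \<odot>\<^bsub>tensor A B\<^esub> s"
    by (simp add: simps single_add free_product_mult_add_left)
  show "c \<odot>\<^bsub>tensor A B\<^esub> (s \<oplus>\<^bsub>tensor A B\<^esub> t) = c \<odot>\<^bsub>tensor A B\<^esub> s \<oplus>\<^bsub>tensor A B\<^esub> c \<odot>\<^bsub>tensor A B\<^esub> t"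
    by (simp add: simps free_product_mult_add_right)
  have "Poly_Mapping.single (\<one>\<^bsub>A\<^esub>, \<one>\<^bsub>B\<^esub>) c \<otimes>\<^bsub>F\<^esub> (Poly_Mapping.single (\<one>\<^bsub>A\<^esub>, \<one>\<^bsub>B\<^esub>) d \<otimes>\<^bsub>F\<^esub> f) =
      Poly_Mapping.single (\<one>\<^bsub>A\<^esub>, \<one>\<^bsub>B\<^esub>) (c * d) \<otimes>\<^bsub>F\<^esub> f"
    using F.m_assoc[of "Poly_Mapping.single (\<one>\<^bsub>A\<^esub>, \<one>\<^bsub>B\<^esub>) c" "Poly_Mapping.single (\<one>\<^bsub>A\<^esub>, \<one>\<^bsub>B\<^esub>) d" f] fg
    by (simp add: keys_single_one)
  then show "(c \<otimes>\<^bsub>base_field\<^esub> d) \<odot>\<^bsub>tensor A B\<^esub> s = c \<odot>\<^bsub>tensor A B\<^esub> (d \<odot>\<^bsub>tensor A B\<^esub> s)"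
    by (simp add: simps)
  show "\<one>\<^bsub>base_field\<^esub> \<odot>\<^bsub>tensor A B\<^esub> s = s"
    using F.l_one[of f] by (simp add: simps)
  show "(c \<odot>\<^bsub>tensor A B\<^esub> s) \<otimes>\<^bsub>tensor A B\<^esub> t = c \<odot>\<^bsub>tensor A B\<^esub> (s \<otimes>\<^bsub>tensor A B\<^esub> t)"
    using F.m_assoc[of "Poly_Mapping.single (\<one>\<^bsub>A\<^esub>, \<one>\<^bsub>B\<^esub>) c" f g] fg
    by (simp add: simps)
qed

sublocale T: algebra base_field "tensor A B" by (rule algebra_tensor)

lemma relation_in_ideal: "r \<in> tensor_relations A B \<Longrightarrow> r \<in> tensor_ideal A B"
  unfolding tensor_ideal_def using F.genideal_self[OF tensor_relations_carrier] by blast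

lemma keys_single_K: "a \<in> carrier A \<Longrightarrow> b \<in> carrier B \<Longrightarrow> Poly_Mapping.keys (Poly_Mapping.single (a, b) c) \<subseteq> K"
  by (auto split: if_splits)

lemma pure_closed [simp]:
  "a \<in> carrier A \<Longrightarrow> b \<in> carrier B \<Longrightarrow> pure_tensor A B a b \<in> carrier (tensor A B)"
  by (auto simp: pure_tensor_def carrier_tensor keys_single_K intro!: imageI)

lemma cls_single:
  assumes "a \<in> carrier A" "b \<in> carrier B"
  shows "cls (Poly_Mapping.single (a, b) c) = pure_tensor A B (c \<odot>\<^bsub>A\<^esub> a) b"
    and "cls (Poly_Mapping.single (a, b) c) = pure_tensor A B a (c \<odot>\<^bsub>B\<^esub> b)"
proof -
  show "cls (Poly_Mapping.single (a, b) c) = pure_tensor A B (c \<odot>\<^bsub>A\<^esub> a) b"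
    unfolding pure_tensor_def
    using assms by (intro cls_eqI[symmetric] relation_in_ideal) (auto simp: tensor_relations_def)
  show "cls (Poly_Mapping.single (a, b) c) = pure_tensor A B a (c \<odot>\<^bsub>B\<^esub> b)"
    unfolding pure_tensor_def
    using assms by (intro cls_eqI[symmetric] relation_in_ideal) (auto simp: tensor_relations_def)
qed

lemma pure_smult:
  assumes "a \<in> carrier A" "b \<in> carrier B"
  shows "c \<odot>\<^bsub>tensor A B\<^esub> pure_tensor A B a b = pure_tensor A B (c \<odot>\<^bsub>A\<^esub> a) b"
    and "c \<odot>\<^bsub>tensor A B\<^esub> pure_tensor A B a b = pure_tensor A B a (c \<odot>\<^bsub>B\<^esub> b)"
proof -
  have "c \<odot>\<^bsub>tensor A B\<^esub> pure_tensor A B a b = cls (Poly_Mapping.single (a, b) c)"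
    using assms by (simp add: pure_tensor_def cls_smult keys_single_K)
  then show "c \<odot>\<^bsub>tensor A B\<^esub> pure_tensor A B a b = pure_tensor A B (c \<odot>\<^bsub>A\<^esub> a) b"
    "c \<odot>\<^bsub>tensor A B\<^esub> pure_tensor A B a b = pure_tensor A B a (c \<odot>\<^bsub>B\<^esub> b)"
    using cls_single[OF assms] by simp_all
qed

lemma pure_add_left:
  assumes "a \<in> carrier A" "a' \<in> carrier A" "b \<in> carrier B"
  shows "pure_tensor A B (a \<oplus>\<^bsub>A\<^esub> a') b = pure_tensor A B a b \<oplus>\<^bsub>tensor A B\<^esub> pure_tensor A B a' b"
proof -
  have "Poly_Mapping.single (a \<oplus>\<^bsub>A\<^esub> a', b) 1 - (Poly_Mapping.single (a, b) 1 + Poly_Mapping.single (a', b) 1)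
      \<in> tensor_relations A B"
    using assms by (auto simp: tensor_relations_def diff_diff_eq)
  then show ?thesis using assms
    unfolding pure_tensor_def cls_add[OF keys_single_K keys_single_K, OF assms(1,3) assms(2,3)]
    by (intro cls_eqI relation_in_ideal keys_add_subset keys_single_K) simp_all
qed

lemma pure_add_right:
  assumes "a \<in> carrier A" "b \<in> carrier B" "b' \<in> carrier B"
  shows "pure_tensor A B a (b \<oplus>\<^bsub>B\<^esub> b') = pure_tensor A B a b \<oplus>\<^bsub>tensor A B\<^esub> pure_tensor A B a b'"
proof -
  have "Poly_Mapping.single (a, b \<oplus>\<^bsub>B\<^esub> b') 1 - (Poly_Mapping.single (a, b) 1 + Poly_Mapping.single (a, b') 1)
      \<in> tensor_relations A B"
    using assms by (auto simp: tensor_relations_def diff_diff_eq)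
  then show ?thesis using assms
    unfolding pure_tensor_def cls_add[OF keys_single_K keys_single_K, OF assms(1,2) assms(1,3)]
    by (intro cls_eqI relation_in_ideal keys_add_subset keys_single_K) simp_all
qed

lemma pure_mult:
  assumes "a \<in> carrier A" "b \<in> carrier B" "a' \<in> carrier A" "b' \<in> carrier B"
  shows "pure_tensor A B a b \<otimes>\<^bsub>tensor A B\<^esub> pure_tensor A B a' b' =
    pure_tensor A B (a \<otimes>\<^bsub>A\<^esub> a') (b \<otimes>\<^bsub>B\<^esub> b')"
  using assms by (simp add: pure_tensor_def cls_mult keys_single_K)

lemma pure_one: "\<one>\<^bsub>tensor A B\<^esub> = pure_tensor A B \<one>\<^bsub>A\<^esub> \<one>\<^bsub>B\<^esub>"
  by (simp add: pure_tensor_def cls_one)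

text \<open>Scalars can be moved into the first factor, so sums of pure tensors exhaust the tensor
  product; in particular \<open>0\<close> is itself pure.\<close>

lemma tensor_induct [consumes 1, case_names pure add]:
  assumes t: "t \<in> carrier (tensor A B)"
    and pure: "\<And>a b. a \<in> carrier A \<Longrightarrow> b \<in> carrier B \<Longrightarrow> P (pure_tensor A B a b)"
    and add: "\<And>s t. s \<in> carrier (tensor A B) \<Longrightarrow> t \<in> carrier (tensor A B) \<Longrightarrow> P s \<Longrightarrow> P t \<Longrightarrow>
      P (s \<oplus>\<^bsub>tensor A B\<^esub> t)"
  shows "P t"
proof -
  obtain f where f: "Poly_Mapping.keys f \<subseteq> K" "t = cls f" using t by (auto simp: carrier_tensor)
  have "P (cls f)" using f(1)
  proof (induction f rule: poly_mapping_carrier_induct)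
    case zero
    show ?case
      using cls_single(1)[of "\<one>\<^bsub>A\<^esub>" "\<one>\<^bsub>B\<^esub>" 0] pure[of "0 \<odot>\<^bsub>A\<^esub> \<one>\<^bsub>A\<^esub>" "\<one>\<^bsub>B\<^esub>"] by simp
  next
    case (add f g)
    then show ?case
      using assms(3)[of "cls f" "cls g"] cls_add[of f g] by (auto simp: carrier_tensor)
  next
    case (single p c)
    then show ?case
      using cls_single(1)[of "fst p" "snd p" c] pure[of "c \<odot>\<^bsub>A\<^esub> fst p" "snd p"] by (cases p) auto
  qed
  with f show ?thesis by simp
qed

lemma tensor_maps_eqI:
  assumes R: "algebra base_field R"
    and s: "\<phi> \<in> linear_maps (tensor A B) R" "\<psi> \<in> linear_maps (tensor A B) R"
    and "\<And>a b. a \<in> carrier A \<Longrightarrow> b \<in> carrier B \<Longrightarrow> \<phi> (pure_tensor A B a b) = \<psi> (pure_tensor A B a b)"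
    and t: "t \<in> carrier (tensor A B)"
  shows "\<phi> t = \<psi> t"
  using t
proof (induction t rule: tensor_induct)
  case (add s t)
  then show ?case using linear_mapsD(2)[OF assms(2)] linear_mapsD(2)[OF assms(3)] by simp
qed (use assms in auto)

end

locale tensor_linear = tensor_algebras A B for A :: "('k::field, 'a) module" and B :: "('k, 'b) module" +
  fixes R :: "('k, 'r) module" and x :: "'a \<Rightarrow> 'r" and y :: "'b \<Rightarrow> 'r"
  assumes R: "algebra base_field R" and x: "x \<in> linear_maps A R" and y: "y \<in> linear_maps B R"
begin

sublocale R: algebra base_field R by (rule R)

lemmas x_simps [simp] = linear_mapsD[OF x]
lemmas y_simps [simp] = linear_mapsD[OF y]

abbreviation "L \<equiv> free_product_extend R x y"

lemma smult_zero_left: "r \<in> carrier R \<Longrightarrow> 0 \<odot>\<^bsub>R\<^esub> r = \<zero>\<^bsub>R\<^esub>"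
  using R.smult_l_null[of r] by (simp only: base_field_simps)

lemma smult_add: "r \<in> carrier R \<Longrightarrow> (c + d) \<odot>\<^bsub>R\<^esub> r = c \<odot>\<^bsub>R\<^esub> r \<oplus>\<^bsub>R\<^esub> d \<odot>\<^bsub>R\<^esub> r"
  using R.smult_l_distr[of c d r] by (simp only: base_field_simps UNIV_I)

lemma smult_smult: "r \<in> carrier R \<Longrightarrow> c \<odot>\<^bsub>R\<^esub> (d \<odot>\<^bsub>R\<^esub> r) = (c * d) \<odot>\<^bsub>R\<^esub> r"
  using R.smult_assoc1[of c d r] by (simp only: base_field_simps UNIV_I)

lemma L_superset:
  assumes "finite S" "Poly_Mapping.keys f \<subseteq> S" "S \<subseteq> K"
  shows "L f = (\<Oplus>\<^bsub>R\<^esub>p\<in>S. Poly_Mapping.lookup f p \<odot>\<^bsub>R\<^esub> (x (fst p) \<otimes>\<^bsub>R\<^esub> y (snd p)))"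
  unfolding free_product_extend_def
proof (rule R.M.add.finprod_mono_neutral_cong_left)
  fix p assume "p \<in> S - Poly_Mapping.keys f"
  then show "Poly_Mapping.lookup f p \<odot>\<^bsub>R\<^esub> (x (fst p) \<otimes>\<^bsub>R\<^esub> y (snd p)) = \<zero>\<^bsub>R\<^esub>"
    using assms(3) by (auto simp: in_keys_iff intro!: smult_zero_left)
qed (use assms in auto)

lemma L_add:
  assumes "Poly_Mapping.keys f \<subseteq> K" "Poly_Mapping.keys g \<subseteq> K"
  shows "L (f + g) = L f \<oplus>\<^bsub>R\<^esub> L g"
proof -
  let ?S = "Poly_Mapping.keys f \<union> Poly_Mapping.keys g"
  have S: "finite ?S" "?S \<subseteq> K" using assms by auto
  have "L (f + g) = (\<Oplus>\<^bsub>R\<^esub>p\<in>?S. Poly_Mapping.lookup (f + g) p \<odot>\<^bsub>R\<^esub> (x (fst p) \<otimes>\<^bsub>R\<^esub> y (snd p)))"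
    using Poly_Mapping.keys_add[of f g] S by (intro L_superset) auto
  also have "\<dots> = (\<Oplus>\<^bsub>R\<^esub>p\<in>?S. Poly_Mapping.lookup f p \<odot>\<^bsub>R\<^esub> (x (fst p) \<otimes>\<^bsub>R\<^esub> y (snd p)) \<oplus>\<^bsub>R\<^esub>
      Poly_Mapping.lookup g p \<odot>\<^bsub>R\<^esub> (x (fst p) \<otimes>\<^bsub>R\<^esub> y (snd p)))"
    using S by (intro R.M.add.finprod_cong') (auto simp: lookup_add intro!: smult_add)
  also have "\<dots> = L f \<oplus>\<^bsub>R\<^esub> L g"
    using S by (subst R.M.finsum_addf) (auto simp: L_superset[of ?S])
  finally show ?thesis .
qed

lemma L_single:
  assumes "a \<in> carrier A" "b \<in> carrier B"
  shows "L (Poly_Mapping.single (a, b) c) = c \<odot>\<^bsub>R\<^esub> (x a \<otimes>\<^bsub>R\<^esub> y b)"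
  using assms by (subst L_superset[of "{(a, b)}"]) auto

lemma L_zero: "L 0 = \<zero>\<^bsub>R\<^esub>"
  by (simp add: free_product_extend_def)

lemma L_closed:
  assumes "Poly_Mapping.keys f \<subseteq> K"
  shows "L f \<in> carrier R"
  unfolding free_product_extend_def using assms by (intro R.M.finsum_closed) auto

lemma L_uminus:
  assumes "Poly_Mapping.keys f \<subseteq> K"
  shows "L (- f) = \<ominus>\<^bsub>R\<^esub> L f"
  using L_add[of "- f" f] L_closed[of f] L_closed[of "- f"] assms L_zero
  by (intro R.M.minus_equality[symmetric]) auto

lemma L_diff:
  assumes "Poly_Mapping.keys f \<subseteq> K" "Poly_Mapping.keys g \<subseteq> K"
  shows "L (f - g) = L f \<ominus>\<^bsub>R\<^esub> L g"
  using L_add[of f "- g"] L_uminus[of g] assms by (simp add: a_minus_def)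

end

context tensor_linear
begin

lemma A_mult_smult: "p \<in> carrier A \<Longrightarrow> a \<in> carrier A \<Longrightarrow> p \<otimes>\<^bsub>A\<^esub> (c \<odot>\<^bsub>A\<^esub> a) = c \<odot>\<^bsub>A\<^esub> (p \<otimes>\<^bsub>A\<^esub> a)"
  using A.smult_assoc2[of c a p] by (simp add: A.m_comm)

lemma B_mult_smult: "p \<in> carrier B \<Longrightarrow> a \<in> carrier B \<Longrightarrow> p \<otimes>\<^bsub>B\<^esub> (c \<odot>\<^bsub>B\<^esub> a) = c \<odot>\<^bsub>B\<^esub> (p \<otimes>\<^bsub>B\<^esub> a)"
  using B.smult_assoc2[of c a p] by (simp add: B.m_comm)

lemma R_mult_smult: "p \<in> carrier R \<Longrightarrow> a \<in> carrier R \<Longrightarrow> p \<otimes>\<^bsub>R\<^esub> (c \<odot>\<^bsub>R\<^esub> a) = c \<odot>\<^bsub>R\<^esub> (p \<otimes>\<^bsub>R\<^esub> a)"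
  using R.smult_assoc2[of c a p] by (simp add: R.m_comm)

lemma minus_minus_eq_zero:
  assumes "v \<in> carrier R" "w \<in> carrier R"
  shows "((v \<oplus>\<^bsub>R\<^esub> w) \<ominus>\<^bsub>R\<^esub> v) \<ominus>\<^bsub>R\<^esub> w = \<zero>\<^bsub>R\<^esub>"
proof -
  have "((v \<oplus>\<^bsub>R\<^esub> w) \<oplus>\<^bsub>R\<^esub> (\<ominus>\<^bsub>R\<^esub> v)) = w"
    using assms R.a_comm[of v w] R.a_assoc[of w v "\<ominus>\<^bsub>R\<^esub> v"] by (simp add: R.r_neg)
  then show ?thesis using assms by (simp add: a_minus_def R.r_neg)
qed

text \<open>A generator of the free algebra multiplies a bilinearity relation into a relation of the
  same kind, and \<open>L\<close> respects these because \<open>x\<close> and \<open>y\<close> are linear.\<close>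

lemma L_relation:
  assumes r: "r \<in> tensor_relations A B" and p: "p \<in> carrier A" and q: "q \<in> carrier B"
  shows "L (Poly_Mapping.single (p, q) c \<otimes>\<^bsub>F\<^esub> r) = \<zero>\<^bsub>R\<^esub>"
proof -
  consider
    (1) a a' b where "r = Poly_Mapping.single (a \<oplus>\<^bsub>A\<^esub> a', b) 1 - Poly_Mapping.single (a, b) 1
        - Poly_Mapping.single (a', b) 1" "a \<in> carrier A" "a' \<in> carrier A" "b \<in> carrier B"
  | (2) a b b' where "r = Poly_Mapping.single (a, b \<oplus>\<^bsub>B\<^esub> b') 1 - Poly_Mapping.single (a, b) 1
        - Poly_Mapping.single (a, b') 1" "a \<in> carrier A" "b' \<in> carrier B" "b \<in> carrier B"
  | (3) d a b where "r = Poly_Mapping.single (d \<odot>\<^bsub>A\<^esub> a, b) 1 - Poly_Mapping.single (a, b) d"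
      "a \<in> carrier A" "b \<in> carrier B"
  | (4) d a b where "r = Poly_Mapping.single (a, d \<odot>\<^bsub>B\<^esub> b) 1 - Poly_Mapping.single (a, b) d"
      "a \<in> carrier A" "b \<in> carrier B"
    using r unfolding tensor_relations_def by blast
  then show ?thesis
  proof cases
    case 1
    have "c \<odot>\<^bsub>R\<^esub> (x (p \<otimes>\<^bsub>A\<^esub> (a \<oplus>\<^bsub>A\<^esub> a')) \<otimes>\<^bsub>R\<^esub> y (q \<otimes>\<^bsub>B\<^esub> b)) =
      c \<odot>\<^bsub>R\<^esub> (x (p \<otimes>\<^bsub>A\<^esub> a) \<otimes>\<^bsub>R\<^esub> y (q \<otimes>\<^bsub>B\<^esub> b)) \<oplus>\<^bsub>R\<^esub> c \<odot>\<^bsub>R\<^esub> (x (p \<otimes>\<^bsub>A\<^esub> a') \<otimes>\<^bsub>R\<^esub> y (q \<otimes>\<^bsub>B\<^esub> b))"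
      using 1 p q by (simp add: A.r_distr R.l_distr R.smult_r_distr)
    with 1 p q show ?thesis
      by (simp add: mult_diff_right L_diff L_single keys_single_K order_trans[OF keys_diff] minus_minus_eq_zero)
  next
    case 2
    have "c \<odot>\<^bsub>R\<^esub> (x (p \<otimes>\<^bsub>A\<^esub> a) \<otimes>\<^bsub>R\<^esub> y (q \<otimes>\<^bsub>B\<^esub> (b \<oplus>\<^bsub>B\<^esub> b'))) =
      c \<odot>\<^bsub>R\<^esub> (x (p \<otimes>\<^bsub>A\<^esub> a) \<otimes>\<^bsub>R\<^esub> y (q \<otimes>\<^bsub>B\<^esub> b)) \<oplus>\<^bsub>R\<^esub> c \<odot>\<^bsub>R\<^esub> (x (p \<otimes>\<^bsub>A\<^esub> a) \<otimes>\<^bsub>R\<^esub> y (q \<otimes>\<^bsub>B\<^esub> b'))"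
      using 2 p q by (simp add: B.r_distr R.r_distr R.smult_r_distr)
    with 2 p q show ?thesis
      by (simp add: mult_diff_right L_diff L_single keys_single_K order_trans[OF keys_diff] minus_minus_eq_zero)
  next
    case 3
    have "c \<odot>\<^bsub>R\<^esub> (x (p \<otimes>\<^bsub>A\<^esub> (d \<odot>\<^bsub>A\<^esub> a)) \<otimes>\<^bsub>R\<^esub> y (q \<otimes>\<^bsub>B\<^esub> b)) =
      (c * d) \<odot>\<^bsub>R\<^esub> (x (p \<otimes>\<^bsub>A\<^esub> a) \<otimes>\<^bsub>R\<^esub> y (q \<otimes>\<^bsub>B\<^esub> b))"
      using 3 p q by (simp add: A_mult_smult R.smult_assoc2 smult_smult)
    with 3 p q show ?thesis
      by (simp add: mult_diff_right L_diff L_single keys_single_K a_minus_def R.r_neg)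
  next
    case 4
    have "c \<odot>\<^bsub>R\<^esub> (x (p \<otimes>\<^bsub>A\<^esub> a) \<otimes>\<^bsub>R\<^esub> y (q \<otimes>\<^bsub>B\<^esub> (d \<odot>\<^bsub>B\<^esub> b))) =
      (c * d) \<odot>\<^bsub>R\<^esub> (x (p \<otimes>\<^bsub>A\<^esub> a) \<otimes>\<^bsub>R\<^esub> y (q \<otimes>\<^bsub>B\<^esub> b))"
      using 4 p q by (simp add: B_mult_smult R_mult_smult smult_smult)
    with 4 p q show ?thesis
      by (simp add: mult_diff_right L_diff L_single keys_single_K a_minus_def R.r_neg)
  qed
qed

text \<open>The maps \<open>x\<close> and \<open>y\<close> are only linear, so the kernel of \<open>L\<close> need not be an ideal. The set of
  all \<open>f\<close> with \<open>L (h f) = 0\<close> for every \<open>h\<close> is one; it contains the relations, hence the ideal they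
  generate, and \<open>h = 1\<close> gives the claim.\<close>

lemma L_ideal:
  assumes "f \<in> tensor_ideal A B"
  shows "L f = \<zero>\<^bsub>R\<^esub>"
proof -
  note closed = free_product_mult_closed[OF A B]
  \<comment> \<open>the largest ideal contained in the kernel of \<open>L\<close>\<close>
  define J where "J = {f. Poly_Mapping.keys f \<subseteq> K \<and> (\<forall>h. Poly_Mapping.keys h \<subseteq> K \<longrightarrow> L (h \<otimes>\<^bsub>F\<^esub> f) = \<zero>\<^bsub>R\<^esub>)}"
  have "ideal J F"
  proof (rule idealI)
    show "ring F" by (rule F.ring_axioms)
    show "subgroup J (add_monoid F)"
    proof (rule F.add.subgroupI)
      show "J \<subseteq> carrier F" by (auto simp: J_def)
      have "0 \<in> J" by (simp add: J_def L_zero)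
      then show "J \<noteq> {}" by blast
      fix f assume f: "f \<in> J"
      then have fK: "Poly_Mapping.keys f \<subseteq> K" by (simp add: J_def)
      have "L (h \<otimes>\<^bsub>F\<^esub> (- f)) = \<zero>\<^bsub>R\<^esub>" if "Poly_Mapping.keys h \<subseteq> K" for h
        using f that mult_diff_right[of h 0 f] L_uminus[of "h \<otimes>\<^bsub>F\<^esub> f"] closed[of h f] fK
        by (simp add: J_def)
      then have "- f \<in> J" using fK by (simp add: J_def)
      then show "\<ominus>\<^bsub>F\<^esub> f \<in> J" using F_minus[OF fK] by simp
      fix g assume g: "g \<in> J"
      then have gK: "Poly_Mapping.keys g \<subseteq> K" by (simp add: J_def)
      show "f \<oplus>\<^bsub>F\<^esub> g \<in> J"
        using f g fK gK by (auto simp: J_def free_product_mult_add_right L_add closed keys_add_subset)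
    qed
    fix f g assume f: "f \<in> J" and g: "g \<in> carrier F"
    then have fK: "Poly_Mapping.keys f \<subseteq> K" and gK: "Poly_Mapping.keys g \<subseteq> K" by (simp_all add: J_def)
    have "L (h \<otimes>\<^bsub>F\<^esub> (g \<otimes>\<^bsub>F\<^esub> f)) = \<zero>\<^bsub>R\<^esub>" if "Poly_Mapping.keys h \<subseteq> K" for h
    proof -
      have "L ((h \<otimes>\<^bsub>F\<^esub> g) \<otimes>\<^bsub>F\<^esub> f) = \<zero>\<^bsub>R\<^esub>" using f closed[OF that gK] by (simp add: J_def)
      then show ?thesis using F.m_assoc[of h g f] that fK gK by simp
    qed
    then show *: "g \<otimes>\<^bsub>F\<^esub> f \<in> J" using closed[OF gK fK] by (simp add: J_def)
    then show "f \<otimes>\<^bsub>F\<^esub> g \<in> J" using F.m_comm[of f g] fK gK by simp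
  qed
  moreover have "tensor_relations A B \<subseteq> J"
  proof
    fix r assume r: "r \<in> tensor_relations A B"
    have rK: "Poly_Mapping.keys r \<subseteq> K" using subsetD[OF tensor_relations_carrier r] by simp
    have "L (h \<otimes>\<^bsub>F\<^esub> r) = \<zero>\<^bsub>R\<^esub>" if "Poly_Mapping.keys h \<subseteq> K" for h
      using that
    proof (induction h rule: poly_mapping_carrier_induct)
      case (single p c)
      then show ?case using L_relation[OF r] by (cases p) auto
    qed (simp_all add: L_zero free_product_mult_add_left L_add closed rK)
    with rK show "r \<in> J" by (simp add: J_def)
  qed
  ultimately have "tensor_ideal A B \<subseteq> J"
    unfolding tensor_ideal_def by (rule F.genideal_minimal)
  with assms have f: "f \<in> J" by blast
  then have fK: "Poly_Mapping.keys f \<subseteq> K" by (simp add: J_def)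
  have "L (\<one>\<^bsub>F\<^esub> \<otimes>\<^bsub>F\<^esub> f) = \<zero>\<^bsub>R\<^esub>" using f by (simp add: J_def keys_single_one)
  then show ?thesis using F.l_one[of f] fK by simp
qed

lemma tensor_map_cls:
  assumes f: "Poly_Mapping.keys f \<subseteq> K"
  shows "tensor_map A B R x y (cls f) = L f"
proof -
  have "L (i + f) = L f" if "i \<in> tensor_ideal A B" for i
    using L_add[of i f] L_ideal[OF that] I.a_subset that f L_closed[OF f] by auto
  moreover have "tensor_ideal A B \<noteq> {}" using I.zero_closed by blast
  ultimately have "L ` cls f = {L f}"
    unfolding a_r_coset_def' by (auto simp: image_iff)
  moreover have "cls f \<in> carrier (tensor A B)" using f by (auto simp: carrier_tensor)
  ultimately show ?thesis
    unfolding tensor_map_def by (simp add: free_product_extend_def[abs_def])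
qed

lemma tensor_map_pure':
  assumes "a \<in> carrier A" "b \<in> carrier B"
  shows "tensor_map A B R x y (pure_tensor A B a b) = x a \<otimes>\<^bsub>R\<^esub> y b"
  using assms tensor_map_cls[OF keys_single_K[OF assms, of 1]]
  by (simp add: pure_tensor_def L_single R.smult_one[simplified])

lemma tensor_map_linear': "tensor_map A B R x y \<in> linear_maps (tensor A B) R"
proof -
  have "L (Poly_Mapping.single (\<one>\<^bsub>A\<^esub>, \<one>\<^bsub>B\<^esub>) c \<otimes>\<^bsub>F\<^esub> f) = c \<odot>\<^bsub>R\<^esub> L f" if "Poly_Mapping.keys f \<subseteq> K" for c f
    using that
  proof (induction f rule: poly_mapping_carrier_induct)
    case zero
    then show ?case using R.smult_r_null[of c] by (simp add: L_zero)
  next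
    case (add f g)
    then show ?case
      by (simp add: free_product_mult_add_right L_add free_product_mult_closed[OF A B] keys_single_one
          R.smult_r_distr L_closed)
  next
    case (single p d)
    then show ?case by (cases p) (simp add: L_single smult_smult)
  qed
  then show ?thesis
    unfolding linear_maps_def
    by (auto simp: carrier_tensor cls_add cls_smult tensor_map_cls L_closed L_add keys_add_subset
        free_product_mult_closed[OF A B] keys_single_one)
qed

end

lemma tensor_map_pure:
  assumes "algebra base_field A" "algebra base_field B" "algebra base_field R"
    and "x \<in> linear_maps A R" "y \<in> linear_maps B R" "a \<in> carrier A" "b \<in> carrier B"
  shows "tensor_map A B R x y (pure_tensor A B a b) = x a \<otimes>\<^bsub>R\<^esub> y b"
  using assms by (intro tensor_linear.tensor_map_pure' tensor_linear.intro tensor_algebras.intro tensor_linear_axioms.intro)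

lemma tensor_map_linear:
  assumes "algebra base_field A" "algebra base_field B" "algebra base_field R"
    and "x \<in> linear_maps A R" "y \<in> linear_maps B R"
  shows "tensor_map A B R x y \<in> linear_maps (tensor A B) R"
  using assms by (intro tensor_linear.tensor_map_linear' tensor_linear.intro tensor_algebras.intro tensor_linear_axioms.intro)

lemmas tensor_induct [consumes 3, case_names pure add] = tensor_algebras.tensor_induct[OF tensor_algebras.intro]
lemmas pure_mult = tensor_algebras.pure_mult[OF tensor_algebras.intro]
lemmas pure_closed = tensor_algebras.pure_closed[OF tensor_algebras.intro]
lemmas pure_one = tensor_algebras.pure_one[OF tensor_algebras.intro]
lemmas pure_smult = tensor_algebras.pure_smult[OF tensor_algebras.intro]
lemmas pure_add_left = tensor_algebras.pure_add_left[OF tensor_algebras.intro]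
lemmas pure_add_right = tensor_algebras.pure_add_right[OF tensor_algebras.intro]
lemmas algebra_tensor = tensor_algebras.algebra_tensor[OF tensor_algebras.intro]
lemmas tensor_maps_eqI = tensor_algebras.tensor_maps_eqI[OF tensor_algebras.intro]

section \<open>Operations on points\<close>

lemma tensor_map_extensional: "tensor_map A B R x y \<in> extensional (carrier (tensor A B))"
  by (simp add: tensor_map_def)

text \<open>Commutativity of \<open>R\<close> enters here: \<open>x a y b x a' y b' = x (a a') y (b b')\<close>.\<close>

lemma tensor_map_alg_hom:
  assumes A: "algebra base_field A" and B: "algebra base_field B" and R: "algebra base_field R"
    and x: "x \<in> alg_hom A R" and y: "y \<in> alg_hom B R"
  shows "tensor_map A B R x y \<in> alg_hom (tensor A B) R"
proof -
  interpret A: algebra base_field A by fact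
  interpret B: algebra base_field B by fact
  interpret R: algebra base_field R by fact
  interpret T: algebra base_field "tensor A B" by (rule algebra_tensor[OF A B])
  let ?t = "tensor_map A B R x y"
  note lin = tensor_map_linear[OF A B R alg_hom_linear[OF x] alg_hom_linear[OF y]]
  note pure = tensor_map_pure[OF A B R alg_hom_linear[OF x] alg_hom_linear[OF y]]
  note [simp] = alg_homD[OF x] alg_homD[OF y] linear_mapsD[OF lin] pure pure_closed[OF A B]
  have mult: "?t (s \<otimes>\<^bsub>tensor A B\<^esub> t) = ?t s \<otimes>\<^bsub>R\<^esub> ?t t"
    if s: "s \<in> carrier (tensor A B)" and t: "t \<in> carrier (tensor A B)" for s t
    using A B s
  proof (induction s rule: tensor_induct)
    case (pure a b)
    note ab = this
    from A B t show ?case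
    proof (induction t rule: tensor_induct)
      case (pure a' b')
      with ab show ?case by (simp add: pure_mult[OF A B] R.m_ac)
    next
      case (add s t)
      with ab show ?case by (simp add: T.r_distr R.r_distr)
    qed
  next
    case (add s s')
    with t show ?case by (simp add: T.l_distr R.l_distr)
  qed
  show ?thesis
    by (intro alg_homI mult) (simp_all add: pure_one[OF A B] tensor_map_extensional)
qed

lemma tensor_inl_alg_hom:
  assumes A: "algebra base_field A" and B: "algebra base_field B"
  shows "tensor_inl A B \<in> alg_hom A (tensor A B)"
proof -
  interpret A: algebra base_field A by fact
  interpret B: algebra base_field B by fact
  show ?thesis
    by (intro alg_homI)
       (simp_all add: tensor_inl_def pure_closed[OF A B] pure_one[OF A B] pure_add_left[OF A B]
          pure_mult[OF A B] pure_smult(1)[OF A B])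
qed

lemma tensor_inr_alg_hom:
  assumes A: "algebra base_field A" and B: "algebra base_field B"
  shows "tensor_inr A B \<in> alg_hom B (tensor A B)"
proof -
  interpret A: algebra base_field A by fact
  interpret B: algebra base_field B by fact
  show ?thesis
    by (intro alg_homI)
       (simp_all add: tensor_inr_def pure_closed[OF A B] pure_one[OF A B] pure_add_right[OF A B]
          pure_mult[OF A B] pure_smult(2)[OF A B])
qed

lemma tensor_map_inl:
  assumes A: "algebra base_field A" and B: "algebra base_field B" and R: "algebra base_field R"
    and x: "x \<in> alg_hom A R" and y: "y \<in> alg_hom B R"
  shows "compose (carrier A) (tensor_map A B R x y) (tensor_inl A B) = x"
proof -
  interpret B: algebra base_field B by fact
  interpret R: algebra base_field R by fact
  show ?thesis
    using alg_homD[OF x] alg_homD[OF y] tensor_map_pure[OF A B R alg_hom_linear[OF x] alg_hom_linear[OF y]]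
    by (intro extensionalityI[of _ "carrier A"]) (auto simp: compose_def tensor_inl_def)
qed

lemma tensor_map_inr:
  assumes A: "algebra base_field A" and B: "algebra base_field B" and R: "algebra base_field R"
    and x: "x \<in> alg_hom A R" and y: "y \<in> alg_hom B R"
  shows "compose (carrier B) (tensor_map A B R x y) (tensor_inr A B) = y"
proof -
  interpret A: algebra base_field A by fact
  interpret R: algebra base_field R by fact
  show ?thesis
    using alg_homD[OF x] alg_homD[OF y] tensor_map_pure[OF A B R alg_hom_linear[OF x] alg_hom_linear[OF y]]
    by (intro extensionalityI[of _ "carrier B"]) (auto simp: compose_def tensor_inr_def)
qed

lemma tensor_map_inl_inr:
  assumes A: "algebra base_field A" and B: "algebra base_field B" and t: "t \<in> carrier (tensor A B)"
  shows "tensor_map A B (tensor A B) (tensor_inl A B) (tensor_inr A B) t = t"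
proof -
  interpret A: algebra base_field A by fact
  interpret B: algebra base_field B by fact
  note T = algebra_tensor[OF A B]
  interpret T: algebra base_field "tensor A B" by (rule T)
  note inl = alg_hom_linear[OF tensor_inl_alg_hom[OF A B]]
  note inr = alg_hom_linear[OF tensor_inr_alg_hom[OF A B]]
  have "tensor_map A B (tensor A B) (tensor_inl A B) (tensor_inr A B) t = (\<lambda>t. t) t"
  proof (rule tensor_maps_eqI[OF A B T tensor_map_linear[OF A B T inl inr] _ _ t])
    show "(\<lambda>t. t) \<in> linear_maps (tensor A B) (tensor A B)"
      by (simp add: linear_maps_def)
    fix a b assume "a \<in> carrier A" "b \<in> carrier B"
    then show "tensor_map A B (tensor A B) (tensor_inl A B) (tensor_inr A B) (pure_tensor A B a b) =
        pure_tensor A B a b"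
      by (simp add: tensor_map_pure[OF A B T inl inr]) (simp add: tensor_inl_def tensor_inr_def pure_mult[OF A B])
  qed
  then show ?thesis by simp
qed

lemma linear_maps_compose:
  assumes "g \<in> linear_maps A B" "h \<in> linear_maps B C"
  shows "(\<lambda>a. h (g a)) \<in> linear_maps A C"
  using assms by (auto simp: linear_maps_def Pi_iff)

lemma tensor_map_natural:
  assumes A: "algebra base_field A" and B: "algebra base_field B" and R: "algebra base_field R"
    and S: "algebra base_field S"
    and x: "x \<in> linear_maps A R" and y: "y \<in> linear_maps B R" and h: "h \<in> alg_hom R S"
    and t: "t \<in> carrier (tensor A B)"
  shows "h (tensor_map A B R x y t) =
    tensor_map A B S (compose (carrier A) h x) (compose (carrier B) h y) t"
proof -
  interpret A: algebra base_field A by fact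
  interpret B: algebra base_field B by fact
  have hx: "compose (carrier A) h x \<in> linear_maps A S"
    using linear_maps_compose[OF x alg_hom_linear[OF h]] by (auto simp: linear_maps_def compose_def)
  have hy: "compose (carrier B) h y \<in> linear_maps B S"
    using linear_maps_compose[OF y alg_hom_linear[OF h]] by (auto simp: linear_maps_def compose_def)
  show ?thesis
  proof (rule tensor_maps_eqI[OF A B S linear_maps_compose[OF tensor_map_linear[OF A B R x y] alg_hom_linear[OF h]]
      tensor_map_linear[OF A B S hx hy] _ t])
    fix a b assume "a \<in> carrier A" "b \<in> carrier B"
    then show "h (tensor_map A B R x y (pure_tensor A B a b)) =
        tensor_map A B S (compose (carrier A) h x) (compose (carrier B) h y) (pure_tensor A B a b)"
      using alg_homD(3)[OF h] linear_mapsD(1)[OF x] linear_mapsD(1)[OF y]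
      by (simp add: tensor_map_pure[OF A B R x y] tensor_map_pure[OF A B S hx hy]) (simp add: compose_def)
  qed
qed

lemma point_op_alg_hom:
  assumes A: "algebra base_field A" and R: "algebra base_field R"
    and m: "m \<in> alg_hom A (tensor A A)" and x: "x \<in> alg_hom A R" and y: "y \<in> alg_hom A R"
  shows "point_op A R m x y \<in> alg_hom A R"
  unfolding point_op_def by (rule alg_hom_compose[OF m tensor_map_alg_hom[OF A A R x y] A])

text \<open>Together with the next lemma this is the Yoneda principle: an operation is its value at the
  pair of projections, and an identity between projections holds for the points of every algebra.\<close>

lemma point_op_natural:
  assumes A: "algebra base_field A" and R: "algebra base_field R" and S: "algebra base_field S"
    and m: "m \<in> alg_hom A (tensor A A)" and x: "x \<in> alg_hom A R" and y: "y \<in> alg_hom A R"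
    and h: "h \<in> alg_hom R S"
  shows "compose (carrier A) h (point_op A R m x y) =
    point_op A S m (compose (carrier A) h x) (compose (carrier A) h y)"
  using tensor_map_natural[OF A A R S alg_hom_linear[OF x] alg_hom_linear[OF y] h] alg_homD(1)[OF m]
  by (intro extensionalityI[of _ "carrier A"]) (auto simp: point_op_def compose_def)

lemma point_op_generic:
  assumes A: "algebra base_field A" and m: "m \<in> alg_hom A (tensor A A)"
  shows "point_op A (tensor A A) m (proj1_of2 A) (proj2_of2 A) = m"
  using tensor_map_inl_inr[OF A A] alg_homD(1,6)[OF m]
  by (intro extensionalityI[of _ "carrier A"]) (auto simp: point_op_def compose_def)

lemma point_unit_alg_hom:
  assumes A: "algebra base_field A" and R: "algebra base_field R" and \<epsilon>: "\<epsilon> \<in> alg_hom A base_algebra"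
  shows "point_unit A R \<epsilon> \<in> alg_hom A R"
proof -
  interpret A: algebra base_field A by fact
  interpret R: algebra base_field R by fact
  have sm: "(c \<odot>\<^bsub>R\<^esub> \<one>\<^bsub>R\<^esub>) \<otimes>\<^bsub>R\<^esub> (d \<odot>\<^bsub>R\<^esub> \<one>\<^bsub>R\<^esub>) = (c * d) \<odot>\<^bsub>R\<^esub> \<one>\<^bsub>R\<^esub>" for c d
    using R.smult_assoc1[of c d "\<one>\<^bsub>R\<^esub>"] R.smult_assoc2[of c "\<one>\<^bsub>R\<^esub>" "d \<odot>\<^bsub>R\<^esub> \<one>\<^bsub>R\<^esub>"] by simp
  show ?thesis
    using alg_homD[OF \<epsilon>] R.smult_l_distr[of _ _ "\<one>\<^bsub>R\<^esub>"] R.smult_assoc1[of _ _ "\<one>\<^bsub>R\<^esub>"] R.smult_one[of "\<one>\<^bsub>R\<^esub>"]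
    by (intro alg_homI) (simp_all add: point_unit_def sm)
qed

lemma identity_alg_hom:
  assumes A: "algebra base_field A"
  shows "(\<lambda>a\<in>carrier A. a) \<in> alg_hom A A"
proof -
  interpret A: algebra base_field A by fact
  show ?thesis by (intro alg_homI) auto
qed

section \<open>Functionals on tensor powers\<close>

lemma derivations_linear: "D \<in> derivations A \<epsilon> \<Longrightarrow> D \<in> linear_maps A base_algebra"
  by (auto simp: derivations_def linear_maps_def)

locale pointed_algebra =
  fixes A :: "('k::field, 'a) module" and \<epsilon> :: "'a \<Rightarrow> 'k"
  assumes A: "algebra base_field A" and \<epsilon>: "\<epsilon> \<in> alg_hom A base_algebra"
begin

sublocale A: algebra base_field A by (rule A)

abbreviation "k \<equiv> base_algebra :: ('k, 'k) module"
abbreviation "A2 \<equiv> tensor A A"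
abbreviation "A3 \<equiv> tensor A2 A"

lemmas K = algebra_base_algebra
lemmas A2 = algebra_tensor[OF A A]
lemmas A3 = algebra_tensor[OF A2 A]
lemmas \<epsilon>_linear = alg_hom_linear[OF \<epsilon>]
lemmas \<epsilon>_simps = alg_homD[OF \<epsilon>, simplified]

abbreviation pairing where "pairing D E \<equiv> tensor_map A A k D E"

lemmas pairing_pure = tensor_map_pure[OF A A K, simplified]
lemmas pairing_linear = tensor_map_linear[OF A A K]

lemma pairing_add:
  "D \<in> linear_maps A k \<Longrightarrow> E \<in> linear_maps A k \<Longrightarrow> u \<in> carrier A2 \<Longrightarrow> v \<in> carrier A2 \<Longrightarrow>
    pairing D E (u \<oplus>\<^bsub>A2\<^esub> v) = pairing D E u + pairing D E v"
  using linear_mapsD(2)[OF pairing_linear] by simp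

lemma derivation_simps:
  assumes "D \<in> derivations A \<epsilon>" "f \<in> carrier A" "g \<in> carrier A"
  shows "D (f \<otimes>\<^bsub>A\<^esub> g) = D f * \<epsilon> g + \<epsilon> f * D g" "D (f \<oplus>\<^bsub>A\<^esub> g) = D f + D g"
    "D (c \<odot>\<^bsub>A\<^esub> f) = c * D f"
  using assms by (auto simp: derivations_def)

lemma derivation_one:
  assumes "D \<in> derivations A \<epsilon>"
  shows "D \<one>\<^bsub>A\<^esub> = 0"
proof -
  have "D \<one>\<^bsub>A\<^esub> = D \<one>\<^bsub>A\<^esub> + D \<one>\<^bsub>A\<^esub>"
    using derivation_simps(1)[OF assms A.one_closed A.one_closed]
    by (simp only: \<epsilon>_simps A.l_one A.one_closed mult_1_left mult_1_right)
  then show ?thesis by (simp only: add_cancel_right_right)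
qed

lemma tensor_bilinear_eqI:
  assumes u: "u \<in> carrier A2" and v: "v \<in> carrier A2"
    and pure: "\<And>p q r s. p \<in> carrier A \<Longrightarrow> q \<in> carrier A \<Longrightarrow> r \<in> carrier A \<Longrightarrow> s \<in> carrier A \<Longrightarrow>
      \<Phi> (pure_tensor A A p q) (pure_tensor A A r s) = (\<Psi> (pure_tensor A A p q) (pure_tensor A A r s) :: 'k)"
    and "\<And>u u' v. u \<in> carrier A2 \<Longrightarrow> u' \<in> carrier A2 \<Longrightarrow> v \<in> carrier A2 \<Longrightarrow> \<Phi> (u \<oplus>\<^bsub>A2\<^esub> u') v = \<Phi> u v + \<Phi> u' v"
    and "\<And>u u' v. u \<in> carrier A2 \<Longrightarrow> u' \<in> carrier A2 \<Longrightarrow> v \<in> carrier A2 \<Longrightarrow> \<Psi> (u \<oplus>\<^bsub>A2\<^esub> u') v = \<Psi> u v + \<Psi> u' v"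
    and "\<And>u v v'. u \<in> carrier A2 \<Longrightarrow> v \<in> carrier A2 \<Longrightarrow> v' \<in> carrier A2 \<Longrightarrow> \<Phi> u (v \<oplus>\<^bsub>A2\<^esub> v') = \<Phi> u v + \<Phi> u v'"
    and "\<And>u v v'. u \<in> carrier A2 \<Longrightarrow> v \<in> carrier A2 \<Longrightarrow> v' \<in> carrier A2 \<Longrightarrow> \<Psi> u (v \<oplus>\<^bsub>A2\<^esub> v') = \<Psi> u v + \<Psi> u v'"
  shows "\<Phi> u v = \<Psi> u v"
  using A A u
proof (induction u rule: tensor_induct)
  case (pure p q)
  note pq = this
  from A A v show ?case
    by (induction v rule: tensor_induct) (use pq assms in \<open>simp_all add: pure_closed[OF A A]\<close>)
qed (use assms in simp_all)

text \<open>The product rule in both slots; \<open>\<epsilon>\<close> stands where a derivation was applied to the other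
  factor.\<close>

lemma pairing_mult:
  assumes D: "D \<in> derivations A \<epsilon>" and E: "E \<in> derivations A \<epsilon>"
    and u: "u \<in> carrier A2" and v: "v \<in> carrier A2"
  shows "pairing D E (u \<otimes>\<^bsub>A2\<^esub> v) = pairing D E u * pairing \<epsilon> \<epsilon> v + pairing D \<epsilon> u * pairing \<epsilon> E v +
    pairing \<epsilon> E u * pairing D \<epsilon> v + pairing \<epsilon> \<epsilon> u * pairing D E v"
proof -
  interpret A2: algebra base_field A2 by (rule A2)
  note lin = derivations_linear[OF D] derivations_linear[OF E] \<epsilon>_linear
  show ?thesis
    by (rule tensor_bilinear_eqI[OF u v])
       (simp_all add: pure_mult[OF A A] pairing_pure lin derivation_simps[OF D] derivation_simps[OF E]
         algebra_simps pairing_add A2.r_distr A2.l_distr)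
qed

lemma point_unit_linear:
  assumes R: "algebra base_field R" and c: "c \<in> linear_maps A k"
  shows "point_unit A R c \<in> linear_maps A R"
proof -
  interpret R: algebra base_field R by fact
  show ?thesis
    using linear_mapsD[OF c] R.smult_l_distr[of _ _ "\<one>\<^bsub>R\<^esub>"] R.smult_assoc1[of _ _ "\<one>\<^bsub>R\<^esub>"]
    by (auto simp: linear_maps_def point_unit_def)
qed

text \<open>Contracting the first tensor factor with \<open>c\<close>. For \<open>c = \<epsilon>\<close> the map being contracted computes
  \<open>e \<triangleright> x\<close>, so the unit laws of a rack or group become statements about pairings with \<open>\<epsilon>\<close>; for a
  point \<open>c\<close> it gives left translation by \<open>c\<close> on regular functions.\<close>

lemma contract_left:
  assumes c: "c \<in> linear_maps A k" and D: "D \<in> linear_maps A k" and u: "u \<in> carrier A2"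
  shows "D (tensor_map A A A (point_unit A A c) (\<lambda>a\<in>carrier A. a) u) = pairing c D u"
proof -
  note e = point_unit_linear[OF A c]
  note i = alg_hom_linear[OF identity_alg_hom[OF A]]
  show ?thesis
  proof (rule tensor_maps_eqI[OF A A K linear_maps_compose[OF tensor_map_linear[OF A A A e i] D] pairing_linear[OF c D] _ u])
    fix a b assume ab: "a \<in> carrier A" "b \<in> carrier A"
    then have "(c a \<odot>\<^bsub>A\<^esub> \<one>\<^bsub>A\<^esub>) \<otimes>\<^bsub>A\<^esub> b = c a \<odot>\<^bsub>A\<^esub> b" using A.smult_assoc2[of "c a" "\<one>\<^bsub>A\<^esub>" b] by simp
    with ab show "D (tensor_map A A A (point_unit A A c) (\<lambda>a\<in>carrier A. a) (pure_tensor A A a b)) =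
        pairing c D (pure_tensor A A a b)"
      using linear_mapsD(3)[OF D ab(2)]
      by (simp add: tensor_map_pure[OF A A A e i] pairing_pure c D) (simp add: point_unit_def)
  qed
qed

lemma contract_right:
  assumes c: "c \<in> linear_maps A k" and D: "D \<in> linear_maps A k" and u: "u \<in> carrier A2"
  shows "D (tensor_map A A A (\<lambda>a\<in>carrier A. a) (point_unit A A c) u) = pairing D c u"
proof -
  note e = point_unit_linear[OF A c]
  note i = alg_hom_linear[OF identity_alg_hom[OF A]]
  show ?thesis
  proof (rule tensor_maps_eqI[OF A A K linear_maps_compose[OF tensor_map_linear[OF A A A i e] D] pairing_linear[OF D c] _ u])
    fix a b assume ab: "a \<in> carrier A" "b \<in> carrier A"
    then have "a \<otimes>\<^bsub>A\<^esub> (c b \<odot>\<^bsub>A\<^esub> \<one>\<^bsub>A\<^esub>) = c b \<odot>\<^bsub>A\<^esub> a"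
      using A.smult_assoc2[of "c b" "\<one>\<^bsub>A\<^esub>" a] A.m_comm[of a "c b \<odot>\<^bsub>A\<^esub> \<one>\<^bsub>A\<^esub>"] by simp
    with ab show "D (tensor_map A A A (\<lambda>a\<in>carrier A. a) (point_unit A A c) (pure_tensor A A a b)) =
        pairing D c (pure_tensor A A a b)"
      using linear_mapsD(3)[OF D ab(1)]
      by (simp add: tensor_map_pure[OF A A A i e] pairing_pure c D) (simp add: point_unit_def)
  qed
qed

text \<open>The functional \<open>D \<otimes> E \<otimes> F\<close>. The self-distributive laws live on \<open>A \<otimes> A \<otimes> A\<close>; testing them
  against it yields the Leibniz identities. The four lemmas at the end of this section evaluate it
  on the products that occur in the two laws.\<close>

abbreviation triple where "triple D E F \<equiv> tensor_map A2 A k (pairing D E) F"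

lemma triple_linear:
  "D \<in> linear_maps A k \<Longrightarrow> E \<in> linear_maps A k \<Longrightarrow> F \<in> linear_maps A k \<Longrightarrow> triple D E F \<in> linear_maps A3 k"
  by (intro tensor_map_linear[OF A2 A K] pairing_linear)

lemma triple_pure:
  assumes "D \<in> linear_maps A k" "E \<in> linear_maps A k" "F \<in> linear_maps A k"
    and "p \<in> carrier A" "q \<in> carrier A" "r \<in> carrier A"
  shows "triple D E F (pure_tensor A2 A (pure_tensor A A p q) r) = D p * E q * F r"
  using assms by (simp add: tensor_map_pure[OF A2 A K] pairing_linear pure_closed[OF A A] pairing_pure)

lemma projections3:
  assumes "p \<in> carrier A"
  shows "proj1_of3 A p = pure_tensor A2 A (pure_tensor A A p \<one>\<^bsub>A\<^esub>) \<one>\<^bsub>A\<^esub>"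
    and "proj2_of3 A p = pure_tensor A2 A (pure_tensor A A \<one>\<^bsub>A\<^esub> p) \<one>\<^bsub>A\<^esub>"
    and "proj3_of3 A p = pure_tensor A2 A (pure_tensor A A \<one>\<^bsub>A\<^esub> \<one>\<^bsub>A\<^esub>) p"
  using assms
  by (simp_all add: compose_def tensor_inl_def tensor_inr_def pure_closed[OF A A] pure_one[OF A A])

lemma projections3_alg_hom:
  "proj1_of3 A \<in> alg_hom A A3" "proj2_of3 A \<in> alg_hom A A3" "proj3_of3 A \<in> alg_hom A A3"
  using alg_hom_compose[OF tensor_inl_alg_hom[OF A A] tensor_inl_alg_hom[OF A2 A] A]
    alg_hom_compose[OF tensor_inr_alg_hom[OF A A] tensor_inl_alg_hom[OF A2 A] A]
    tensor_inr_alg_hom[OF A2 A] by auto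

lemma pure3_mult:
  assumes "p \<in> carrier A" "q \<in> carrier A" "r \<in> carrier A" "p' \<in> carrier A" "q' \<in> carrier A" "r' \<in> carrier A"
  shows "pure_tensor A2 A (pure_tensor A A p q) r \<otimes>\<^bsub>A3\<^esub> pure_tensor A2 A (pure_tensor A A p' q') r' =
    pure_tensor A2 A (pure_tensor A A (p \<otimes>\<^bsub>A\<^esub> p') (q \<otimes>\<^bsub>A\<^esub> q')) (r \<otimes>\<^bsub>A\<^esub> r')"
  using assms by (simp add: pure_mult[OF A2 A] pure_mult[OF A A] pure_closed[OF A A])

abbreviation "map12 \<equiv> tensor_map A A A3 (proj1_of3 A) (proj2_of3 A)"
abbreviation "map13 \<equiv> tensor_map A A A3 (proj1_of3 A) (proj3_of3 A)"
abbreviation "map23 \<equiv> tensor_map A A A3 (proj2_of3 A) (proj3_of3 A)"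

lemma maps3_alg_hom: "map12 \<in> alg_hom A2 A3" "map13 \<in> alg_hom A2 A3" "map23 \<in> alg_hom A2 A3"
  by (intro tensor_map_alg_hom[OF A A A3] projections3_alg_hom)+

lemma maps3_pure:
  assumes "p \<in> carrier A" "q \<in> carrier A"
  shows "map12 (pure_tensor A A p q) = pure_tensor A2 A (pure_tensor A A p q) \<one>\<^bsub>A\<^esub>"
    and "map13 (pure_tensor A A p q) = pure_tensor A2 A (pure_tensor A A p \<one>\<^bsub>A\<^esub>) q"
    and "map23 (pure_tensor A A p q) = pure_tensor A2 A (pure_tensor A A \<one>\<^bsub>A\<^esub> p) q"
  using assms
  by (simp_all only: tensor_map_pure[OF A A A3] alg_hom_linear[OF projections3_alg_hom(1)]
      alg_hom_linear[OF projections3_alg_hom(2)] alg_hom_linear[OF projections3_alg_hom(3)]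
      projections3 pure3_mult A.one_closed A.l_one A.r_one)

lemma
  assumes D: "D \<in> linear_maps A k" and E: "E \<in> linear_maps A k" and F: "F \<in> linear_maps A k"
    and p: "p \<in> carrier A" and u: "u \<in> carrier A2"
  shows triple_proj1_map23: "triple D E F (proj1_of3 A p \<otimes>\<^bsub>A3\<^esub> map23 u) = D p * pairing E F u"
    and triple_map12_proj3: "triple D E F (map12 u \<otimes>\<^bsub>A3\<^esub> proj3_of3 A p) = pairing D E u * F p"
proof -
  interpret A3: algebra base_field A3 by (rule A3)
  note lin = D E F
  note T = linear_mapsD(2)[OF triple_linear[OF lin], simplified]
  note P = alg_homD(1)[OF projections3_alg_hom(1) p] alg_homD(1)[OF projections3_alg_hom(3) p]
  note M = alg_homD(1,2)[OF maps3_alg_hom(1)] alg_homD(1,2)[OF maps3_alg_hom(3)]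
  show "triple D E F (proj1_of3 A p \<otimes>\<^bsub>A3\<^esub> map23 u) = D p * pairing E F u"
    using A A u
  proof (induction u rule: tensor_induct)
    case (pure q r)
    then show ?case using p
      by (simp only: projections3 maps3_pure pure3_mult triple_pure lin pairing_pure A.one_closed
          A.l_one A.r_one mult.assoc)
  next
    case (add u v)
    then show ?case using p
      by (simp only: M P A3.r_distr A3.m_closed T pairing_add lin distrib_left)
  qed
  show "triple D E F (map12 u \<otimes>\<^bsub>A3\<^esub> proj3_of3 A p) = pairing D E u * F p"
    using A A u
  proof (induction u rule: tensor_induct)
    case (pure q r)
    then show ?case using p
      by (simp only: projections3 maps3_pure pure3_mult triple_pure lin pairing_pure A.one_closed
          A.l_one A.r_one)
  next
    case (add u v)
    then show ?case using p
      by (simp only: M P A3.l_distr A3.m_closed T pairing_add lin distrib_right)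
  qed
qed

text \<open>The coordinate \<open>x\<close> occurs in both factors of \<open>(x \<triangleright> y) \<triangleright> (x \<triangleright> z)\<close>, so their first tensor
  components are multiplied. A derivation \<open>D\<close> in that slot splits by the product rule, and this is
  the source of the two terms on the right of the Leibniz identity.\<close>

lemma triple_map12_map13:
  assumes D: "D \<in> derivations A \<epsilon>" and E: "E \<in> linear_maps A k" and F: "F \<in> linear_maps A k"
    and u: "u \<in> carrier A2" and v: "v \<in> carrier A2"
  shows "triple D E F (map12 u \<otimes>\<^bsub>A3\<^esub> map13 v) =
    pairing D E u * pairing \<epsilon> F v + pairing \<epsilon> E u * pairing D F v"
proof -
  interpret A3: algebra base_field A3 by (rule A3)
  note lin = derivations_linear[OF D] E F \<epsilon>_linear
  note T = linear_mapsD(2)[OF triple_linear[OF lin(1,2,3)], simplified]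
  note M = alg_homD(1,2)[OF maps3_alg_hom(1)] alg_homD(1,2)[OF maps3_alg_hom(2)]
  show ?thesis
    by (rule tensor_bilinear_eqI[OF u v])
      (simp_all only: M maps3_pure pure3_mult triple_pure lin pairing_pure A.one_closed A.m_closed
         A.l_one A.r_one A3.r_distr A3.l_distr A3.m_closed T pairing_add derivation_simps[OF D],
       simp_all only: algebra_simps)
qed

text \<open>The analogue for \<open>(x \<triangleright>\<^sup>-\<^sup>1 z) \<triangleright>\<^sup>-\<^sup>1 (y \<triangleright>\<^sup>-\<^sup>1 z)\<close>, where the repeated coordinate is \<open>z\<close>.\<close>

lemma triple_map13_map23:
  assumes D: "D \<in> linear_maps A k" and E: "E \<in> linear_maps A k" and F: "F \<in> derivations A \<epsilon>"
    and u: "u \<in> carrier A2" and v: "v \<in> carrier A2"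
  shows "triple D E F (map13 u \<otimes>\<^bsub>A3\<^esub> map23 v) =
    pairing D F u * pairing E \<epsilon> v + pairing D \<epsilon> u * pairing E F v"
proof -
  interpret A3: algebra base_field A3 by (rule A3)
  note lin = derivations_linear[OF F] D E \<epsilon>_linear
  note T = linear_mapsD(2)[OF triple_linear[OF lin(2,3,1)], simplified]
  note M = alg_homD(1,2)[OF maps3_alg_hom(2)] alg_homD(1,2)[OF maps3_alg_hom(3)]
  show ?thesis
    by (rule tensor_bilinear_eqI[OF u v])
      (simp_all only: M maps3_pure pure3_mult triple_pure lin pairing_pure A.one_closed A.m_closed
         A.l_one A.r_one A3.r_distr A3.l_distr A3.m_closed T pairing_add derivation_simps[OF F],
       simp_all only: algebra_simps)
qed

end

section \<open>The Leibniz algebras of an affine algebraic rack\<close>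

lemma functional_algebra_simps [simp]:
  "carrier (functional_algebra S V b) = V"
  "\<zero>\<^bsub>functional_algebra S V b\<^esub> = (\<lambda>f\<in>S. 0)"
  "D \<oplus>\<^bsub>functional_algebra S V b\<^esub> E = (\<lambda>f\<in>S. D f + E f)"
  "c \<odot>\<^bsub>functional_algebra S V b\<^esub> D = (\<lambda>f\<in>S. c * D f)"
  by (simp_all add: functional_algebra_def)

lemma functional_algebra_bracket [simp]:
  "D \<in> V \<Longrightarrow> E \<in> V \<Longrightarrow> bracket (functional_algebra S V b) D E = b D E"
  by (simp add: functional_algebra_def)

definition functional_space :: "'s set \<Rightarrow> ('s \<Rightarrow> 'k::field) set \<Rightarrow> bool" where
  "functional_space S V \<longleftrightarrow> V \<subseteq> extensional S \<and> (\<lambda>f\<in>S. 0) \<in> V \<and>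
     (\<forall>D\<in>V. \<forall>E\<in>V. (\<lambda>f\<in>S. D f + E f) \<in> V) \<and> (\<forall>c. \<forall>D\<in>V. (\<lambda>f\<in>S. c * D f) \<in> V)"

lemma module_functional_algebra:
  assumes "functional_space S V"
  shows "Module.module base_field (functional_algebra S V b)"
proof (rule moduleI)
  have V: "V \<subseteq> extensional S" "(\<lambda>f\<in>S. 0) \<in> V" "\<And>D E. D \<in> V \<Longrightarrow> E \<in> V \<Longrightarrow> (\<lambda>f\<in>S. D f + E f) \<in> V"
    "\<And>c D. D \<in> V \<Longrightarrow> (\<lambda>f\<in>S. c * D f) \<in> V"
    using assms by (auto simp: functional_space_def)
  have eq: "D = E" if "D \<in> V" "E \<in> extensional S" "\<And>f. f \<in> S \<Longrightarrow> D f = E f" for D E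
    using that V(1) by (intro extensionalityI[of _ S]) auto
  have eq': "E = D" if "D \<in> V" "E \<in> extensional S" "\<And>f. f \<in> S \<Longrightarrow> E f = D f" for D E
    using eq[of D E] that by auto
  show "cring (base_field :: 'b ring)" by (rule cring_from_type_algebra)
  show "abelian_group (functional_algebra S V b)"
  proof (rule abelian_groupI)
    fix D assume D: "D \<in> carrier (functional_algebra S V b)"
    show "\<exists>E\<in>carrier (functional_algebra S V b). E \<oplus>\<^bsub>functional_algebra S V b\<^esub> D = \<zero>\<^bsub>functional_algebra S V b\<^esub>"
      using D V(4)[of D "-1"] by (intro bexI[of _ "\<lambda>f\<in>S. -1 * D f"]) (auto simp: fun_eq_iff)
    show "\<zero>\<^bsub>functional_algebra S V b\<^esub> \<oplus>\<^bsub>functional_algebra S V b\<^esub> D = D"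
      using D by (intro eq') auto
  qed (auto simp: V algebra_simps intro!: restrict_ext)
  show "\<one>\<^bsub>base_field\<^esub> \<odot>\<^bsub>functional_algebra S V b\<^esub> D = D" if "D \<in> carrier (functional_algebra S V b)" for D
    using that by (intro eq') auto
qed (use assms in \<open>auto simp: functional_space_def algebra_simps fun_eq_iff cong: restrict_cong
    intro!: extensionalityI[of _ S] restrict_ext\<close>)

lemma functional_space_derivations:
  "functional_space (carrier A) (derivations A \<epsilon>)" if "algebra base_field A"
proof -
  interpret A: algebra base_field A by fact
  show ?thesis
    by (auto simp: functional_space_def derivations_def algebra_simps)
qed

context pointed_algebra
begin

lemma linear_add:
  "\<phi> \<in> linear_maps B k \<Longrightarrow> \<psi> \<in> linear_maps B k \<Longrightarrow> (\<lambda>t. \<phi> t + \<psi> t) \<in> linear_maps B k"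
  by (auto simp: linear_maps_def algebra_simps)

lemma linear_scale: "\<phi> \<in> linear_maps B k \<Longrightarrow> (\<lambda>t. c * \<phi> t) \<in> linear_maps B k"
  by (auto simp: linear_maps_def algebra_simps)

lemma linear_restrict: "\<phi> \<in> linear_maps A k \<Longrightarrow> (\<lambda>t\<in>carrier A. \<phi> t) \<in> linear_maps A k"
  by (auto simp: linear_maps_def)

lemma pairing_add_left:
  assumes D: "D \<in> linear_maps A k" and D': "D' \<in> linear_maps A k" and E: "E \<in> linear_maps A k" and u: "u \<in> carrier A2"
  shows "pairing (\<lambda>f\<in>carrier A. D f + D' f) E u = pairing D E u + pairing D' E u"
proof -
  note S = linear_restrict[OF linear_add[OF D D']]
  show ?thesis
    by (rule tensor_maps_eqI[OF A A K pairing_linear[OF S E] linear_add[OF pairing_linear[OF D E] pairing_linear[OF D' E]] _ u])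
       (simp add: pairing_pure S D D' E algebra_simps)
qed

lemma pairing_add_right:
  assumes D: "D \<in> linear_maps A k" and D': "D' \<in> linear_maps A k" and E: "E \<in> linear_maps A k" and u: "u \<in> carrier A2"
  shows "pairing E (\<lambda>f\<in>carrier A. D f + D' f) u = pairing E D u + pairing E D' u"
proof -
  note S = linear_restrict[OF linear_add[OF D D']]
  show ?thesis
    by (rule tensor_maps_eqI[OF A A K pairing_linear[OF E S] linear_add[OF pairing_linear[OF E D] pairing_linear[OF E D']] _ u])
       (simp add: pairing_pure S D D' E algebra_simps)
qed

lemma pairing_scale_left:
  assumes D: "D \<in> linear_maps A k" and E: "E \<in> linear_maps A k" and u: "u \<in> carrier A2"
  shows "pairing (\<lambda>f\<in>carrier A. c * D f) E u = c * pairing D E u"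
proof -
  note S = linear_restrict[OF linear_scale[OF D]]
  show ?thesis
    by (rule tensor_maps_eqI[OF A A K pairing_linear[OF S E] linear_scale[OF pairing_linear[OF D E]] _ u])
       (simp add: pairing_pure S D E algebra_simps)
qed

lemma pairing_scale_right:
  assumes D: "D \<in> linear_maps A k" and E: "E \<in> linear_maps A k" and u: "u \<in> carrier A2"
  shows "pairing E (\<lambda>f\<in>carrier A. c * D f) u = c * pairing E D u"
proof -
  note S = linear_restrict[OF linear_scale[OF D]]
  show ?thesis
    by (rule tensor_maps_eqI[OF A A K pairing_linear[OF E S] linear_scale[OF pairing_linear[OF E D]] _ u])
       (simp add: pairing_pure S D E algebra_simps)
qed

abbreviation convolution where "convolution m D E \<equiv> compose (carrier A) (pairing D E) m"

lemma convolution_linear: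
  assumes m: "m \<in> alg_hom A A2" and D: "D \<in> linear_maps A k" and E: "E \<in> linear_maps A k"
  shows "convolution m D E \<in> linear_maps A k"
  using linear_restrict[OF linear_maps_compose[OF alg_hom_linear[OF m] pairing_linear[OF D E]]]
  by (simp add: compose_def)

text \<open>By \<open>pairing_mult\<close> the product rule for \<open>(D \<otimes> E) \<circ> m\<close> holds up to cross terms, each with a
  factor \<open>D \<otimes> \<epsilon>\<close> and a factor \<open>\<epsilon> \<otimes> E\<close>. For \<open>\<triangleright>\<close> the first kind vanishes because \<open>x \<triangleright> e = e\<close>, for
  \<open>\<triangleright>\<^sup>-\<^sup>1\<close> the second because \<open>e \<triangleright>\<^sup>-\<^sup>1 x = e\<close>; the hypothesis on products covers both.\<close>

lemma convolution_derivation: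
  assumes m: "m \<in> alg_hom A A2" and D: "D \<in> derivations A \<epsilon>" and E: "E \<in> derivations A \<epsilon>"
    and unit: "\<And>f. f \<in> carrier A \<Longrightarrow> pairing \<epsilon> \<epsilon> (m f) = \<epsilon> f"
    and zero: "\<And>f g. f \<in> carrier A \<Longrightarrow> g \<in> carrier A \<Longrightarrow> pairing D \<epsilon> (m f) * pairing \<epsilon> E (m g) = 0"
  shows "convolution m D E \<in> derivations A \<epsilon>"
proof -
  have "convolution m D E (f \<otimes>\<^bsub>A\<^esub> g) = convolution m D E f * \<epsilon> g + \<epsilon> f * convolution m D E g"
    if f: "f \<in> carrier A" and g: "g \<in> carrier A" for f g
  proof -
    have "pairing \<epsilon> E (m f) * pairing D \<epsilon> (m g) = 0"
      using zero[OF g f] by (simp only: mult.commute)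
    then show ?thesis
      using f g zero[OF f g]
      by (simp only: compose_eq A.m_closed alg_homD[OF m] pairing_mult[OF D E] unit) (simp only: add_0_right)
  qed
  then show ?thesis
    using linear_mapsD[OF convolution_linear[OF m derivations_linear[OF D] derivations_linear[OF E]]]
    by (simp add: derivations_def)
qed

lemma bilinear_bracket_convolution:
  assumes m: "m \<in> alg_hom A A2"
    and closed: "\<And>D E. D \<in> derivations A \<epsilon> \<Longrightarrow> E \<in> derivations A \<epsilon> \<Longrightarrow> convolution m D E \<in> derivations A \<epsilon>"
  shows "bilinear_bracket (functional_algebra (carrier A) (derivations A \<epsilon>) (convolution m))"
proof -
  note S = functional_space_derivations[OF A, of \<epsilon>]
  then have cl: "\<And>D E. D \<in> derivations A \<epsilon> \<Longrightarrow> E \<in> derivations A \<epsilon> \<Longrightarrow> (\<lambda>f\<in>carrier A. D f + E f) \<in> derivations A \<epsilon>"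
    "\<And>c D. D \<in> derivations A \<epsilon> \<Longrightarrow> (\<lambda>f\<in>carrier A. c * D f) \<in> derivations A \<epsilon>"
    by (auto simp: functional_space_def)
  note simps = alg_homD(1)[OF m] derivations_linear
  show ?thesis
    unfolding bilinear_bracket_def
    by (auto simp: module_functional_algebra[OF S] closed cl compose_eq pairing_add_left pairing_add_right
        pairing_scale_left pairing_scale_right simps intro!: extensionalityI[of _ "carrier A"])
qed

end

lemma affine_rackD:
  assumes "affine_rack Q"
  shows "algebra base_field (coord Q)" "fg_algebra (coord Q)"
    "nabla Q \<in> alg_hom (coord Q) (tensor (coord Q) (coord Q))"
    "nabla_inv Q \<in> alg_hom (coord Q) (tensor (coord Q) (coord Q))"
    "counit Q \<in> alg_hom (coord Q) base_algebra"
  using assms by (auto simp: affine_rack_def Let_def fg_algebra_def)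

lemma affine_rack_pointed_algebra: "affine_rack Q \<Longrightarrow> pointed_algebra (coord Q) (counit Q)"
  by (simp add: affine_rackD pointed_algebra_def)

locale affine_rack_scheme =
  fixes Q :: "('k::field, 'a) rack_scheme" (structure)
  assumes Q: "affine_rack Q"
begin

sublocale pointed_algebra "coord Q" "counit Q"
  by (rule affine_rack_pointed_algebra[OF Q])

abbreviation "A \<equiv> coord Q"
abbreviation "\<epsilon> \<equiv> counit Q"
abbreviation "m \<equiv> nabla Q"
abbreviation "mi \<equiv> nabla_inv Q"
abbreviation "i \<equiv> \<lambda>a\<in>carrier A. a"
abbreviation "e \<equiv> point_unit A A \<epsilon>"

lemmas m = affine_rackD(3)[OF Q]
lemmas mi = affine_rackD(4)[OF Q]

lemma rack_laws:
  "point_op A A2 mi (point_op A A2 m (proj1_of2 A) (proj2_of2 A)) (proj1_of2 A) = proj2_of2 A"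
  "point_op A A3 m (proj1_of3 A) (point_op A A3 m (proj2_of3 A) (proj3_of3 A)) =
    point_op A A3 m (point_op A A3 m (proj1_of3 A) (proj2_of3 A)) (point_op A A3 m (proj1_of3 A) (proj3_of3 A))"
  "point_op A A3 mi (point_op A A3 mi (proj1_of3 A) (proj2_of3 A)) (proj3_of3 A) =
    point_op A A3 mi (point_op A A3 mi (proj1_of3 A) (proj3_of3 A)) (point_op A A3 mi (proj2_of3 A) (proj3_of3 A))"
  "point_op A A m e i = i"
  "point_op A A m i e = e"
  using Q unfolding affine_rack_def Let_def by blast+

lemma point_op_cancel:
  assumes R: "algebra base_field R" and x: "x \<in> alg_hom A R" and y: "y \<in> alg_hom A R"
  shows "point_op A R mi (point_op A R m x y) x = y"
proof -
  let ?h = "tensor_map A A R x y"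
  note h = tensor_map_alg_hom[OF A A R x y]
  note proj = tensor_inl_alg_hom[OF A A] tensor_inr_alg_hom[OF A A]
  have "compose (carrier A) ?h (point_op A A2 mi (point_op A A2 m (proj1_of2 A) (proj2_of2 A)) (proj1_of2 A)) =
      compose (carrier A) ?h (proj2_of2 A)"
    by (simp only: rack_laws(1))
  then show ?thesis
    by (simp only: point_op_natural[OF A A2 R mi point_op_alg_hom[OF A A2 m proj] proj(1) h]
        point_op_natural[OF A A2 R m proj h] tensor_map_inl[OF A A R x y] tensor_map_inr[OF A A R x y])
qed

text \<open>From \<open>(e \<triangleright> x) \<triangleright>\<^sup>-\<^sup>1 e = x\<close> and \<open>(x \<triangleright> e) \<triangleright>\<^sup>-\<^sup>1 x = e\<close>.\<close>

lemma unit_laws_inv: "point_op A A mi i e = i" "point_op A A mi e i = e"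
  using point_op_cancel[OF A point_unit_alg_hom[OF A A \<epsilon>] identity_alg_hom[OF A]]
    point_op_cancel[OF A identity_alg_hom[OF A] point_unit_alg_hom[OF A A \<epsilon>]]
  by (simp_all only: rack_laws)

lemma pairing_nabla:
  assumes f: "f \<in> carrier A" and D: "D \<in> linear_maps A k"
  shows "pairing \<epsilon> D (m f) = D f" "pairing D \<epsilon> (m f) = \<epsilon> f * D \<one>\<^bsub>A\<^esub>"
    "pairing D \<epsilon> (mi f) = D f" "pairing \<epsilon> D (mi f) = \<epsilon> f * D \<one>\<^bsub>A\<^esub>"
proof -
  have e: "D (e f) = \<epsilon> f * D \<one>\<^bsub>A\<^esub>"
    using f linear_mapsD(3)[OF D A.one_closed] by (simp add: point_unit_def)
  have op: "tensor_map A A A x y (n f) = point_op A A n x y f" for n x y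
    using f by (simp add: point_op_def compose_def)
  note mf = alg_homD(1)[OF m f] alg_homD(1)[OF mi f]
  show "pairing \<epsilon> D (m f) = D f" "pairing D \<epsilon> (m f) = \<epsilon> f * D \<one>\<^bsub>A\<^esub>"
    "pairing D \<epsilon> (mi f) = D f" "pairing \<epsilon> D (mi f) = \<epsilon> f * D \<one>\<^bsub>A\<^esub>"
    using f by (simp_all only: contract_left[OF \<epsilon>_linear D, symmetric] contract_right[OF \<epsilon>_linear D, symmetric] mf op
        rack_laws(4,5) unit_laws_inv e restrict_apply')
qed

lemma bracket_closed:
  assumes D: "D \<in> derivations A \<epsilon>" and E: "E \<in> derivations A \<epsilon>"
  shows "convolution m D E \<in> derivations A \<epsilon>" "convolution mi D E \<in> derivations A \<epsilon>"
  using D E by (intro convolution_derivation m mi;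
      simp add: pairing_nabla \<epsilon>_linear derivations_linear \<epsilon>_simps derivation_one)+

text \<open>Self-distributivity tested against \<open>D \<otimes> E \<otimes> F\<close>. The left side gives \<open>[D, [E, F]]\<close>. On the
  right side \<open>D\<close> splits, and the factor left with \<open>\<epsilon>\<close> in the slot of \<open>x\<close> collapses because
  \<open>e \<triangleright> y = y\<close>.\<close>

lemma left_jacobi:
  assumes D: "D \<in> derivations A \<epsilon>" and E: "E \<in> derivations A \<epsilon>" and F: "F \<in> derivations A \<epsilon>" and f: "f \<in> carrier A"
  shows "convolution m D (convolution m E F) f =
    convolution m (convolution m D E) F f + convolution m E (convolution m D F) f"
proof -
  note D' = derivations_linear[OF D] and E' = derivations_linear[OF E] and F' = derivations_linear[OF F]
  note lin = D' E' F'
  note T = triple_linear[OF lin]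
  note proj = projections3_alg_hom
  note op = point_op_alg_hom[OF A A3 m]
  have op_app: "point_op A A3 m x y p = tensor_map A A A3 x y (m p)" if "p \<in> carrier A" for x y p
    using that by (simp add: point_op_def compose_def)
  note mf = alg_homD(1)[OF m]
  have 1: "triple D E F (tensor_map A A A3 (proj1_of3 A) (point_op A A3 m (proj2_of3 A) (proj3_of3 A)) u) =
      pairing D (convolution m E F) u" if u: "u \<in> carrier A2" for u
  proof (rule tensor_maps_eqI[OF A A K linear_maps_compose[OF tensor_map_linear[OF A A A3] T] pairing_linear _ u])
    fix p r assume pr: "p \<in> carrier A" "r \<in> carrier A"
    then show "triple D E F (tensor_map A A A3 (proj1_of3 A) (point_op A A3 m (proj2_of3 A) (proj3_of3 A)) (pure_tensor A A p r)) =
      pairing D (convolution m E F) (pure_tensor A A p r)"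
      by (simp only: tensor_map_pure[OF A A A3] alg_hom_linear proj op op_app pairing_pure
          triple_proj1_map23 lin mf convolution_linear[OF m]) (simp only: compose_eq)
  qed (simp_all only: alg_hom_linear proj op convolution_linear[OF m] lin)
  have 2: "triple D E F (tensor_map A A A3 (point_op A A3 m (proj1_of3 A) (proj2_of3 A))
        (point_op A A3 m (proj1_of3 A) (proj3_of3 A)) u) =
      pairing (convolution m D E) F u + pairing E (convolution m D F) u" if u: "u \<in> carrier A2" for u
  proof (rule tensor_maps_eqI[OF A A K linear_maps_compose[OF tensor_map_linear[OF A A A3] T]
        linear_add[OF pairing_linear pairing_linear] _ u])
    fix p r assume pr: "p \<in> carrier A" "r \<in> carrier A"
    then show "triple D E F (tensor_map A A A3 (point_op A A3 m (proj1_of3 A) (proj2_of3 A))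
        (point_op A A3 m (proj1_of3 A) (proj3_of3 A)) (pure_tensor A A p r)) =
      pairing (convolution m D E) F (pure_tensor A A p r) + pairing E (convolution m D F) (pure_tensor A A p r)"
      by (simp only: tensor_map_pure[OF A A A3] alg_hom_linear proj op op_app pairing_pure
          triple_map12_map13[OF D] lin mf convolution_linear[OF m] pairing_nabla) (simp only: compose_eq)
  qed (simp_all only: alg_hom_linear proj op convolution_linear[OF m] lin)
  have 3: "tensor_map A A A3 (proj1_of3 A) (point_op A A3 m (proj2_of3 A) (proj3_of3 A)) (m f) =
      tensor_map A A A3 (point_op A A3 m (proj1_of3 A) (proj2_of3 A)) (point_op A A3 m (proj1_of3 A) (proj3_of3 A)) (m f)"
    using rack_laws(2) by (simp only: op_app[OF f, symmetric])
  show ?thesis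
    using 1[OF mf[OF f]] 2[OF mf[OF f]] f by (simp only: 3 compose_eq)
qed

text \<open>The same argument, with \<open>F\<close> splitting over the two occurrences of \<open>z\<close> and the remaining
  factors collapsing because \<open>x \<triangleright>\<^sup>-\<^sup>1 e = x\<close>.\<close>

lemma right_jacobi:
  assumes D: "D \<in> derivations A \<epsilon>" and E: "E \<in> derivations A \<epsilon>" and F: "F \<in> derivations A \<epsilon>" and f: "f \<in> carrier A"
  shows "convolution mi (convolution mi D E) F f =
    convolution mi (convolution mi D F) E f + convolution mi D (convolution mi E F) f"
proof -
  note D' = derivations_linear[OF D] and E' = derivations_linear[OF E] and F' = derivations_linear[OF F]
  note lin = D' E' F'
  note T = triple_linear[OF lin]
  note proj = projections3_alg_hom
  note op = point_op_alg_hom[OF A A3 mi]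
  have op_app: "point_op A A3 mi x y p = tensor_map A A A3 x y (mi p)" if "p \<in> carrier A" for x y p
    using that by (simp add: point_op_def compose_def)
  note mf = alg_homD(1)[OF mi]
  have 1: "triple D E F (tensor_map A A A3 (point_op A A3 mi (proj1_of3 A) (proj2_of3 A)) (proj3_of3 A) u) =
      pairing (convolution mi D E) F u" if u: "u \<in> carrier A2" for u
  proof (rule tensor_maps_eqI[OF A A K linear_maps_compose[OF tensor_map_linear[OF A A A3] T] pairing_linear _ u])
    fix p r assume pr: "p \<in> carrier A" "r \<in> carrier A"
    then show "triple D E F (tensor_map A A A3 (point_op A A3 mi (proj1_of3 A) (proj2_of3 A)) (proj3_of3 A) (pure_tensor A A p r)) =
      pairing (convolution mi D E) F (pure_tensor A A p r)"
      by (simp only: tensor_map_pure[OF A A A3] alg_hom_linear proj op op_app pairing_pure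
          triple_map12_proj3 lin mf convolution_linear[OF mi]) (simp only: compose_eq)
  qed (simp_all only: alg_hom_linear proj op convolution_linear[OF mi] lin)
  have 2: "triple D E F (tensor_map A A A3 (point_op A A3 mi (proj1_of3 A) (proj3_of3 A))
        (point_op A A3 mi (proj2_of3 A) (proj3_of3 A)) u) =
      pairing (convolution mi D F) E u + pairing D (convolution mi E F) u" if u: "u \<in> carrier A2" for u
  proof (rule tensor_maps_eqI[OF A A K linear_maps_compose[OF tensor_map_linear[OF A A A3] T]
        linear_add[OF pairing_linear pairing_linear] _ u])
    fix p r assume pr: "p \<in> carrier A" "r \<in> carrier A"
    then show "triple D E F (tensor_map A A A3 (point_op A A3 mi (proj1_of3 A) (proj3_of3 A))
        (point_op A A3 mi (proj2_of3 A) (proj3_of3 A)) (pure_tensor A A p r)) =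
      pairing (convolution mi D F) E (pure_tensor A A p r) + pairing D (convolution mi E F) (pure_tensor A A p r)"
      by (simp only: tensor_map_pure[OF A A A3] alg_hom_linear proj op op_app pairing_pure
          triple_map13_map23[OF _ _ F] lin mf convolution_linear[OF mi] pairing_nabla) (simp only: compose_eq)
  qed (simp_all only: alg_hom_linear proj op convolution_linear[OF mi] lin)
  have 3: "tensor_map A A A3 (point_op A A3 mi (proj1_of3 A) (proj2_of3 A)) (proj3_of3 A) (mi f) =
      tensor_map A A A3 (point_op A A3 mi (proj1_of3 A) (proj3_of3 A)) (point_op A A3 mi (proj2_of3 A) (proj3_of3 A)) (mi f)"
    using rack_laws(3) by (simp only: op_app[OF f, symmetric])
  show ?thesis
    using 1[OF mf[OF f]] 2[OF mf[OF f]] f by (simp only: 3 compose_eq)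
qed

theorem left_leibniz_left_tangent: "left_leibniz (left_tangent Q)"
proof -
  let ?L = "functional_algebra (carrier A) (derivations A \<epsilon>) (convolution m)"
  let ?b = "bracket ?L"
  have "?b D (?b E F) = ?b (?b D E) F \<oplus>\<^bsub>?L\<^esub> ?b E (?b D F)"
    if DEF: "D \<in> derivations A \<epsilon>" "E \<in> derivations A \<epsilon>" "F \<in> derivations A \<epsilon>" for D E F
    unfolding functional_algebra_simps
    by (simp only: functional_algebra_bracket bracket_closed DEF,
        rule extensionalityI[of _ "carrier A"], rule compose_extensional, rule restrict_extensional,
        simp only: restrict_apply' left_jacobi[OF DEF])
  then show ?thesis
    unfolding left_leibniz_def left_tangent_def Let_def functional_algebra_simps(1)
    using bilinear_bracket_convolution[OF m bracket_closed(1)] by blast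
qed

theorem right_leibniz_right_tangent: "right_leibniz (right_tangent Q)"
proof -
  let ?L = "functional_algebra (carrier A) (derivations A \<epsilon>) (convolution mi)"
  let ?b = "bracket ?L"
  have "?b (?b D E) F = ?b (?b D F) E \<oplus>\<^bsub>?L\<^esub> ?b D (?b E F)"
    if DEF: "D \<in> derivations A \<epsilon>" "E \<in> derivations A \<epsilon>" "F \<in> derivations A \<epsilon>" for D E F
    unfolding functional_algebra_simps
    by (simp only: functional_algebra_bracket bracket_closed DEF,
        rule extensionalityI[of _ "carrier A"], rule compose_extensional, rule restrict_extensional,
        simp only: restrict_apply' right_jacobi[OF DEF])
  then show ?thesis
    unfolding right_leibniz_def right_tangent_def Let_def functional_algebra_simps(1)
    using bilinear_bracket_convolution[OF mi bracket_closed(2)] by blast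
qed

end

section \<open>Functoriality\<close>

definition intertwines ::
    "('k::field, 'a) module \<Rightarrow> ('a \<Rightarrow> (('a \<times> 'a) \<Rightarrow>\<^sub>0 'k) set) \<Rightarrow>
     ('k, 'b) module \<Rightarrow> ('b \<Rightarrow> (('b \<times> 'b) \<Rightarrow>\<^sub>0 'k) set) \<Rightarrow> ('b \<Rightarrow> 'a) \<Rightarrow> bool" where
  "intertwines A m B n h \<longleftrightarrow> compose (carrier B) m h =
     point_op B (tensor A A) n (compose (carrier B) (proj1_of2 A) h) (compose (carrier B) (proj2_of2 A) h)"

text \<open>The projections are the generic pair of points, so the composite of \<^const>\<open>point_op\<close> with them is
  the operation itself.\<close>

lemma rack_hom_iff:
  assumes "affine_rack Q"
  shows "h \<in> rack_hom Q Q' \<longleftrightarrow> h \<in> alg_hom (coord Q') (coord Q) \<and>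
    intertwines (coord Q) (nabla Q) (coord Q') (nabla Q') h \<and>
    intertwines (coord Q) (nabla_inv Q) (coord Q') (nabla_inv Q') h \<and>
    compose (carrier (coord Q')) (counit Q) h = counit Q'"
  using affine_rackD[OF assms] by (simp add: rack_hom_def Let_def point_op_generic intertwines_def)

lemma intertwines_identity:
  assumes A: "algebra base_field A" and m: "m \<in> alg_hom A (tensor A A)"
  shows "intertwines A m A m (\<lambda>a\<in>carrier A. a)"
proof -
  have id: "compose (carrier A) x (\<lambda>a\<in>carrier A. a) = x" if "x \<in> extensional (carrier A)" for x :: "'b \<Rightarrow> 'c"
    using that by (intro extensionalityI[of _ "carrier A"]) (auto simp: compose_eq)
  show ?thesis
    using alg_homD(6)[OF m] alg_homD(6)[OF tensor_inl_alg_hom[OF A A]] alg_homD(6)[OF tensor_inr_alg_hom[OF A A]]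
    by (simp add: intertwines_def id point_op_generic[OF A m])
qed

lemma intertwines_compose:
  assumes A: "algebra base_field A" and B: "algebra base_field B" and C: "algebra base_field C"
    and n: "n \<in> alg_hom B (tensor B B)" and l: "l \<in> alg_hom C (tensor C C)"
    and f: "f \<in> alg_hom B A" and g: "g \<in> alg_hom C B"
    and mf: "intertwines A m B n f" and ng: "intertwines B n C l g"
  shows "intertwines A m C l (compose (carrier C) f g)"
proof -
  note A2 = algebra_tensor[OF A A] and B2 = algebra_tensor[OF B B]
  note inl = tensor_inl_alg_hom[OF A A] and inr = tensor_inr_alg_hom[OF A A]
  note inlB = tensor_inl_alg_hom[OF B B] and inrB = tensor_inr_alg_hom[OF B B]
  let ?x = "compose (carrier B) (proj1_of2 A) f" and ?y = "compose (carrier B) (proj2_of2 A) f"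
  let ?H = "tensor_map B B (tensor A A) ?x ?y"
  have x: "?x \<in> alg_hom B (tensor A A)" and y: "?y \<in> alg_hom B (tensor A A)"
    using alg_hom_compose[OF f inl B] alg_hom_compose[OF f inr B] by auto
  note H = tensor_map_alg_hom[OF B B A2 x y]
  have gc: "g c \<in> carrier B" if "c \<in> carrier C" for c using alg_homD(1)[OF g that] .
  have "compose (carrier C) m (compose (carrier C) f g) = compose (carrier C) (compose (carrier B) m f) g"
    using gc by (intro extensionalityI[of _ "carrier C"]) (auto simp: compose_eq)
  also have "\<dots> = compose (carrier C) ?H (compose (carrier C) n g)"
    using mf gc by (intro extensionalityI[of _ "carrier C"]) (auto simp: compose_eq intertwines_def point_op_def)
  also have "\<dots> = compose (carrier C) ?H (point_op C (tensor B B) l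
      (compose (carrier C) (proj1_of2 B) g) (compose (carrier C) (proj2_of2 B) g))"
    using ng by (simp add: intertwines_def)
  also have "\<dots> = point_op C (tensor A A) l
      (compose (carrier C) ?H (compose (carrier C) (proj1_of2 B) g))
      (compose (carrier C) ?H (compose (carrier C) (proj2_of2 B) g))"
    by (rule point_op_natural[OF C B2 A2 l alg_hom_compose[OF g inlB C] alg_hom_compose[OF g inrB C] H])
  also have "compose (carrier C) ?H (compose (carrier C) (proj1_of2 B) g) =
      compose (carrier C) (compose (carrier B) ?H (proj1_of2 B)) g"
    using gc by (intro extensionalityI[of _ "carrier C"]) (auto simp: compose_eq)
  also have "compose (carrier B) ?H (proj1_of2 B) = ?x" by (rule tensor_map_inl[OF B B A2 x y])
  also have "compose (carrier C) ?x g = compose (carrier C) (proj1_of2 A) (compose (carrier C) f g)"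
    using gc by (intro extensionalityI[of _ "carrier C"]) (auto simp: compose_eq)
  also have "compose (carrier C) ?H (compose (carrier C) (proj2_of2 B) g) =
      compose (carrier C) (compose (carrier B) ?H (proj2_of2 B)) g"
    using gc by (intro extensionalityI[of _ "carrier C"]) (auto simp: compose_eq)
  also have "compose (carrier B) ?H (proj2_of2 B) = ?y" by (rule tensor_map_inr[OF B B A2 x y])
  also have "compose (carrier C) ?y g = compose (carrier C) (proj2_of2 A) (compose (carrier C) f g)"
    using gc by (intro extensionalityI[of _ "carrier C"]) (auto simp: compose_eq)
  finally show ?thesis by (simp add: intertwines_def)
qed

lemma is_category_rack_category: "is_category (rack_category :: (('k::field, 'a) rack_scheme, 'a \<Rightarrow> 'a) cat)"
proof -
  have comp: "compose (carrier (coord Z)) f g \<in> rack_hom X Z"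
    if "affine_rack X" "affine_rack Y" "affine_rack Z" "f \<in> rack_hom X Y" "g \<in> rack_hom Y Z"
    for X Y Z :: "('k, 'a) rack_scheme" and f g
  proof -
    note X = affine_rackD[OF that(1)] and Y = affine_rackD[OF that(2)] and Z = affine_rackD[OF that(3)]
    have f: "f \<in> alg_hom (coord Y) (coord X)" "compose (carrier (coord Y)) (counit X) f = counit Y"
      "intertwines (coord X) (nabla X) (coord Y) (nabla Y) f"
      "intertwines (coord X) (nabla_inv X) (coord Y) (nabla_inv Y) f"
      and g: "g \<in> alg_hom (coord Z) (coord Y)" "compose (carrier (coord Z)) (counit Y) g = counit Z"
      "intertwines (coord Y) (nabla Y) (coord Z) (nabla Z) g"
      "intertwines (coord Y) (nabla_inv Y) (coord Z) (nabla_inv Z) g"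
      using that by (auto simp: rack_hom_iff)
    have "compose (carrier (coord Z)) (counit X) (compose (carrier (coord Z)) f g) =
        compose (carrier (coord Z)) (compose (carrier (coord Y)) (counit X) f) g"
      using alg_homD(1)[OF g(1)] by (intro extensionalityI[of _ "carrier (coord Z)"]) (auto simp: compose_eq)
    then show ?thesis
      using f g by (simp add: rack_hom_iff[OF that(1)] alg_hom_compose[OF g(1) f(1) Z(1)]
          intertwines_compose[OF X(1) Y(1) Z(1) Y(3) Z(3) f(1) g(1) f(3) g(3)]
          intertwines_compose[OF X(1) Y(1) Z(1) Y(4) Z(4) f(1) g(1) f(4) g(4)])
  qed
  have ident: "(\<lambda>a\<in>carrier (coord X). a) \<in> rack_hom X X" if "affine_rack X" for X :: "('k, 'a) rack_scheme"
  proof -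
    note X = affine_rackD[OF that]
    have "compose (carrier (coord X)) (counit X) (\<lambda>a\<in>carrier (coord X). a) = counit X"
      using alg_homD(6)[OF X(5)] by (intro extensionalityI[of _ "carrier (coord X)"]) (auto simp: compose_eq)
    then show ?thesis
      by (simp add: rack_hom_iff[OF that] identity_alg_hom[OF X(1)] intertwines_identity[OF X(1) X(3)]
          intertwines_identity[OF X(1) X(4)])
  qed
  have hom: "f \<in> extensional (carrier (coord Y))" "\<And>a. a \<in> carrier (coord Y) \<Longrightarrow> f a \<in> carrier (coord X)"
    if "affine_rack X" "f \<in> rack_hom X Y" for X Y :: "('k, 'a) rack_scheme" and f
    using that by (auto simp: rack_hom_iff dest: alg_homD)
  show ?thesis
    unfolding is_category_def rack_category_def cat.simps mem_Collect_eq
    by (intro conjI ballI ident comp; (assumption | simp)?;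
        rule extensionalityI[of _ "carrier (coord Y)" for Y];
        (rule compose_extensional | rule hom; assumption)?)
       (auto simp: compose_eq hom)
qed

lemma bilinear_bracketD:
  assumes "bilinear_bracket L" "x \<in> carrier L" "y \<in> carrier L"
  shows "x \<oplus>\<^bsub>L\<^esub> y \<in> carrier L" "c \<odot>\<^bsub>L\<^esub> x \<in> carrier L" "bracket L x y \<in> carrier L"
proof -
  interpret module base_field L using assms(1) by (simp add: bilinear_bracket_def)
  show "x \<oplus>\<^bsub>L\<^esub> y \<in> carrier L" "c \<odot>\<^bsub>L\<^esub> x \<in> carrier L" "bracket L x y \<in> carrier L"
    using assms by (auto simp: bilinear_bracket_def)
qed

lemma leibniz_homD:
  assumes "h \<in> leibniz_hom L M"
  shows "x \<in> carrier L \<Longrightarrow> h x \<in> carrier M" "h \<in> extensional (carrier L)"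
    "x \<in> carrier L \<Longrightarrow> y \<in> carrier L \<Longrightarrow> h (x \<oplus>\<^bsub>L\<^esub> y) = h x \<oplus>\<^bsub>M\<^esub> h y"
    "x \<in> carrier L \<Longrightarrow> y \<in> carrier L \<Longrightarrow> h (bracket L x y) = bracket M (h x) (h y)"
    "x \<in> carrier L \<Longrightarrow> h (c \<odot>\<^bsub>L\<^esub> x) = c \<odot>\<^bsub>M\<^esub> h x"
  using assms by (auto simp: leibniz_hom_def PiE_def)

lemma is_category_bracket_category:
  fixes P :: "('k::field, 'v) bracket_module \<Rightarrow> bool"
  assumes P: "\<And>L. P L \<Longrightarrow> bilinear_bracket L"
  shows "is_category (bracket_category P)"
proof -
  have comp: "compose (carrier X) g f \<in> leibniz_hom X Z"
    if "P X" "f \<in> leibniz_hom X Y" "g \<in> leibniz_hom Y Z" for X Y Z :: "('k, 'v) bracket_module" and f g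
    using bilinear_bracketD[OF P[OF that(1)]] leibniz_homD[OF that(2)] leibniz_homD[OF that(3)]
    by (auto simp: leibniz_hom_def compose_eq PiE_def)
  have ident: "(\<lambda>x\<in>carrier X. x) \<in> leibniz_hom X X" if "P X" for X
    using bilinear_bracketD[OF P[OF that(1)]] by (auto simp: leibniz_hom_def PiE_def)
  show ?thesis
    unfolding is_category_def bracket_category_def cat.simps mem_Collect_eq
    by (intro conjI ballI ident comp; (assumption | simp)?;
        rule extensionalityI[of _ "carrier X" for X];
        (rule compose_extensional | rule leibniz_homD; assumption)?)
       (auto simp: compose_eq leibniz_homD)
qed

text \<open>The condition on a rack morphism, tested against \<open>D \<otimes> E\<close>: this is compatibility of the
  differential with brackets.\<close>

lemma intertwines_pairing:
  assumes A: "algebra base_field A" and B: "algebra base_field B" and n: "n \<in> alg_hom B (tensor B B)"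
    and h: "h \<in> alg_hom B A" and I: "intertwines A m B n h"
    and D: "D \<in> linear_maps A base_algebra" and E: "E \<in> linear_maps A base_algebra" and f: "f \<in> carrier B"
  shows "tensor_map A A base_algebra D E (m (h f)) =
    tensor_map B B base_algebra (compose (carrier B) D h) (compose (carrier B) E h) (n f)"
proof -
  interpret A: algebra base_field A by fact
  interpret B: algebra base_field B by fact
  note K = algebra_base_algebra and A2 = algebra_tensor[OF A A]
  let ?x = "compose (carrier B) (proj1_of2 A) h" and ?y = "compose (carrier B) (proj2_of2 A) h"
  have x: "?x \<in> linear_maps B (tensor A A)" and y: "?y \<in> linear_maps B (tensor A A)"
    using alg_hom_compose[OF h tensor_inl_alg_hom[OF A A] B] alg_hom_compose[OF h tensor_inr_alg_hom[OF A A] B]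
    by (auto intro: alg_hom_linear)
  have Dh: "compose (carrier B) D h \<in> linear_maps B base_algebra"
    if "D \<in> linear_maps A base_algebra" for D
    using linear_maps_compose[OF alg_hom_linear[OF h] that]
    by (auto simp: linear_maps_def compose_def)
  have "tensor_map A A base_algebra D E (tensor_map B B (tensor A A) ?x ?y u) =
      tensor_map B B base_algebra (compose (carrier B) D h) (compose (carrier B) E h) u"
    if u: "u \<in> carrier (tensor B B)" for u
  proof (rule tensor_maps_eqI[OF B B K linear_maps_compose[OF tensor_map_linear[OF B B A2 x y] tensor_map_linear[OF A A K D E]]
        tensor_map_linear[OF B B K Dh[OF D] Dh[OF E]] _ u])
    fix p q assume pq: "p \<in> carrier B" "q \<in> carrier B"
    have hpq: "h p \<in> carrier A" "h q \<in> carrier A" using pq alg_homD(1)[OF h] by auto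
    have "tensor_map B B (tensor A A) ?x ?y (pure_tensor B B p q) = pure_tensor A A (h p) (h q)"
      using pq hpq by (simp add: tensor_map_pure[OF B B A2 x y])
        (simp add: compose_eq tensor_inl_def tensor_inr_def pure_mult[OF A A])
    then show "tensor_map A A base_algebra D E (tensor_map B B (tensor A A) ?x ?y (pure_tensor B B p q)) =
      tensor_map B B base_algebra (compose (carrier B) D h) (compose (carrier B) E h) (pure_tensor B B p q)"
      using pq hpq by (simp add: tensor_map_pure[OF A A K D E] tensor_map_pure[OF B B K Dh[OF D] Dh[OF E]])
        (simp add: compose_eq)
  qed
  from this[OF alg_homD(1)[OF n f]] show ?thesis
    using I f by (simp add: intertwines_def point_op_def compose_def fun_eq_iff split: if_splits)
qed

lemma derivations_pullback:
  assumes "algebra base_field B" and h: "h \<in> alg_hom B A" and c: "compose (carrier B) \<epsilon> h = \<epsilon>'" and D: "D \<in> derivations A \<epsilon>"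
  shows "compose (carrier B) D h \<in> derivations B \<epsilon>'"
proof -
  interpret B: algebra base_field B by fact
  have "\<epsilon>' f = \<epsilon> (h f)" if "f \<in> carrier B" for f
    using that unfolding c[symmetric] by (simp add: compose_eq)
  then show ?thesis
    using D by (auto simp: derivations_def compose_def alg_homD[OF h])
qed

lemma differential_leibniz_hom:
  assumes X: "affine_rack X" and Y: "affine_rack Y" and h: "h \<in> rack_hom X Y"
  shows "differential_at_unit X Y h \<in> leibniz_hom (left_tangent X) (left_tangent Y)"
    and "differential_at_unit X Y h \<in> leibniz_hom (right_tangent X) (right_tangent Y)"
proof -
  note X' = affine_rackD[OF X] and Y' = affine_rackD[OF Y]
  interpret X: affine_rack_scheme X by (simp add: affine_rack_scheme_def X)
  have f: "h \<in> alg_hom (coord Y) (coord X)" "compose (carrier (coord Y)) (counit X) h = counit Y"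
      "intertwines (coord X) (nabla X) (coord Y) (nabla Y) h"
      "intertwines (coord X) (nabla_inv X) (coord Y) (nabla_inv Y) h"
    using h X by (auto simp: rack_hom_iff)
  note pull = derivations_pullback[OF Y'(1) f(1,2)]
  note S = functional_space_derivations[OF X'(1), of "counit X"]
  have gen: "differential_at_unit X Y h \<in> leibniz_hom
      (functional_algebra (carrier (coord X)) (derivations (coord X) (counit X)) (X.convolution m))
      (functional_algebra (carrier (coord Y)) (derivations (coord Y) (counit Y))
        (\<lambda>D E. compose (carrier (coord Y)) (tensor_map (coord Y) (coord Y) base_algebra D E) n))"
    if n: "n \<in> alg_hom (coord Y) (tensor (coord Y) (coord Y))" and I: "intertwines (coord X) m (coord Y) n h"
      and cl: "\<And>D E. D \<in> derivations (coord X) (counit X) \<Longrightarrow> E \<in> derivations (coord X) (counit X) \<Longrightarrow>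
        X.convolution m D E \<in> derivations (coord X) (counit X)"
    for m n
  proof -
    have "compose (carrier (coord Y)) (X.convolution m D E) h =
        compose (carrier (coord Y)) (tensor_map (coord Y) (coord Y) base_algebra
          (compose (carrier (coord Y)) D h) (compose (carrier (coord Y)) E h)) n"
      if "D \<in> derivations (coord X) (counit X)" "E \<in> derivations (coord X) (counit X)" for D E
      using intertwines_pairing[OF X'(1) Y'(1) n f(1) I] that alg_homD(1)[OF f(1)]
      by (intro extensionalityI[of _ "carrier (coord Y)"]) (auto simp: compose_eq derivations_linear)
    then show ?thesis
      using S cl pull alg_homD(1)[OF f(1)]
      by (auto simp: leibniz_hom_def functional_space_def differential_at_unit_def PiE_def
          intro!: extensionalityI[of _ "carrier (coord Y)"]) (auto simp: compose_eq)
  qed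
  show "differential_at_unit X Y h \<in> leibniz_hom (left_tangent X) (left_tangent Y)"
    "differential_at_unit X Y h \<in> leibniz_hom (right_tangent X) (right_tangent Y)"
    using gen[OF Y'(3) f(3) X.bracket_closed(1)] gen[OF Y'(4) f(4) X.bracket_closed(2)]
    by (simp_all add: left_tangent_def right_tangent_def Let_def)
qed

lemma is_functor_tangent:
  fixes T :: "('k::field, 'a) rack_scheme \<Rightarrow> ('k, 'a \<Rightarrow> 'k) bracket_module"
  assumes "\<And>Q. affine_rack Q \<Longrightarrow> P (T Q)" "\<And>L :: ('k, 'a \<Rightarrow> 'k) bracket_module. P L \<Longrightarrow> bilinear_bracket L"
    and carrier: "\<And>Q. carrier (T Q) = derivations (coord Q) (counit Q)"
    and hom: "\<And>X Y h. affine_rack X \<Longrightarrow> affine_rack Y \<Longrightarrow> h \<in> rack_hom X Y \<Longrightarrow>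
      differential_at_unit X Y h \<in> leibniz_hom (T X) (T Y)"
  shows "is_functor (rack_category :: (('k, 'a) rack_scheme, 'a \<Rightarrow> 'a) cat) (bracket_category P) T differential_at_unit"
proof -
  have ident: "differential_at_unit X X (\<lambda>a\<in>carrier (coord X). a) = (\<lambda>D\<in>carrier (T X). D)"
    for X :: "('k, 'a) rack_scheme"
    unfolding differential_at_unit_def carrier
    by (intro restrict_ext extensionalityI[of _ "carrier (coord X)"]) (auto simp: compose_eq derivations_def)
  have comp: "differential_at_unit X Z (compose (carrier (coord Z)) f g) =
      compose (carrier (T X)) (differential_at_unit Y Z g) (differential_at_unit X Y f)"
    if X: "affine_rack X" and Y: "affine_rack Y" and f: "f \<in> rack_hom X Y" and g: "g \<in> rack_hom Y Z"
    for X Y Z :: "('k, 'a) rack_scheme" and f g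
  proof -
    have f': "f \<in> alg_hom (coord Y) (coord X)" "compose (carrier (coord Y)) (counit X) f = counit Y"
      and g': "g \<in> alg_hom (coord Z) (coord Y)"
      using f g X Y by (auto simp: rack_hom_iff)
    show ?thesis
      unfolding differential_at_unit_def carrier compose_def[of "derivations (coord X) (counit X)"]
      using derivations_pullback[OF affine_rackD(1)[OF Y] f'] alg_homD(1)[OF g']
      by (intro restrict_ext extensionalityI[of _ "carrier (coord Z)"]) (auto simp: compose_eq)
  qed
  show ?thesis
    unfolding is_functor_def
    using is_category_rack_category is_category_bracket_category[of P, OF assms(2)]
    by (auto simp: rack_category_def bracket_category_def assms(1) hom ident comp)
qed

theorem is_functor_left_tangent:
  "is_functor (rack_category :: (('k::field, 'a) rack_scheme, 'a \<Rightarrow> 'a) cat) left_leibniz_category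
      left_tangent differential_at_unit"
proof (rule is_functor_tangent)
  fix Q :: "('k, 'a) rack_scheme" assume "affine_rack Q"
  then interpret affine_rack_scheme Q by (rule affine_rack_scheme.intro)
  show "left_leibniz (left_tangent Q)" by (rule left_leibniz_left_tangent)
qed (simp_all add: left_leibniz_def left_tangent_def Let_def differential_leibniz_hom(1)[unfolded left_tangent_def Let_def])

theorem is_functor_right_tangent:
  "is_functor (rack_category :: (('k::field, 'a) rack_scheme, 'a \<Rightarrow> 'a) cat) right_leibniz_category
      right_tangent differential_at_unit"
proof (rule is_functor_tangent)
  fix Q :: "('k, 'a) rack_scheme" assume "affine_rack Q"
  then interpret affine_rack_scheme Q by (rule affine_rack_scheme.intro)
  show "right_leibniz (right_tangent Q)" by (rule right_leibniz_right_tangent)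
qed (simp_all add: right_leibniz_def right_tangent_def Let_def differential_leibniz_hom(2)[unfolded right_tangent_def Let_def])

section \<open>Conjugation\<close>

locale affine_group_scheme =
  fixes G :: "('k::field, 'a) group_scheme" (structure)
  assumes G: "affine_group G"
begin

lemma algebra_gcoord: "algebra base_field (gcoord G)"
  and comult: "comult G \<in> alg_hom (gcoord G) (tensor (gcoord G) (gcoord G))"
  and gcounit: "gcounit G \<in> alg_hom (gcoord G) base_algebra"
  and antipode: "antipode G \<in> alg_hom (gcoord G) (gcoord G)"
  using G by (auto simp: affine_group_def Let_def fg_algebra_def)

sublocale pointed_algebra "gcoord G" "gcounit G"
  by (rule pointed_algebra.intro[OF algebra_gcoord gcounit])

abbreviation "A \<equiv> gcoord G"
abbreviation "\<Delta> \<equiv> comult G"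
abbreviation "\<epsilon> \<equiv> gcounit G"
abbreviation "S \<equiv> antipode G"
abbreviation "i \<equiv> \<lambda>a\<in>carrier A. a"

lemma group_laws:
  "point_op A A3 \<Delta> (point_op A A3 \<Delta> (proj1_of3 A) (proj2_of3 A)) (proj3_of3 A) =
    point_op A A3 \<Delta> (proj1_of3 A) (point_op A A3 \<Delta> (proj2_of3 A) (proj3_of3 A))"
  "point_op A A \<Delta> (point_unit A A \<epsilon>) i = i"
  "point_op A A \<Delta> i (point_unit A A \<epsilon>) = i"
  "point_op A A \<Delta> S i = point_unit A A \<epsilon>"
  using G unfolding affine_group_def Let_def by blast+

definition points :: "('k, 'r) module \<Rightarrow> ('a \<Rightarrow> 'r) monoid" where
  "points R = \<lparr>carrier = alg_hom A R, monoid.mult = point_op A R \<Delta>, one = point_unit A R \<epsilon>\<rparr>"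

lemma points_simps [simp]:
  "carrier (points R) = alg_hom A R" "x \<otimes>\<^bsub>points R\<^esub> y = point_op A R \<Delta> x y"
  "\<one>\<^bsub>points R\<^esub> = point_unit A R \<epsilon>"
  by (simp_all add: points_def)

lemma compose_point_unit:
  assumes R: "algebra base_field R" and "algebra base_field R'" and h: "h \<in> alg_hom R R'"
  shows "compose (carrier A) h (point_unit A R \<epsilon>) = point_unit A R' \<epsilon>"
proof -
  interpret R: algebra base_field R by fact
  show ?thesis
    by (intro extensionalityI[of _ "carrier A"]) (auto simp: compose_def point_unit_def alg_homD[OF h])
qed

lemma compose_identity: "x \<in> extensional (carrier A) \<Longrightarrow> compose (carrier A) x i = x"
  by (intro extensionalityI[of _ "carrier A"]) (auto simp: compose_eq)

lemma proj3_compose: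
  assumes R: "algebra base_field R" and xyz: "x \<in> alg_hom A R" "y \<in> alg_hom A R" "z \<in> alg_hom A R"
  defines "h \<equiv> tensor_map A2 A R (tensor_map A A R x y) z"
  shows "h \<in> alg_hom A3 R" "compose (carrier A) h (proj1_of3 A) = x"
    "compose (carrier A) h (proj2_of3 A) = y" "compose (carrier A) h (proj3_of3 A) = z"
proof -
  note xy = tensor_map_alg_hom[OF A A R xyz(1,2)]
  show "h \<in> alg_hom A3 R" unfolding h_def by (rule tensor_map_alg_hom[OF A2 A R xy xyz(3)])
  have h: "h t = tensor_map A A R x y u" if "t = tensor_inl A2 A u" "u \<in> carrier A2" for t u
    using fun_cong[OF tensor_map_inl[OF A2 A R xy xyz(3)], of u] that by (simp add: h_def compose_eq)
  note inl = alg_homD(1)[OF tensor_inl_alg_hom[OF A A]] and inr = alg_homD(1)[OF tensor_inr_alg_hom[OF A A]]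
  have "compose (carrier A) h (proj1_of3 A) = compose (carrier A) (tensor_map A A R x y) (proj1_of2 A)"
    using inl by (intro extensionalityI[of _ "carrier A"]) (auto simp: compose_eq h)
  then show "compose (carrier A) h (proj1_of3 A) = x" by (simp only: tensor_map_inl[OF A A R xyz(1,2)])
  have "compose (carrier A) h (proj2_of3 A) = compose (carrier A) (tensor_map A A R x y) (proj2_of2 A)"
    using inr by (intro extensionalityI[of _ "carrier A"]) (auto simp: compose_eq h)
  then show "compose (carrier A) h (proj2_of3 A) = y" by (simp only: tensor_map_inr[OF A A R xyz(1,2)])
  show "compose (carrier A) h (proj3_of3 A) = z"
    unfolding h_def by (rule tensor_map_inr[OF A2 A R xy xyz(3)])
qed

text \<open>The axioms of a group scheme are equations between projections; base change carries them to
  the points of every algebra. After this, the rack axioms for conjugation are ordinary group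
  theory.\<close>

lemma group_points:
  assumes R: "algebra base_field R"
  shows "group (points R)"
proof (rule groupI)
  note unit = point_unit_alg_hom[OF A R gcounit]
  show "\<one>\<^bsub>points R\<^esub> \<in> carrier (points R)" using unit by simp
  fix x assume "x \<in> carrier (points R)"
  then have x: "x \<in> alg_hom A R" by simp
  note e = point_unit_alg_hom[OF A A gcounit] and id = identity_alg_hom[OF A]
  have cx: "compose (carrier A) x i = x" by (rule compose_identity[OF alg_homD(6)[OF x]])
  show "\<one>\<^bsub>points R\<^esub> \<otimes>\<^bsub>points R\<^esub> x = x"
    using point_op_natural[OF A A R comult e id x] by (simp add: group_laws cx compose_point_unit[OF A R x])
  have Sx: "compose (carrier A) x S \<in> alg_hom A R" by (rule alg_hom_compose[OF antipode x A])
  show "\<exists>y\<in>carrier (points R). y \<otimes>\<^bsub>points R\<^esub> x = \<one>\<^bsub>points R\<^esub>"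
    using point_op_natural[OF A A R comult antipode id x] Sx
    by (auto simp: group_laws cx compose_point_unit[OF A R x])
  fix y assume "y \<in> carrier (points R)"
  then have y: "y \<in> alg_hom A R" by simp
  show "x \<otimes>\<^bsub>points R\<^esub> y \<in> carrier (points R)" using point_op_alg_hom[OF A R comult x y] by simp
  fix z assume "z \<in> carrier (points R)"
  then have z: "z \<in> alg_hom A R" by simp
  note h = proj3_compose[OF R x y z]
  note p = projections3_alg_hom and o = point_op_alg_hom[OF A A3 comult]
  note nat = point_op_natural[OF A A3 R comult _ _ h(1)]
  have "point_op A R \<Delta> (point_op A R \<Delta> x y) z = point_op A R \<Delta> x (point_op A R \<Delta> y z)"
    using arg_cong[OF group_laws(1), of "compose (carrier A) (tensor_map A2 A R (tensor_map A A R x y) z)"]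
    by (simp only: nat p o h(2,3,4))
  then show "(x \<otimes>\<^bsub>points R\<^esub> y) \<otimes>\<^bsub>points R\<^esub> z = x \<otimes>\<^bsub>points R\<^esub> (y \<otimes>\<^bsub>points R\<^esub> z)"
    by simp
qed

lemma inv_points:
  assumes R: "algebra base_field R" and x: "x \<in> alg_hom A R"
  shows "compose (carrier A) x S = inv\<^bsub>points R\<^esub> x"
proof -
  interpret P: group "points R" by (rule group_points[OF R])
  note id = identity_alg_hom[OF A]
  have cx: "compose (carrier A) x i = x" by (rule compose_identity[OF alg_homD(6)[OF x]])
  have Sx: "compose (carrier A) x S \<in> alg_hom A R" by (rule alg_hom_compose[OF antipode x A])
  have "compose (carrier A) x S \<otimes>\<^bsub>points R\<^esub> x = \<one>\<^bsub>points R\<^esub>"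
    using point_op_natural[OF A A R comult antipode id x]
    by (simp add: group_laws cx compose_point_unit[OF A R x])
  then show ?thesis using P.inv_equality[of "compose (carrier A) x S" x] x Sx by simp
qed

lemma coord_Conj [simp]: "coord (Conj G) = A" "counit (Conj G) = \<epsilon>"
  by (simp_all add: Conj_def Let_def)

lemmas proj2 = tensor_inl_alg_hom[OF A A] tensor_inr_alg_hom[OF A A]

lemma Conj_operations:
  "nabla (Conj G) = point_op A A2 \<Delta> (point_op A A2 \<Delta> (proj1_of2 A) (proj2_of2 A))
      (compose (carrier A) (proj1_of2 A) S)"
  "nabla_inv (Conj G) = point_op A A2 \<Delta> (point_op A A2 \<Delta> (compose (carrier A) (proj2_of2 A) S) (proj1_of2 A))
      (proj2_of2 A)"
  by (simp_all add: Conj_def Let_def)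

lemma Conj_operations_alg_hom:
  "nabla (Conj G) \<in> alg_hom A A2" "nabla_inv (Conj G) \<in> alg_hom A A2"
  unfolding Conj_operations
  by (intro point_op_alg_hom[OF A A2 comult] proj2 alg_hom_compose[OF antipode] A)+

lemma point_op_Conj:
  assumes R: "algebra base_field R" and x: "x \<in> alg_hom A R" and y: "y \<in> alg_hom A R"
  shows "point_op A R (nabla (Conj G)) x y = x \<otimes>\<^bsub>points R\<^esub> y \<otimes>\<^bsub>points R\<^esub> inv\<^bsub>points R\<^esub> x"
    and "point_op A R (nabla_inv (Conj G)) x y = inv\<^bsub>points R\<^esub> y \<otimes>\<^bsub>points R\<^esub> x \<otimes>\<^bsub>points R\<^esub> y"
proof -
  note h = tensor_map_alg_hom[OF A A R x y]
  note nat = point_op_natural[OF A A2 R comult _ _ h]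
  note o = point_op_alg_hom[OF A A2 comult] and inv = alg_hom_compose[OF antipode proj2(1) A] alg_hom_compose[OF antipode proj2(2) A]
  have assoc: "compose (carrier A) h (compose (carrier A) p S) = compose (carrier A) (compose (carrier A) h p) S"
    for h :: "(('a \<times> 'a) \<Rightarrow>\<^sub>0 'k) set \<Rightarrow> 'c" and p
    using alg_homD(1)[OF antipode] by (intro extensionalityI[of _ "carrier A"]) (auto simp: compose_eq)
  show "point_op A R (nabla (Conj G)) x y = x \<otimes>\<^bsub>points R\<^esub> y \<otimes>\<^bsub>points R\<^esub> inv\<^bsub>points R\<^esub> x"
    "point_op A R (nabla_inv (Conj G)) x y = inv\<^bsub>points R\<^esub> y \<otimes>\<^bsub>points R\<^esub> x \<otimes>\<^bsub>points R\<^esub> y"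
    unfolding Conj_operations points_simps
    by (simp_all only: point_op_def[of A R "point_op A A2 \<Delta> u v" for u v] nat o proj2 inv assoc
        tensor_map_inl[OF A A R x y] tensor_map_inr[OF A A R x y] inv_points[OF R x] inv_points[OF R y])
qed

text \<open>The rack axioms hold on the points of every algebra; the universal ones are the cases of the
  projections.\<close>

theorem affine_rack_Conj: "affine_rack (Conj G)"
proof -
  note hom = Conj_operations_alg_hom
  have R: "point_op A R (nabla_inv (Conj G)) (point_op A R (nabla (Conj G)) x y) x = y"
    "point_op A R (nabla (Conj G)) x (point_op A R (nabla_inv (Conj G)) y x) = y"
    "point_op A R (nabla (Conj G)) x (point_op A R (nabla (Conj G)) y z) =
      point_op A R (nabla (Conj G)) (point_op A R (nabla (Conj G)) x y) (point_op A R (nabla (Conj G)) x z)"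
    "point_op A R (nabla_inv (Conj G)) (point_op A R (nabla_inv (Conj G)) x y) z =
      point_op A R (nabla_inv (Conj G)) (point_op A R (nabla_inv (Conj G)) x z) (point_op A R (nabla_inv (Conj G)) y z)"
    "point_op A R (nabla (Conj G)) (point_unit A R \<epsilon>) x = x"
    "point_op A R (nabla (Conj G)) x (point_unit A R \<epsilon>) = point_unit A R \<epsilon>"
    if R: "algebra base_field R" and x: "x \<in> alg_hom A R" and y: "y \<in> alg_hom A R" and z: "z \<in> alg_hom A R"
    for R :: "('k, 'r) module" and x y z
  proof -
    interpret P: group "points R" by (rule group_points[OF R])
    have cancel: "a \<otimes>\<^bsub>points R\<^esub> (inv\<^bsub>points R\<^esub> a \<otimes>\<^bsub>points R\<^esub> b) = b"
      "inv\<^bsub>points R\<^esub> a \<otimes>\<^bsub>points R\<^esub> (a \<otimes>\<^bsub>points R\<^esub> b) = b"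
      if "a \<in> carrier (points R)" "b \<in> carrier (points R)" for a b
      using that by (simp_all only: P.m_assoc[symmetric] P.inv_closed P.r_inv P.l_inv P.l_one)
    note group_simps = P.m_assoc P.inv_mult_group P.inv_inv P.inv_closed P.m_closed P.r_inv P.l_inv
      P.l_one P.r_one P.one_closed cancel P.inv_one
    note simps = point_op_Conj[OF R] x y z group_simps[unfolded points_simps(1)]
    show "point_op A R (nabla_inv (Conj G)) (point_op A R (nabla (Conj G)) x y) x = y"
      by (simp only: simps)
    show "point_op A R (nabla (Conj G)) x (point_op A R (nabla_inv (Conj G)) y x) = y"
      by (simp only: simps)
    show "point_op A R (nabla (Conj G)) x (point_op A R (nabla (Conj G)) y z) =
      point_op A R (nabla (Conj G)) (point_op A R (nabla (Conj G)) x y) (point_op A R (nabla (Conj G)) x z)"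
      by (simp only: simps)
    show "point_op A R (nabla_inv (Conj G)) (point_op A R (nabla_inv (Conj G)) x y) z =
      point_op A R (nabla_inv (Conj G)) (point_op A R (nabla_inv (Conj G)) x z) (point_op A R (nabla_inv (Conj G)) y z)"
      by (simp only: simps)
    show "point_op A R (nabla (Conj G)) (point_unit A R \<epsilon>) x = x"
      by (simp only: simps point_unit_alg_hom[OF A R gcounit] points_simps(3)[symmetric])
    show "point_op A R (nabla (Conj G)) x (point_unit A R \<epsilon>) = point_unit A R \<epsilon>"
      by (simp only: simps point_unit_alg_hom[OF A R gcounit] points_simps(3)[symmetric])
  qed
  note p3 = projections3_alg_hom
  show ?thesis
    unfolding affine_rack_def Let_def coord_Conj
    using G hom gcounit R(1,2)[OF A2 proj2 proj2(1)] R(3,4)[OF A3 p3]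
      R(5,6)[OF A identity_alg_hom[OF A] identity_alg_hom[OF A] identity_alg_hom[OF A]]
    by (simp add: affine_group_def Let_def)
qed

lemma pairing_comult:
  assumes f: "f \<in> carrier A" and D: "D \<in> linear_maps A k"
  shows "pairing \<epsilon> D (\<Delta> f) = D f" "pairing D \<epsilon> (\<Delta> f) = D f"
proof -
  have op: "tensor_map A A A x y (\<Delta> f) = point_op A A \<Delta> x y f" for x y
    using f by (simp add: point_op_def compose_def)
  note mf = alg_homD(1)[OF comult f]
  show "pairing \<epsilon> D (\<Delta> f) = D f" "pairing D \<epsilon> (\<Delta> f) = D f"
    using f by (simp_all only: contract_left[OF \<epsilon>_linear D, symmetric] contract_right[OF \<epsilon>_linear D, symmetric] mf op
        group_laws restrict_apply')
qed

lemma counit_antipode: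
  assumes f: "f \<in> carrier A"
  shows "\<epsilon> (S f) = \<epsilon> f"
proof -
  interpret P: group "points k" by (rule group_points[OF K])
  have unit: "point_unit A k \<epsilon> = \<epsilon>"
    using \<epsilon>_simps(6) by (intro extensionalityI[of _ "carrier A"]) (auto simp: point_unit_def)
  have "compose (carrier A) \<epsilon> S = inv\<^bsub>points k\<^esub> \<epsilon>" by (rule inv_points[OF K gcounit])
  also have "\<dots> = \<epsilon>" using P.inv_one by (simp add: unit)
  finally show ?thesis using f by (metis compose_eq)
qed

text \<open>Differentiate \<open>x\<^sup>-\<^sup>1 x = e\<close> along \<open>D\<close>.\<close>

lemma derivation_antipode:
  assumes D: "D \<in> derivations A \<epsilon>" and f: "f \<in> carrier A"
  shows "D (S f) = - D f"
proof -
  note S = alg_hom_linear[OF antipode] and id = alg_hom_linear[OF identity_alg_hom[OF A]]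
  note D' = derivations_linear[OF D]
  have DS: "compose (carrier A) D S \<in> linear_maps A k"
    using linear_restrict[OF linear_maps_compose[OF S D']] by (simp add: compose_def)
  have "D (tensor_map A A A S i u) = pairing (compose (carrier A) D S) \<epsilon> u + pairing \<epsilon> D u"
    if u: "u \<in> carrier A2" for u
  proof (rule tensor_maps_eqI[OF A A K linear_maps_compose[OF tensor_map_linear[OF A A A S id] D']
        linear_add[OF pairing_linear[OF DS \<epsilon>_linear] pairing_linear[OF \<epsilon>_linear D']] _ u])
    fix p q assume pq: "p \<in> carrier A" "q \<in> carrier A"
    then have "S p \<in> carrier A" using alg_homD(1)[OF antipode] by simp
    with pq show "D (tensor_map A A A S i (pure_tensor A A p q)) =
        pairing (compose (carrier A) D S) \<epsilon> (pure_tensor A A p q) + pairing \<epsilon> D (pure_tensor A A p q)"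
      by (simp add: tensor_map_pure[OF A A A S id] pairing_pure DS D' \<epsilon>_linear derivation_simps[OF D] counit_antipode)
        (simp add: compose_eq)
  qed
  from this[OF alg_homD(1)[OF comult f]]
  have "D (point_op A A \<Delta> S i f) = D (S f) + D f"
    using f by (simp add: pairing_comult DS D') (simp add: point_op_def compose_eq)
  moreover have "D (point_unit A A \<epsilon> f) = 0"
    using f derivation_simps(3)[OF D A.one_closed A.one_closed] by (simp add: point_unit_def derivation_one[OF D])
  ultimately show ?thesis by (simp add: group_laws eq_neg_iff_add_eq_0)
qed

text \<open>Multiplying with \<open>a \<otimes> 1\<close> gives \<open>D\<close> two factors to act on in the first slot, as in \<open>x y x\<^sup>-\<^sup>1\<close>,
  where \<open>x\<close> occurs twice.\<close>

lemma pairing_mult_inl: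
  assumes D: "D \<in> derivations A \<epsilon>" and E: "E \<in> linear_maps A k" and a: "a \<in> carrier A" and v: "v \<in> carrier A2"
  shows "pairing D E (v \<otimes>\<^bsub>A2\<^esub> proj1_of2 A a) = pairing D E v * \<epsilon> a + pairing \<epsilon> E v * D a"
proof -
  interpret A2: algebra base_field A2 by (rule A2)
  note lin = derivations_linear[OF D] E \<epsilon>_linear
  note inl = alg_homD(1)[OF proj2(1) a]
  from A A v show ?thesis
  proof (induction v rule: tensor_induct)
    case (pure p q)
    then show ?case using a
      by (simp add: tensor_inl_def pure_mult[OF A A] pairing_pure lin derivation_simps[OF D] algebra_simps)
  next
    case (add u v)
    then show ?case using inl
      by (simp add: A2.l_distr pairing_add lin algebra_simps)
  qed
qed

text \<open>Differentiating \<open>x y x\<^sup>-\<^sup>1\<close> in \<open>x\<close> along \<open>D\<close>: the first occurrence of \<open>x\<close> contributes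
  \<open>(D \<otimes> E) \<circ> \<Delta>\<close>, and the second contributes \<open>(E \<otimes> D \<circ> S) \<circ> \<Delta>\<close> with \<open>D \<circ> S = - D\<close>.\<close>

theorem bracket_Conj:
  assumes D: "D \<in> derivations A \<epsilon>" and E: "E \<in> derivations A \<epsilon>" and f: "f \<in> carrier A"
  shows "pairing D E (nabla (Conj G) f) = pairing D E (\<Delta> f) - pairing E D (\<Delta> f)"
proof -
  note D' = derivations_linear[OF D] and E' = derivations_linear[OF E]
  note conv = convolution_linear[OF comult D' E']
  have neg: "(\<lambda>f\<in>carrier A. - 1 * D f) \<in> linear_maps A k" by (rule linear_restrict[OF linear_scale[OF D']])
  let ?xS = "compose (carrier A) (proj1_of2 A) S"
  note x = alg_hom_linear[OF comult] and y = alg_hom_linear[OF alg_hom_compose[OF antipode proj2(1) A]]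
  have "pairing D E (tensor_map A A A2 \<Delta> ?xS u) = pairing (convolution \<Delta> D E) \<epsilon> u + pairing E (\<lambda>f\<in>carrier A. - 1 * D f) u"
    if u: "u \<in> carrier A2" for u
  proof (rule tensor_maps_eqI[OF A A K linear_maps_compose[OF tensor_map_linear[OF A A A2 x y] pairing_linear[OF D' E']]
        linear_add[OF pairing_linear[OF conv \<epsilon>_linear] pairing_linear[OF E' neg]] _ u])
    fix p r assume pr: "p \<in> carrier A" "r \<in> carrier A"
    then have "S r \<in> carrier A" "\<Delta> p \<in> carrier A2" using alg_homD(1)[OF antipode] alg_homD(1)[OF comult] by auto
    with pr show "pairing D E (tensor_map A A A2 \<Delta> ?xS (pure_tensor A A p r)) =
        pairing (convolution \<Delta> D E) \<epsilon> (pure_tensor A A p r) + pairing E (\<lambda>f\<in>carrier A. - 1 * D f) (pure_tensor A A p r)"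
      by (simp only: tensor_map_pure[OF A A A2 x y] pairing_pure conv neg E' \<epsilon>_linear)
        (simp add: compose_eq pairing_mult_inl[OF D E'] counit_antipode derivation_antipode[OF D] pairing_comult E')
  qed
  from this[OF alg_homD(1)[OF comult f]] show ?thesis
    using f alg_homD(1)[OF comult f]
    by (simp add: Conj_operations point_op_generic[OF A comult] pairing_comult conv pairing_scale_right[OF D' E', of _ "-1", simplified])
      (simp add: point_op_def compose_eq)
qed

theorem left_tangent_Conj: "left_tangent (Conj G) = lie_algebra_of G"
proof -
  have "convolution (nabla (Conj G)) D E = (\<lambda>f\<in>carrier A. pairing D E (\<Delta> f) - pairing E D (\<Delta> f))"
    if "D \<in> derivations A \<epsilon>" "E \<in> derivations A \<epsilon>" for D E
    using bracket_Conj[OF that] by (intro extensionalityI[of _ "carrier A"]) (auto simp: compose_eq)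
  then show ?thesis
    by (simp add: left_tangent_def lie_algebra_of_def Let_def functional_algebra_def cong: restrict_cong)
qed

end

section \<open>Differentiable functions on \<open>k\<^sup>n\<close>\<close>

lemma openin_kspace_box:
  assumes S: "openin (kspace_topology n) S" and u: "u \<in> S"
  obtains d where "d > 0"
    "\<And>v :: nat \<Rightarrow> 'k::real_normed_field. v \<in> kspace n \<Longrightarrow> (\<And>i. i < n \<Longrightarrow> dist (v i) (u i) < d) \<Longrightarrow> v \<in> S"
proof -
  obtain T where T: "open T" "S = kspace n \<inter> T" using S by (auto simp: openin_open)
  have prod: "openin (product_topology (\<lambda>i. euclidean) UNIV) T" using T(1) by (simp add: open_fun_def)
  have uT: "u \<in> T" using u T(2) by auto
  obtain X where X: "u \<in> Pi\<^sub>E UNIV X" "\<And>i. open (X i)" "Pi\<^sub>E UNIV X \<subseteq> T"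
    using u T(2) product_topology_open_contains_basis[OF prod uT] by (simp, blast)
  have "\<exists>e>0. ball (u i) e \<subseteq> X i" for i
    using PiE_mem[OF X(1), of i] X(2)[of i] open_contains_ball[of "X i"] by blast
  then obtain e where e: "\<And>i. e i > 0" "\<And>i. ball (u i) (e i) \<subseteq> X i" by metis
  define d where "d = Min (insert 1 (e ` {..<n}))"
  have d: "d > 0" "\<And>i. i < n \<Longrightarrow> d \<le> e i" using e(1) by (auto simp: d_def)
  show ?thesis
  proof (rule that[OF d(1)])
    fix v :: "nat \<Rightarrow> 'k" assume v: "v \<in> kspace n" "\<And>i. i < n \<Longrightarrow> dist (v i) (u i) < d"
    have "v i \<in> X i" for i
    proof (cases "i < n")
      case True
      then show ?thesis using v(2)[OF True] d(2)[OF True] e(2)[of i] by (auto simp: dist_commute subset_iff)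
    next
      case False
      then have "v i = u i" using v(1) u T(2) by (auto simp: kspace_def)
      then show ?thesis using X(1) by (auto simp: PiE_iff)
    qed
    then show "v \<in> S" using X(3) v(1) T(2) by (auto simp: PiE_iff)
  qed
qed

lemma openin_kspace_subset: "openin (kspace_topology n) S \<Longrightarrow> S \<subseteq> kspace n"
  by (auto simp: openin_open)

lemma eventually_fun_upd_in:
  fixes u :: "nat \<Rightarrow> 'k::real_normed_field"
  assumes S: "openin (kspace_topology n) S" and u: "u \<in> S" and i: "i < n"
  shows "eventually (\<lambda>t. u(i := t) \<in> S) (nhds (u i))"
proof -
  obtain d where d: "d > 0"
    "\<And>v. v \<in> kspace n \<Longrightarrow> (\<And>i. i < n \<Longrightarrow> dist (v i) (u i) < d) \<Longrightarrow> v \<in> S"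
    using openin_kspace_box[OF S u] by metis
  have "u \<in> kspace n" using openin_kspace_subset[OF S] u by auto
  then have "u(i := t) \<in> S" if "dist t (u i) < d" for t
    using that i d(1) by (intro d(2)) (auto simp: kspace_def)
  then show ?thesis using d(1) by (auto simp: eventually_nhds_metric)
qed

lemma continuous_partial_box:
  fixes P :: "(nat \<Rightarrow> 'k::real_normed_field) \<Rightarrow> 'k"
  assumes S: "openin (kspace_topology n) S" and u: "u \<in> S" and P: "continuous_on S P" and e: "e > 0"
  obtains d where "d > 0"
    "\<And>v. v \<in> kspace n \<Longrightarrow> (\<And>i. i < n \<Longrightarrow> dist (v i) (u i) < d) \<Longrightarrow> v \<in> S \<and> dist (P v) (P u) < e"
proof -
  have "openin (top_of_set S) (S \<inter> P -` ball (P u) e)"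
    using P by (rule continuous_openin_preimage_gen) simp
  then have "openin (kspace_topology n) (S \<inter> P -` ball (P u) e)"
    using S openin_trans by blast
  moreover have "u \<in> S \<inter> P -` ball (P u) e" using u e by auto
  ultimately obtain d where "d > 0"
    "\<And>v. v \<in> kspace n \<Longrightarrow> (\<And>i. i < n \<Longrightarrow> dist (v i) (u i) < d) \<Longrightarrow> v \<in> S \<inter> P -` ball (P u) e"
    using openin_kspace_box[of n "S \<inter> P -` ball (P u) e" u] by metis
  then show ?thesis using that[of d] by (auto simp: dist_commute)
qed

text \<open>Continuous partial derivatives give a total derivative. The increment is split into steps
  that change one coordinate each, and the mean value inequality, which holds over any real normed
  field, bounds each step.\<close>

lemma total_differentiability:
  fixes F :: "(nat \<Rightarrow> 'k::real_normed_field) \<Rightarrow> 'k"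
  assumes S: "openin (kspace_topology n) S" and u: "u \<in> S"
    and F: "times_differentiable_on (Suc 0) n S F" and e: "e > 0"
  obtains d where "d > 0"
    "\<And>v. v \<in> kspace n \<Longrightarrow> (\<And>i. i < n \<Longrightarrow> dist (v i) (u i) < d) \<Longrightarrow>
      norm (F v - F u - (\<Sum>j<n. partial_deriv j F u * (v j - u j))) \<le> e * (\<Sum>j<n. norm (v j - u j))"
proof -
  have "\<exists>d>0. \<forall>v. v \<in> kspace n \<longrightarrow> (\<forall>i<n. dist (v i) (u i) < d) \<longrightarrow>
      v \<in> S \<and> dist (partial_deriv j F v) (partial_deriv j F u) < e" if "j < n" for j
  proof -
    have "continuous_on S (partial_deriv j F)" using F that by simp
    from continuous_partial_box[OF S u this e] show ?thesis by metis
  qed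
  then obtain d' where d': "\<And>j. j < n \<Longrightarrow> d' j > 0"
    "\<And>j v. j < n \<Longrightarrow> v \<in> kspace n \<Longrightarrow> (\<And>i. i < n \<Longrightarrow> dist (v i) (u i) < d' j) \<Longrightarrow>
       v \<in> S \<and> dist (partial_deriv j F v) (partial_deriv j F u) < e" by metis
  define d where "d = Min (insert 1 (d' ` {..<n}))"
  have d: "d > 0" "\<And>i. i < n \<Longrightarrow> d \<le> d' i" using d'(1) by (auto simp: d_def)
  have uk: "u \<in> kspace n" using openin_kspace_subset[OF S] u by auto
  show ?thesis
  proof (rule that[OF d(1)])
    fix v :: "nat \<Rightarrow> 'k" assume v: "v \<in> kspace n" "\<And>i. i < n \<Longrightarrow> dist (v i) (u i) < d"
    \<comment> \<open>\<open>w 0 = u\<close> and \<open>w n = v\<close>; consecutive points differ in one coordinate\<close>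
    define w where "w j = (\<lambda>i. if i < j then v i else u i)" for j :: nat
    have step: "norm (F (w (Suc j)) - F (w j) - partial_deriv j F u * (v j - u j)) \<le> e * norm (v j - u j)"
      if j: "j < n" for j
    proof -
      let ?x = "\<lambda>t. (w j)(j := t)"
      have x: "?x t \<in> S \<and> dist (partial_deriv j F (?x t)) (partial_deriv j F u) < e"
        if t: "t \<in> ball (u j) d" for t
      proof (rule d'(2)[OF j])
        show "?x t \<in> kspace n" using v(1) uk j by (auto simp: kspace_def w_def)
        show "dist (?x t i) (u i) < d' j" if "i < n" for i
          using that t v(2)[of i] d(2)[OF j] d(1) by (auto simp: w_def dist_commute)
      qed
      have der: "((\<lambda>s. F (?x s) - partial_deriv j F u * s) has_field_derivative
          (partial_deriv j F (?x t) - partial_deriv j F u)) (at t within ball (u j) d)"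
        if t: "t \<in> ball (u j) d" for t
      proof -
        have "\<forall>x\<in>S. (\<lambda>s. F (x(j := s))) field_differentiable at (x j)" using F j by simp
        from bspec[OF this, of "?x t"] x[OF t]
        have "(\<lambda>s. F ((?x t)(j := s))) field_differentiable at (?x t j)" by blast
        then have "((\<lambda>s. F (?x s)) has_field_derivative partial_deriv j F (?x t)) (at t)"
          by (simp add: partial_deriv_def DERIV_deriv_iff_field_differentiable)
        from DERIV_diff[OF this DERIV_cmult_Id] show ?thesis by (rule has_field_derivative_at_within)
      qed
      have "norm ((F (?x (v j)) - partial_deriv j F u * v j) - (F (?x (u j)) - partial_deriv j F u * u j)) \<le> e * norm (v j - u j)"
      proof (rule field_differentiable_bound[OF convex_ball der])
        show "norm (partial_deriv j F (?x t) - partial_deriv j F u) \<le> e" if "t \<in> ball (u j) d" for t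
          using x[OF that] by (simp add: dist_norm less_imp_le)
      qed (use d(1) v(2)[OF j] in \<open>auto simp: dist_commute\<close>)
      moreover have "?x (v j) = w (Suc j)" "?x (u j) = w j"
        by (auto simp: w_def fun_eq_iff less_Suc_eq)
      ultimately show ?thesis by (simp add: algebra_simps)
    qed
    have ends: "w 0 = u" "w n = v" using v(1) uk by (auto simp: w_def kspace_def fun_eq_iff)
    have "F v - F u - (\<Sum>j<n. partial_deriv j F u * (v j - u j)) =
        (\<Sum>j<n. F (w (Suc j)) - F (w j) - partial_deriv j F u * (v j - u j))"
      unfolding sum_subtractf using sum_lessThan_telescope[of "\<lambda>j. F (w j)" n] by (simp add: ends sum_subtractf)
    also have "norm \<dots> \<le> (\<Sum>j<n. e * norm (v j - u j))"
      by (rule order_trans[OF norm_sum sum_mono]) (use step in auto)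
    finally show "norm (F v - F u - (\<Sum>j<n. partial_deriv j F u * (v j - u j))) \<le> e * (\<Sum>j<n. norm (v j - u j))"
      by (simp add: sum_distrib_left)
  qed
qed

text \<open>Stated along curves \<open>\<gamma>\<close> of one variable, because a partial derivative of a composite is the
  derivative along such a curve.\<close>

theorem chain_rule:
  fixes F :: "(nat \<Rightarrow> 'k::real_normed_field) \<Rightarrow> 'k"
  assumes S: "openin (kspace_topology n) S" and F: "times_differentiable_on (Suc 0) n S F"
    and \<gamma>: "eventually (\<lambda>t. \<gamma> t \<in> kspace n) (nhds s)" and s: "\<gamma> s \<in> S"
    and der: "\<And>j. j < n \<Longrightarrow> ((\<lambda>t. \<gamma> t j) has_field_derivative \<gamma>' j) (at s)"
  shows "((\<lambda>t. F (\<gamma> t)) has_field_derivative (\<Sum>j<n. partial_deriv j F (\<gamma> s) * \<gamma>' j)) (at s)"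
proof -
  \<comment> \<open>difference quotients of the coordinates; near \<open>s\<close> the sum of their norms stays below \<open>M\<close>\<close>
  define q where "q j t = (\<gamma> t j - \<gamma> s j) / (t - s)" for j t
  have q: "(q j \<longlongrightarrow> \<gamma>' j) (at s)" if "j < n" for j
    using der[OF that] by (simp add: has_field_derivative_iff q_def[abs_def])
  define M where "M = (\<Sum>j<n. norm (\<gamma>' j)) + 1"
  have M: "M > 0" unfolding M_def by (intro add_nonneg_pos sum_nonneg) auto
  have bound: "eventually (\<lambda>t. (\<Sum>j<n. norm (q j t)) < M) (at s)"
    by (rule order_tendstoD(2)[OF tendsto_sum[OF tendsto_norm[OF q]]]) (auto simp: M_def)
  have near: "eventually (\<lambda>t. \<forall>j<n. dist (\<gamma> t j) (\<gamma> s j) < d) (at s)" if d: "d > 0" for d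
  proof -
    have "eventually (\<lambda>t. dist (\<gamma> t j) (\<gamma> s j) < d) (at s)" if "j < n" for j
      using DERIV_isCont[OF der[OF that]] d by (auto simp: isCont_def dest: tendstoD)
    then have "eventually (\<lambda>t. \<forall>j\<in>{..<n}. dist (\<gamma> t j) (\<gamma> s j) < d) (at s)"
      by (intro eventually_ball_finite) auto
    then show ?thesis by (rule eventually_mono) auto
  qed
  let ?r = "\<lambda>t. (F (\<gamma> t) - F (\<gamma> s)) / (t - s) - (\<Sum>j<n. partial_deriv j F (\<gamma> s) * q j t)"
  have "(?r \<longlongrightarrow> 0) (at s)"
  proof (rule tendstoI)
    fix e :: real assume e: "e > 0"
    then have e': "e / M > 0" using M by simp
    obtain d where d: "d > 0" "\<And>v. v \<in> kspace n \<Longrightarrow> (\<And>i. i < n \<Longrightarrow> dist (v i) (\<gamma> s i) < d) \<Longrightarrow>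
      norm (F v - F (\<gamma> s) - (\<Sum>j<n. partial_deriv j F (\<gamma> s) * (v j - \<gamma> s j))) \<le> e / M * (\<Sum>j<n. norm (v j - \<gamma> s j))"
      by (rule total_differentiability[OF S s F e']) blast
    have "eventually (\<lambda>t. \<gamma> t \<in> kspace n) (at s)" using \<gamma> by (simp add: eventually_nhds_conv_at)
    then show "eventually (\<lambda>t. dist (?r t) 0 < e) (at s)"
      using near[OF d(1)] bound eventually_neq_at_within[of s s UNIV]
    proof eventually_elim
      case (elim t)
      then have ts: "t - s \<noteq> 0" by simp
      have "?r t = (F (\<gamma> t) - F (\<gamma> s) - (\<Sum>j<n. partial_deriv j F (\<gamma> s) * (\<gamma> t j - \<gamma> s j))) / (t - s)"
        by (simp add: q_def diff_divide_distrib sum_divide_distrib right_diff_distrib)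
      then have "norm (?r t) = norm (F (\<gamma> t) - F (\<gamma> s) - (\<Sum>j<n. partial_deriv j F (\<gamma> s) * (\<gamma> t j - \<gamma> s j))) / norm (t - s)"
        by (simp add: norm_divide)
      also have "\<dots> \<le> (e / M * (\<Sum>j<n. norm (\<gamma> t j - \<gamma> s j))) / norm (t - s)"
        using elim by (intro divide_right_mono d(2)) auto
      also have "\<dots> = e / M * (\<Sum>j<n. norm (q j t))"
        by (simp add: q_def norm_divide sum_divide_distrib[symmetric] mult.commute)
      also have "\<dots> < e / M * M"
        using elim e' by (intro mult_strict_left_mono) auto
      finally show ?case using M by simp
    qed
  qed
  moreover have "((\<lambda>t. \<Sum>j<n. partial_deriv j F (\<gamma> s) * q j t) \<longlongrightarrow> (\<Sum>j<n. partial_deriv j F (\<gamma> s) * \<gamma>' j)) (at s)"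
    by (intro tendsto_sum tendsto_mult_left q) auto
  ultimately have "((\<lambda>t. ?r t + (\<Sum>j<n. partial_deriv j F (\<gamma> s) * q j t)) \<longlongrightarrow> 0 + (\<Sum>j<n. partial_deriv j F (\<gamma> s) * \<gamma>' j)) (at s)"
    by (rule tendsto_add)
  then show ?thesis by (simp add: has_field_derivative_iff)
qed

lemma times_differentiable_continuous: "times_differentiable_on r n S F \<Longrightarrow> continuous_on S F"
  by (cases r) auto

lemma times_differentiable_mono: "times_differentiable_on (Suc r) n S F \<Longrightarrow> times_differentiable_on r n S F"
proof (induction r arbitrary: F)
  case (Suc r)
  then show ?case using times_differentiable_on.simps(2)[of "Suc r" n S F]
      times_differentiable_on.simps(2)[of r n S F] by blast
qed simp

lemma times_differentiable_partial:
  "times_differentiable_on (Suc r) n S F \<Longrightarrow> i < n \<Longrightarrow> times_differentiable_on r n S (partial_deriv i F)"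
  by simp

lemma times_differentiable_subset:
  "times_differentiable_on r n S F \<Longrightarrow> T \<subseteq> S \<Longrightarrow> times_differentiable_on r n T F"
  by (induction r arbitrary: F) (auto intro: continuous_on_subset)

lemma partial_cong:
  assumes S: "openin (kspace_topology n) S" and eq: "\<And>x. x \<in> S \<Longrightarrow> F x = G x" and x: "x \<in> S" and i: "i < n"
  shows "(\<lambda>t. F (x(i := t))) field_differentiable at (x i) \<longleftrightarrow> (\<lambda>t. G (x(i := t))) field_differentiable at (x i)"
    and "partial_deriv i F x = partial_deriv i G x"
proof -
  have ev: "eventually (\<lambda>t. F (x(i := t)) = G (x(i := t))) (nhds (x i))"
    using eventually_fun_upd_in[OF S x i] by (rule eventually_mono) (rule eq)
  show "(\<lambda>t. F (x(i := t))) field_differentiable at (x i) \<longleftrightarrow> (\<lambda>t. G (x(i := t))) field_differentiable at (x i)"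
    using DERIV_cong_ev[OF refl ev refl] by (simp add: field_differentiable_def)
  show "partial_deriv i F x = partial_deriv i G x"
    unfolding partial_deriv_def by (rule deriv_cong_ev[OF ev refl])
qed

lemma times_differentiable_cong:
  assumes S: "openin (kspace_topology n) S" and eq: "\<And>x. x \<in> S \<Longrightarrow> F x = G x"
    and F: "times_differentiable_on r n S F"
  shows "times_differentiable_on r n S G"
  using eq F
proof (induction r arbitrary: F G)
  case 0
  then show ?case using continuous_on_cong[of S S F G] by simp
next
  case (Suc r)
  have "times_differentiable_on r n S (partial_deriv i G)" if "i < n" for i
    using Suc.IH[of "partial_deriv i F" "partial_deriv i G"] partial_cong(2)[OF S Suc.prems(1) _ that] Suc.prems(2) that
    by simp
  moreover have "(\<lambda>t. G (x(i := t))) field_differentiable at (x i)" if "i < n" "x \<in> S" for i x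
    using partial_cong(1)[OF S, of F G x i] Suc.prems that by auto
  moreover have "continuous_on S G"
    using continuous_on_cong[of S S F G] Suc.prems by auto
  ultimately show ?case by simp
qed

lemma times_differentiable_local:
  assumes "\<And>x. x \<in> S \<Longrightarrow> \<exists>T. x \<in> T \<and> T \<subseteq> S \<and> openin (kspace_topology n) T \<and> times_differentiable_on r n T F"
  shows "times_differentiable_on r n S F"
proof -
  have cont: "continuous_on S F"
    if loc: "\<And>x. x \<in> S \<Longrightarrow> \<exists>T. x \<in> T \<and> T \<subseteq> S \<and> openin (kspace_topology n) T \<and> continuous_on T F"
    for F :: "(nat \<Rightarrow> 'a) \<Rightarrow> 'a"
    unfolding continuous_on_eq_continuous_within
  proof
    fix x assume x: "x \<in> S"
    obtain T where T: "x \<in> T" "T \<subseteq> S" "openin (kspace_topology n) T" "continuous_on T F"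
      using loc[OF x] by blast
    obtain V where V: "open V" "T = kspace n \<inter> V" using T(3) by (auto simp: openin_open)
    have "S \<subseteq> kspace n"
    proof
      fix y assume "y \<in> S"
      from loc[OF this] show "y \<in> kspace n" using openin_kspace_subset by blast
    qed
    then have "S \<inter> V = T" using V T(2) by blast
    moreover have "x \<in> V" using T(1) V(2) by blast
    moreover have "T \<inter> V = T" using V(2) by blast
    ultimately have "at x within S = at x within T"
      using V(1) by (intro at_within_nhd[of x V S T]) simp_all
    moreover have "continuous (at x within T) F"
      using T(1,4) by (simp only: continuous_on_eq_continuous_within)
    ultimately show "continuous (at x within S) F"
      by (simp only: continuous_within)
  qed
  show ?thesis using assms
  proof (induction r arbitrary: F)
    case 0
    then show ?case using cont[of F] by simp
  next
    case (Suc r)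
    have "continuous_on S F"
    proof (rule cont)
      fix x assume "x \<in> S"
      from Suc.prems[OF this]
      show "\<exists>T. x \<in> T \<and> T \<subseteq> S \<and> openin (kspace_topology n) T \<and> continuous_on T F" by auto
    qed
    moreover have "times_differentiable_on r n S (partial_deriv i F)" if "i < n" for i
    proof (rule Suc.IH)
      fix x assume "x \<in> S"
      from Suc.prems[OF this] that
      show "\<exists>T. x \<in> T \<and> T \<subseteq> S \<and> openin (kspace_topology n) T \<and> times_differentiable_on r n T (partial_deriv i F)"
        by auto
    qed
    moreover have "(\<lambda>t. F (x(i := t))) field_differentiable at (x i)" if "i < n" "x \<in> S" for i x
      using Suc.prems[OF that(2)] that(1) by auto
    ultimately show ?case by simp
  qed
qed

lemma times_differentiable_const: "times_differentiable_on r n S (\<lambda>_. c)"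
proof (induction r arbitrary: c)
  case (Suc r)
  have "partial_deriv i (\<lambda>_. c) = (\<lambda>_. 0)" for i by (simp add: partial_deriv_def fun_eq_iff)
  with Suc show ?case by simp
qed simp

lemma partial_deriv_has_derivative:
  assumes "times_differentiable_on (Suc r) n S F" "x \<in> S" "i < n"
  shows "((\<lambda>t. F (x(i := t))) has_field_derivative partial_deriv i F x) (at (x i))"
  using assms by (simp add: partial_deriv_def DERIV_deriv_iff_field_differentiable)

text \<open>Any candidates for the partial derivatives may be exhibited, since they agree with
  \<^const>\<open>partial_deriv\<close> on \<open>S\<close>.\<close>

lemma times_differentiable_SucI:
  assumes S: "openin (kspace_topology n) S" and "continuous_on S F"
    and der: "\<And>i x. i < n \<Longrightarrow> x \<in> S \<Longrightarrow> ((\<lambda>t. F (x(i := t))) has_field_derivative P i x) (at (x i))"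
    and P: "\<And>i. i < n \<Longrightarrow> times_differentiable_on r n S (P i)"
  shows "times_differentiable_on (Suc r) n S F"
proof -
  have "partial_deriv i F x = P i x" if "i < n" "x \<in> S" for i x
    using DERIV_imp_deriv[OF der[OF that]] by (simp add: partial_deriv_def)
  then have "times_differentiable_on r n S (partial_deriv i F)" if "i < n" for i
    using times_differentiable_cong[OF S _ P[OF that], of "partial_deriv i F"] that by simp
  then show ?thesis using assms(2) der by (auto simp: field_differentiable_def)
qed

lemma times_differentiable_add:
  assumes S: "openin (kspace_topology n) S"
  shows "times_differentiable_on r n S F \<Longrightarrow> times_differentiable_on r n S G \<Longrightarrow>
    times_differentiable_on r n S (\<lambda>x. F x + G x)"
proof (induction r arbitrary: F G)
  case 0
  then show ?case by (simp add: continuous_on_add)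
next
  case (Suc r)
  show ?case
  proof (rule times_differentiable_SucI[OF S, where P = "\<lambda>i x. partial_deriv i F x + partial_deriv i G x"])
    show "continuous_on S (\<lambda>x. F x + G x)"
      using Suc.prems by (intro continuous_on_add times_differentiable_continuous)
    fix i x assume i: "i < n"
    show "times_differentiable_on r n S (\<lambda>x. partial_deriv i F x + partial_deriv i G x)"
      using Suc.prems i by (intro Suc.IH) auto
    assume x: "x \<in> S"
    show "((\<lambda>t. F (x(i := t)) + G (x(i := t))) has_field_derivative (partial_deriv i F x + partial_deriv i G x)) (at (x i))"
      by (intro DERIV_add partial_deriv_has_derivative[OF Suc.prems(1) x i] partial_deriv_has_derivative[OF Suc.prems(2) x i])
  qed
qed

lemma times_differentiable_mult:
  assumes S: "openin (kspace_topology n) S"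
  shows "times_differentiable_on r n S F \<Longrightarrow> times_differentiable_on r n S G \<Longrightarrow>
    times_differentiable_on r n S (\<lambda>x. F x * G x)"
proof (induction r arbitrary: F G)
  case 0
  then show ?case by (simp add: continuous_on_mult)
next
  case (Suc r)
  show ?case
  proof (rule times_differentiable_SucI[OF S, where P = "\<lambda>i x. partial_deriv i F x * G x + F x * partial_deriv i G x"])
    show "continuous_on S (\<lambda>x. F x * G x)"
      using Suc.prems by (intro continuous_on_mult times_differentiable_continuous)
    fix i x assume i: "i < n"
    show "times_differentiable_on r n S (\<lambda>x. partial_deriv i F x * G x + F x * partial_deriv i G x)"
      by (intro times_differentiable_add[OF S] Suc.IH times_differentiable_mono[OF Suc.prems(1)]
          times_differentiable_mono[OF Suc.prems(2)] times_differentiable_partial[OF Suc.prems(1) i]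
          times_differentiable_partial[OF Suc.prems(2) i])
    assume x: "x \<in> S"
    show "((\<lambda>t. F (x(i := t)) * G (x(i := t))) has_field_derivative (partial_deriv i F x * G x + F x * partial_deriv i G x)) (at (x i))"
      using DERIV_mult[OF partial_deriv_has_derivative[OF Suc.prems(1) x i] partial_deriv_has_derivative[OF Suc.prems(2) x i]]
      by (simp only: fun_upd_triv mult.commute[of "partial_deriv i G x"])
  qed
qed

lemma times_differentiable_sum:
  assumes S: "openin (kspace_topology n) S"
  shows "finite J \<Longrightarrow> (\<And>j. j \<in> J \<Longrightarrow> times_differentiable_on r n S (F j)) \<Longrightarrow>
    times_differentiable_on r n S (\<lambda>x. \<Sum>j\<in>J. F j x)"
  by (induction J rule: finite_induct) (simp_all add: times_differentiable_const times_differentiable_add[OF S])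

lemma times_differentiable_compose:
  fixes F :: "(nat \<Rightarrow> 'k::real_normed_field) \<Rightarrow> 'k"
  assumes S: "openin (kspace_topology n) S" and W: "openin (kspace_topology m) W"
    and HW: "\<And>u. u \<in> S \<Longrightarrow> (\<lambda>j. if j < m then h j u else 0) \<in> W"
  shows "times_differentiable_on r m W F \<Longrightarrow> (\<And>j. j < m \<Longrightarrow> times_differentiable_on r n S (h j)) \<Longrightarrow>
    times_differentiable_on r n S (\<lambda>u. F (\<lambda>j. if j < m then h j u else 0))"
proof (induction r arbitrary: F)
  let ?H = "\<lambda>u j. if j < m then h j u else 0"
  have cont: "continuous_on S (\<lambda>u. F (?H u))"
    if "continuous_on W F" "\<And>j. j < m \<Longrightarrow> continuous_on S (h j)" for F :: "(nat \<Rightarrow> 'k) \<Rightarrow> 'k"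
  proof (rule continuous_on_compose2[OF that(1)])
    have "continuous_on S (\<lambda>u. ?H u j)" for j using that(2)[of j] by (cases "j < m") simp_all
    then show "continuous_on S ?H" by (rule continuous_on_coordinatewise_then_product)
    show "?H ` S \<subseteq> W" using HW by blast
  qed
  {
    case 0
    then show ?case using cont by simp
  next
    case (Suc r)
    show ?case
    proof (rule times_differentiable_SucI[OF S, where P = "\<lambda>i u. \<Sum>j<m. partial_deriv j F (?H u) * partial_deriv i (h j) u"])
      show "continuous_on S (\<lambda>u. F (?H u))"
        by (intro cont times_differentiable_continuous[OF Suc.prems(1)] times_differentiable_continuous[OF Suc.prems(2)])
      fix i u assume i: "i < n"
      show "times_differentiable_on r n S (\<lambda>u. \<Sum>j<m. partial_deriv j F (?H u) * partial_deriv i (h j) u)"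
        by (intro times_differentiable_sum[OF S] times_differentiable_mult[OF S] Suc.IH
            times_differentiable_mono[OF Suc.prems(2)] times_differentiable_partial[OF Suc.prems(1)]
            times_differentiable_partial[OF Suc.prems(2) i]) simp_all
      assume u: "u \<in> S"
      have F1: "times_differentiable_on (Suc 0) m W F"
        using Suc.prems(1) by (auto dest: times_differentiable_continuous)
      have "((\<lambda>t. F (?H (u(i := t)))) has_field_derivative
          (\<Sum>j<m. partial_deriv j F (?H (u(i := u i))) * partial_deriv i (h j) u)) (at (u i))"
      proof (rule chain_rule[OF W F1])
        show "((\<lambda>t. ?H (u(i := t)) j) has_field_derivative partial_deriv i (h j) u) (at (u i))" if "j < m" for j
          using partial_deriv_has_derivative[OF Suc.prems(2)[OF that] u i] by (simp only: that if_True)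
        show "?H (u(i := u i)) \<in> W" unfolding fun_upd_triv by (rule HW[OF u])
      qed (simp add: kspace_def)
      then show "((\<lambda>t. F (?H (u(i := t)))) has_field_derivative
          (\<Sum>j<m. partial_deriv j F (?H u) * partial_deriv i (h j) u)) (at (u i))"
        unfolding fun_upd_triv .
    qed
  }
qed

section \<open>Curves and germs on the manifold of rational points\<close>

lemma smooth_on_kspaceD: "smooth_on_kspace n S F \<Longrightarrow> times_differentiable_on r n S F"
  by (simp add: smooth_on_kspace_def)

lemma field_derivative_cong_near:
  "eventually (\<lambda>t. F t = G t) (nhds s) \<Longrightarrow> (F has_field_derivative D) (at s) \<longleftrightarrow> (G has_field_derivative D) (at s)"
  by (rule DERIV_cong_ev) auto

locale point_manifold =
  fixes A :: "('k::real_normed_field, 'a) module" and e :: "'a \<Rightarrow> 'k"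
  assumes A: "algebra base_field A"
    and manifold: "manifold (kpoints_topology A) (kpoints_atlas A)"
    and e: "e \<in> kpoints A"
begin

abbreviation "P \<equiv> kpoints A"
abbreviation "T \<equiv> kpoints_topology A"
abbreviation "\<A> \<equiv> kpoints_atlas A"
abbreviation "germs \<equiv> smooth_near T \<A> e"
abbreviation (input) "regular f \<equiv> (\<lambda>p :: 'a \<Rightarrow> 'k. p f)"

lemma topspace_T [simp]: "topspace T = P"
  by (simp add: kpoints_topology_def)

lemma pointD:
  assumes "p \<in> P"
  shows "p \<in> alg_hom A base_algebra"
  using assms by (simp add: kpoints_def)

lemma chartD:
  assumes "(U, \<phi>, n) \<in> \<A>"
  shows "openin T U" "inj_on \<phi> U" "openin (kspace_topology n) (\<phi> ` U)"
    "i < n \<Longrightarrow> kpoints_smooth A U (\<lambda>p. \<phi> p i)"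
    "f \<in> carrier A \<Longrightarrow> smooth_on_kspace n (\<phi> ` U) (\<lambda>u. inv_into U \<phi> u f)"
    "U \<subseteq> P" "p \<in> U \<Longrightarrow> \<phi> p \<in> kspace n"
proof -
  show U: "openin T U" and im: "openin (kspace_topology n) (\<phi> ` U)" and "inj_on \<phi> U"
    "i < n \<Longrightarrow> kpoints_smooth A U (\<lambda>p. \<phi> p i)"
    "f \<in> carrier A \<Longrightarrow> smooth_on_kspace n (\<phi> ` U) (\<lambda>u. inv_into U \<phi> u f)"
    using assms by (simp_all add: kpoints_atlas_def)
  show "U \<subseteq> P" using openin_subset[OF U] by simp
  show "p \<in> U \<Longrightarrow> \<phi> p \<in> kspace n" using openin_kspace_subset[OF im] by blast
qed

lemma chart_open:
  assumes c: "(U, \<phi>, n) \<in> \<A>" and X: "openin T X" "X \<subseteq> U"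
  shows "openin (kspace_topology n) (\<phi> ` X)"
proof -
  have "homeomorphic_map (subtopology T U) (top_of_set (\<phi> ` U)) \<phi>"
    using manifold c unfolding manifold_def by blast
  moreover have "openin (subtopology T U) X" using X by (auto simp: openin_subtopology)
  ultimately have "openin (top_of_set (\<phi> ` U)) (\<phi> ` X)"
    using homeomorphic_imp_open_map open_map_def by blast
  then show ?thesis using chartD(3)[OF c] openin_trans by blast
qed

lemma chart_at:
  assumes "p \<in> P"
  obtains U \<phi> n where "(U, \<phi>, n) \<in> \<A>" "p \<in> U"
proof -
  have "p \<in> (\<Union>(U, \<phi>, n)\<in>\<A>. U)"
    using manifold assms unfolding manifold_def by (metis topspace_T)
  then show ?thesis using that by blast
qed

lemma smooth_near_iff:
  "g \<in> smooth_near T \<A> q \<longleftrightarrow> (\<exists>W. openin T W \<and> q \<in> W \<and>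
     (\<forall>U \<phi> n. (U, \<phi>, n) \<in> \<A> \<longrightarrow> smooth_on_kspace n (\<phi> ` (U \<inter> W)) (\<lambda>u. g (inv_into U \<phi> u))))"
  by (simp add: smooth_near_def Ball_def split_paired_All)

text \<open>The instances used below are the identity and the left translations by points of a rack.\<close>

definition regular_map :: "(('a \<Rightarrow> 'k) \<Rightarrow> 'a \<Rightarrow> 'k) \<Rightarrow> bool" where
  "regular_map L \<longleftrightarrow> (\<forall>p\<in>P. L p \<in> P) \<and> (\<forall>f\<in>carrier A. \<exists>f'\<in>carrier A. \<forall>p\<in>P. L p f = p f')"

lemma regular_map_id: "regular_map (\<lambda>p. p)"
  by (auto simp: regular_map_def)

lemma kpoints_extensional: "p \<in> P \<Longrightarrow> a \<notin> carrier A \<Longrightarrow> p a = undefined"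
  by (auto simp: kpoints_def alg_hom_def extensional_def)

lemma openin_regular_preimage:
  assumes L: "regular_map L" and V: "openin T V"
  shows "openin T {p \<in> P. L p \<in> V}"
proof -
  have "continuous_on P L"
  proof (rule continuous_on_coordinatewise_then_product)
    fix a
    show "continuous_on P (\<lambda>p. L p a)"
    proof (cases "a \<in> carrier A")
      case True
      then obtain f' where f': "\<forall>p\<in>P. L p a = p f'" using L True unfolding regular_map_def by blast
      have "continuous_on P (\<lambda>p. p f')" by (rule continuous_on_subset[OF continuous_on_product_coordinates subset_UNIV])
      then show ?thesis using f' continuous_on_cong[of P P "\<lambda>p. L p a" "\<lambda>p. p f'"] by simp
    next
      case False
      then have "\<forall>p\<in>P. L p a = undefined" using L kpoints_extensional by (auto simp: regular_map_def)
      then show ?thesis using continuous_on_cong[of P P "\<lambda>p. L p a" "\<lambda>p. undefined"] by simp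
    qed
  qed
  moreover have "L \<in> P \<rightarrow> P" using L by (auto simp: regular_map_def)
  ultimately have "openin (top_of_set P) (P \<inter> L -` V)"
    using V by (intro continuous_openin_preimage[of P L P]) (auto simp: kpoints_topology_def)
  moreover have "P \<inter> L -` V = {p \<in> P. L p \<in> V}" by auto
  ultimately show ?thesis by (simp add: kpoints_topology_def)
qed

text \<open>Locally the function is \<open>F (f\<^sub>1, \<dots>, f\<^sub>m)\<close> with \<open>F\<close> smooth and the \<open>f\<^sub>i\<close> regular. The \<open>f\<^sub>i \<circ> L\<close>
  are again regular, hence smooth in the chart.\<close>

lemma kpoints_smooth_in_chart:
  assumes c: "(U, \<phi>, n) \<in> \<A>" and L: "regular_map L" and V: "openin T V" and g: "kpoints_smooth A V g"
  shows "smooth_on_kspace n (\<phi> ` {p \<in> U. L p \<in> V}) (\<lambda>u. g (L (inv_into U \<phi> u)))"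
  unfolding smooth_on_kspace_def
proof
  fix r
  show "times_differentiable_on r n (\<phi> ` {p \<in> U. L p \<in> V}) (\<lambda>u. g (L (inv_into U \<phi> u)))"
  proof (rule times_differentiable_local)
    fix u assume "u \<in> \<phi> ` {p \<in> U. L p \<in> V}"
    then obtain p where p: "p \<in> U" "L p \<in> V" "u = \<phi> p" by auto
    obtain m f W F V' where f: "\<And>i. i < m \<Longrightarrow> f i \<in> carrier A" and W: "openin (kspace_topology m) W"
      and F: "smooth_on_kspace m W F" and V': "openin T V'" "L p \<in> V'" "V' \<subseteq> V"
      and eq: "\<And>q. q \<in> V' \<Longrightarrow> (\<lambda>i::nat. if i < m then q (f i) else 0) \<in> W \<and>
         g q = F (\<lambda>i. if i < m then q (f i) else 0)"
      using bspec[OF g[unfolded kpoints_smooth_def] p(2)] by blast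
    have "\<forall>i\<in>{..<m}. \<exists>f'\<in>carrier A. \<forall>p\<in>P. L p (f i) = p f'" using L f by (auto simp: regular_map_def)
    then obtain f' where f': "\<And>i. i < m \<Longrightarrow> f' i \<in> carrier A" "\<And>i p. i < m \<Longrightarrow> p \<in> P \<Longrightarrow> L p (f i) = p (f' i)"
      by (metis lessThan_iff)
    define X where "X = U \<inter> {p \<in> P. L p \<in> V'}"
    have X: "openin T X" "X \<subseteq> U" "p \<in> X"
      unfolding X_def using openin_regular_preimage[OF L V'(1)] chartD(1,6)[OF c] p V'(2) by auto
    note op = chart_open[OF c X(1,2)]
    have XU: "\<phi> ` X \<subseteq> \<phi> ` U" using X(2) by blast
    have inv: "inv_into U \<phi> (\<phi> q) = q" if "q \<in> X" for q
      using that X(2) chartD(2)[OF c] by (intro inv_into_f_f) auto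
    have "times_differentiable_on r n (\<phi> ` X)
        (\<lambda>u. F (\<lambda>i. if i < m then inv_into U \<phi> u (f' i) else 0))"
    proof (rule times_differentiable_compose[OF op W])
      show "times_differentiable_on r m W F" by (rule smooth_on_kspaceD[OF F])
      show "times_differentiable_on r n (\<phi> ` X) (\<lambda>u. inv_into U \<phi> u (f' i))" if "i < m" for i
        using times_differentiable_subset[OF smooth_on_kspaceD[OF chartD(5)[OF c f'(1)[OF that]]] XU] .
      fix u assume "u \<in> \<phi> ` X"
      then obtain q where q: "q \<in> X" "u = \<phi> q" by blast
      then have "L q \<in> V'" "q \<in> P" by (auto simp: X_def)
      then show "(\<lambda>i. if i < m then inv_into U \<phi> u (f' i) else 0) \<in> W"
        using eq[of "L q"] f'(2)[of _ q] q inv by (simp cong: if_cong)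
    qed
    then have "times_differentiable_on r n (\<phi> ` X) (\<lambda>u. g (L (inv_into U \<phi> u)))"
    proof (rule times_differentiable_cong[OF op, rotated])
      fix u assume "u \<in> \<phi> ` X"
      then obtain q where q: "q \<in> X" "u = \<phi> q" by blast
      then have "L q \<in> V'" "q \<in> P" by (auto simp: X_def)
      then show "F (\<lambda>i. if i < m then inv_into U \<phi> u (f' i) else 0) = g (L (inv_into U \<phi> u))"
        using eq[of "L q"] f'(2)[of _ q] q inv by (simp cong: if_cong)
    qed
    moreover have "\<phi> ` X \<subseteq> \<phi> ` {p \<in> U. L p \<in> V}" using V'(3) by (auto simp: X_def)
    moreover have "u \<in> \<phi> ` X" using X(3) p(3) by blast
    ultimately show "\<exists>S. u \<in> S \<and> S \<subseteq> \<phi> ` {p \<in> U. L p \<in> V} \<and> openin (kspace_topology n) S \<and>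
        times_differentiable_on r n S (\<lambda>u. g (L (inv_into U \<phi> u)))"
      using op by (intro exI[of _ "\<phi> ` X"] conjI)
  qed
qed

text \<open>Near \<open>L p\<close> pass to a chart \<open>\<psi>\<close>: the germ is smooth in the coordinates \<open>\<psi>\<^sub>j\<close>, and each
  \<open>\<psi>\<^sub>j \<circ> L\<close> is smooth by the previous lemma.\<close>

lemma smooth_near_regular_map:
  assumes L: "regular_map L" and q: "q \<in> P" and g: "g \<in> smooth_near T \<A> (L q)"
  shows "(\<lambda>p. g (L p)) \<in> smooth_near T \<A> q"
proof -
  obtain W where W: "openin T W" "L q \<in> W"
    and smooth: "\<And>U \<phi> n. (U, \<phi>, n) \<in> \<A> \<Longrightarrow> smooth_on_kspace n (\<phi> ` (U \<inter> W)) (\<lambda>u. g (inv_into U \<phi> u))"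
    using g unfolding smooth_near_iff by blast
  have "times_differentiable_on r n (\<phi> ` (U \<inter> {p \<in> P. L p \<in> W})) (\<lambda>u. g (L (inv_into U \<phi> u)))"
    if c: "(U, \<phi>, n) \<in> \<A>" for U \<phi> n r
  proof (rule times_differentiable_local)
    fix u assume "u \<in> \<phi> ` (U \<inter> {p \<in> P. L p \<in> W})"
    then obtain p where p: "p \<in> U" "L p \<in> W" "u = \<phi> p" "p \<in> P" by auto
    have "L p \<in> P" using L p by (auto simp: regular_map_def)
    then obtain V \<psi> m where d: "(V, \<psi>, m) \<in> \<A>" "L p \<in> V" by (rule chart_at)
    define X where "X = U \<inter> {p \<in> P. L p \<in> V \<inter> W}"
    have VW: "openin T (V \<inter> W)" using chartD(1)[OF d(1)] W(1) by blast
    have X: "openin T X" "X \<subseteq> U" "p \<in> X"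
      unfolding X_def using openin_regular_preimage[OF L VW] chartD(1,6)[OF c] p d(2) by auto
    note op = chart_open[OF c X(1,2)]
    have inv: "inv_into U \<phi> (\<phi> q) = q" if "q \<in> X" for q
      using that X(2) chartD(2)[OF c] by (intro inv_into_f_f) auto
    have coords: "(\<lambda>j. if j < m then \<psi> q j else 0) = \<psi> q" if "q \<in> V" for q
      using chartD(7)[OF d(1) that] by (auto simp: kspace_def fun_eq_iff)
    have "times_differentiable_on r n (\<phi> ` X)
        (\<lambda>u. g (inv_into V \<psi> (\<lambda>j. if j < m then \<psi> (L (inv_into U \<phi> u)) j else 0)))"
    proof (rule times_differentiable_compose[OF op chart_open[OF d(1) VW]])
      show "times_differentiable_on r m (\<psi> ` (V \<inter> W)) (\<lambda>u. g (inv_into V \<psi> u))"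
        by (rule smooth_on_kspaceD[OF smooth[OF d(1)]])
      have "\<phi> ` X \<subseteq> \<phi> ` {p \<in> U. L p \<in> V}" by (auto simp: X_def)
      then show "times_differentiable_on r n (\<phi> ` X) (\<lambda>u. \<psi> (L (inv_into U \<phi> u)) j)" if "j < m" for j
        using times_differentiable_subset[OF smooth_on_kspaceD[OF kpoints_smooth_in_chart[OF c L chartD(1)[OF d(1)] chartD(4)[OF d(1) that]]]]
        by blast
      fix u assume "u \<in> \<phi> ` X"
      then obtain q where q: "q \<in> X" "u = \<phi> q" by blast
      then have "L q \<in> V \<inter> W" by (auto simp: X_def)
      then show "(\<lambda>j. if j < m then \<psi> (L (inv_into U \<phi> u)) j else 0) \<in> \<psi> ` (V \<inter> W)"
        using q inv coords by auto
    qed simp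
    then have "times_differentiable_on r n (\<phi> ` X) (\<lambda>u. g (L (inv_into U \<phi> u)))"
    proof (rule times_differentiable_cong[OF op, rotated])
      fix u assume "u \<in> \<phi> ` X"
      then obtain q where q: "q \<in> X" "u = \<phi> q" by blast
      then have "L q \<in> V" by (auto simp: X_def)
      then show "g (inv_into V \<psi> (\<lambda>j. if j < m then \<psi> (L (inv_into U \<phi> u)) j else 0)) = g (L (inv_into U \<phi> u))"
        using q inv coords chartD(2)[OF d(1)] by (simp add: inv_into_f_f)
    qed
    moreover have "\<phi> ` X \<subseteq> \<phi> ` (U \<inter> {p \<in> P. L p \<in> W})" by (auto simp: X_def)
    moreover have "u \<in> \<phi> ` X" using X(3) p(3) by blast
    ultimately show "\<exists>S. u \<in> S \<and> S \<subseteq> \<phi> ` (U \<inter> {p \<in> P. L p \<in> W}) \<and> openin (kspace_topology n) S \<and>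
        times_differentiable_on r n S (\<lambda>u. g (L (inv_into U \<phi> u)))"
      using op by (intro exI[of _ "\<phi> ` X"] conjI)
  qed
  then show ?thesis
    unfolding smooth_near_iff smooth_on_kspace_def
    using openin_regular_preimage[OF L W(1)] W(2) q by blast
qed

lemma regular_smooth_near: "f \<in> carrier A \<Longrightarrow> q \<in> P \<Longrightarrow> regular f \<in> smooth_near T \<A> q"
  unfolding smooth_near_def
proof (intro CollectI exI[of _ P] conjI ballI)
  assume f: "f \<in> carrier A"
  show "openin T P" by (metis openin_topspace topspace_T)
  fix c assume "c \<in> \<A>"
  then show "case c of (U, \<phi>, n) \<Rightarrow> smooth_on_kspace n (\<phi> ` (U \<inter> P)) (\<lambda>u. inv_into U \<phi> u f)"
    using chartD(5,6)[of "fst c" "fst (snd c)" "snd (snd c)"] f by (auto simp: Int_absorb2)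
qed

lemma smooth_near_cong:
  assumes eq: "\<And>p. p \<in> P \<Longrightarrow> g p = g' p" and g: "g \<in> smooth_near T \<A> q"
  shows "g' \<in> smooth_near T \<A> q"
proof -
  obtain W where W: "openin T W" "q \<in> W"
    and smooth: "\<And>U \<phi> n. (U, \<phi>, n) \<in> \<A> \<Longrightarrow> smooth_on_kspace n (\<phi> ` (U \<inter> W)) (\<lambda>u. g (inv_into U \<phi> u))"
    using g unfolding smooth_near_iff by blast
  have "times_differentiable_on r n (\<phi> ` (U \<inter> W)) (\<lambda>u. g' (inv_into U \<phi> u))"
    if c: "(U, \<phi>, n) \<in> \<A>" for U \<phi> n r
  proof (rule times_differentiable_cong[OF chart_open[OF c] _ smooth_on_kspaceD[OF smooth[OF c]]])
    show "openin T (U \<inter> W)" using chartD(1)[OF c] W(1) by blast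
    fix u assume "u \<in> \<phi> ` (U \<inter> W)"
    then have "inv_into U \<phi> u \<in> U" by (intro inv_into_into) auto
    then show "g (inv_into U \<phi> u) = g' (inv_into U \<phi> u)" using chartD(6)[OF c] eq by auto
  qed simp
  then show ?thesis
    unfolding smooth_near_iff smooth_on_kspace_def using W by blast
qed

text \<open>Tangent vectors are velocities of such curves. The class is closed under regular self-maps
  fixing \<open>e\<close>, and it is tested on regular functions only.\<close>

definition curve :: "('k \<Rightarrow> 'a \<Rightarrow> 'k) \<Rightarrow> bool" where
  "curve c \<longleftrightarrow> c 0 = e \<and> eventually (\<lambda>t. c t \<in> P) (nhds 0) \<and>
     (\<forall>f\<in>carrier A. (\<lambda>t. c t f) field_differentiable at 0)"

abbreviation velocity :: "('k \<Rightarrow> 'a \<Rightarrow> 'k) \<Rightarrow> 'a \<Rightarrow> 'k" where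
  "velocity c f \<equiv> deriv (\<lambda>t. c t f) 0"

lemma curve_has_derivative:
  "curve c \<Longrightarrow> f \<in> carrier A \<Longrightarrow> ((\<lambda>t. c t f) has_field_derivative velocity c f) (at 0)"
  by (simp add: curve_def DERIV_deriv_iff_field_differentiable)

text \<open>The topology of \<open>Q(k)\<close> is that of pointwise convergence, so differentiability of the values
  on regular functions makes the curve continuous at \<open>0\<close>.\<close>

lemma curve_eventually_in:
  assumes c: "curve c" and W: "openin T W" "e \<in> W"
  shows "eventually (\<lambda>t. c t \<in> W) (nhds 0)"
proof -
  have P: "eventually (\<lambda>t. c t \<in> P) (nhds 0)" using c by (simp add: curve_def)
  obtain O' where O': "open O'" "W = P \<inter> O'" using W(1) by (auto simp: kpoints_topology_def openin_open)
  have prod: "openin (product_topology (\<lambda>i. euclidean) UNIV) O'" using O'(1) by (simp add: open_fun_def)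
  have eO: "e \<in> O'" using W O' by auto
  obtain X where X: "e \<in> Pi\<^sub>E UNIV X" "\<And>i. open (X i)" "finite {i. X i \<noteq> UNIV}" "Pi\<^sub>E UNIV X \<subseteq> O'"
    using product_topology_open_contains_basis[OF prod eO] by (simp, blast)
  have "eventually (\<lambda>t. c t a \<in> X a) (nhds 0)" for a
  proof (cases "a \<in> carrier A")
    case True
    have "isCont (\<lambda>t. c t a) 0" by (rule DERIV_isCont[OF curve_has_derivative[OF c True]])
    moreover have "c 0 a \<in> X a" using PiE_mem[OF X(1), of a] c by (simp add: curve_def)
    ultimately have "eventually (\<lambda>t. c t a \<in> X a) (at 0)"
      using X(2)[of a] by (auto simp: isCont_def dest: topological_tendstoD)
    then show ?thesis using \<open>c 0 a \<in> X a\<close> by (simp add: eventually_nhds_conv_at)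
  next
    case False
    have "c t a \<in> X a" if "c t \<in> P" for t
      using PiE_mem[OF X(1), of a] kpoints_extensional[OF that False] kpoints_extensional[OF e False] by simp
    then show ?thesis using P by (rule eventually_mono[rotated])
  qed
  then have "eventually (\<lambda>t. \<forall>a\<in>{i. X i \<noteq> UNIV}. c t a \<in> X a) (nhds 0)"
    using X(3) by (intro eventually_ball_finite) auto
  then show ?thesis using P
  proof eventually_elim
    case (elim t)
    then have "c t \<in> Pi\<^sub>E UNIV X" by (auto simp: PiE_iff)
    then show ?case using X(4) O'(2) elim by auto
  qed
qed

lemma curve_regular_map:
  assumes c: "curve c" and L: "regular_map L" and Le: "L e = e"
  shows "curve (\<lambda>t. L (c t))"
proof -
  have P: "eventually (\<lambda>t. c t \<in> P) (nhds 0)" using c by (simp add: curve_def)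
  have "(\<lambda>t. L (c t) f) field_differentiable at 0" if f: "f \<in> carrier A" for f
  proof -
    obtain f' where f': "f' \<in> carrier A" "\<forall>p\<in>P. L p f = p f'" using L f by (auto simp: regular_map_def)
    have "eventually (\<lambda>t. c t f' = L (c t) f) (nhds 0)" using P by (rule eventually_mono) (simp add: f')
    from iffD1[OF field_derivative_cong_near[OF this] curve_has_derivative[OF c f'(1)]] show ?thesis
      unfolding field_differentiable_def by blast
  qed
  moreover have "eventually (\<lambda>t. L (c t) \<in> P) (nhds 0)"
    using P by (rule eventually_mono) (use L in \<open>auto simp: regular_map_def\<close>)
  ultimately show ?thesis using c Le by (simp add: curve_def)
qed

text \<open>Evaluation is linear in the regular function, so a linear combination of velocities is the
  velocity of one regular function.\<close>

lemma regular_combination: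
  fixes n :: nat
  assumes "\<And>j. j < n \<Longrightarrow> a j \<in> carrier A"
  shows "\<exists>f\<in>carrier A. \<forall>c. curve c \<longrightarrow> velocity c f = (\<Sum>j<n. \<kappa> j * velocity c (a j))"
proof -
  interpret A: algebra base_field A by (rule A)
  have "\<exists>f\<in>carrier A. \<forall>p\<in>P. p f = (\<Sum>j<n. \<kappa> j * p (a j))"
    using assms
  proof (induction n)
    case 0
    have "p \<zero>\<^bsub>A\<^esub> = 0" if "p \<in> P" for p
      using linear_maps_zero[OF A algebra_base_algebra alg_hom_linear[OF pointD[OF that]]] by simp
    then show ?case by auto
  next
    case (Suc n)
    then obtain f where f: "f \<in> carrier A" "\<forall>p\<in>P. p f = (\<Sum>j<n. \<kappa> j * p (a j))" by auto
    show ?case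
      by (rule bexI[of _ "f \<oplus>\<^bsub>A\<^esub> \<kappa> n \<odot>\<^bsub>A\<^esub> a n"])
         (use f Suc.prems[of n] in \<open>auto simp: alg_homD[OF pointD]\<close>)
  qed
  then obtain f where f: "f \<in> carrier A" "\<And>p. p \<in> P \<Longrightarrow> p f = (\<Sum>j<n. \<kappa> j * p (a j))" by auto
  have "velocity c f = (\<Sum>j<n. \<kappa> j * velocity c (a j))" if c: "curve c" for c
  proof (rule DERIV_imp_deriv)
    have ev: "eventually (\<lambda>t. c t f = (\<Sum>j<n. \<kappa> j * c t (a j))) (nhds 0)"
      using c f(2) by (auto simp: curve_def elim: eventually_mono)
    have "((\<lambda>t. \<Sum>j<n. \<kappa> j * c t (a j)) has_field_derivative (\<Sum>j<n. \<kappa> j * velocity c (a j))) (at 0)"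
      by (intro DERIV_sum DERIV_cmult curve_has_derivative[OF c] assms) auto
    then show "((\<lambda>t. c t f) has_field_derivative (\<Sum>j<n. \<kappa> j * velocity c (a j))) (at 0)"
      unfolding field_derivative_cong_near[OF ev] .
  qed
  then show ?thesis using f(1) by blast
qed

lemma kpoints_smooth_velocity:
  assumes U: "e \<in> U" and g: "kpoints_smooth A U g"
  shows "\<exists>f\<in>carrier A. \<forall>c. curve c \<longrightarrow> ((\<lambda>t. g (c t)) has_field_derivative velocity c f) (at 0)"
proof -
  obtain m f W F V where f: "\<And>i. i < m \<Longrightarrow> f i \<in> carrier A" and W: "openin (kspace_topology m) W"
      and F: "smooth_on_kspace m W F" and V: "openin T V" "e \<in> V" "V \<subseteq> U"
      and eq: "\<And>q. q \<in> V \<Longrightarrow> (\<lambda>i::nat. if i < m then q (f i) else 0) \<in> W \<and>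
         g q = F (\<lambda>i. if i < m then q (f i) else 0)"
    using bspec[OF g[unfolded kpoints_smooth_def] U] by blast
  obtain h where h: "h \<in> carrier A" "\<And>c. curve c \<Longrightarrow> velocity c h =
      (\<Sum>j<m. partial_deriv j F (\<lambda>i. if i < m then e (f i) else 0) * velocity c (f j))"
    using regular_combination[OF f, of m] by meson
  have "((\<lambda>t. g (c t)) has_field_derivative velocity c h) (at 0)" if c: "curve c" for c
  proof -
    have c0: "c 0 = e" using c by (simp add: curve_def)
    have d: "((\<lambda>t. F (\<lambda>i. if i < m then c t (f i) else 0)) has_field_derivative
        (\<Sum>j<m. partial_deriv j F (\<lambda>i. if i < m then c 0 (f i) else 0) * velocity c (f j))) (at 0)"
    proof (rule chain_rule[OF W smooth_on_kspaceD[OF F]])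
      show "((\<lambda>t. if j < m then c t (f j) else 0) has_field_derivative velocity c (f j)) (at 0)" if "j < m" for j
        using curve_has_derivative[OF c f[OF that]] that by simp
    qed (use eq[OF V(2)] c0 in \<open>auto simp: kspace_def\<close>)
    have ev: "eventually (\<lambda>t. g (c t) = F (\<lambda>i. if i < m then c t (f i) else 0)) (nhds 0)"
      using curve_eventually_in[OF c V(1,2)] by (rule eventually_mono) (use eq in blast)
    show ?thesis using d unfolding field_derivative_cong_near[OF ev] h(2)[OF c] c0 .
  qed
  with h(1) show ?thesis by blast
qed

text \<open>The chain rule twice: \<open>g\<close> is a smooth function of the coordinates of a chart, and these are
  smooth functions of regular functions. All derivatives are taken at \<open>e\<close>, so the resulting
  combination of regular functions is the same for every curve.\<close>

lemma germ_velocity: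
  assumes g: "g \<in> germs"
  shows "\<exists>f\<in>carrier A. \<forall>c. curve c \<longrightarrow> ((\<lambda>t. g (c t)) has_field_derivative velocity c f) (at 0)"
proof -
  obtain W where W: "openin T W" "e \<in> W"
    and smooth: "\<And>U \<phi> n. (U, \<phi>, n) \<in> \<A> \<Longrightarrow> smooth_on_kspace n (\<phi> ` (U \<inter> W)) (\<lambda>u. g (inv_into U \<phi> u))"
    using g unfolding smooth_near_iff by blast
  obtain U \<phi> n where d: "(U, \<phi>, n) \<in> \<A>" "e \<in> U" using e by (rule chart_at)
  have UW: "openin T (U \<inter> W)" using chartD(1)[OF d(1)] W(1) by blast
  have "\<forall>j\<in>{..<n}. \<exists>f\<in>carrier A. \<forall>c. curve c \<longrightarrow> ((\<lambda>t. \<phi> (c t) j) has_field_derivative velocity c f) (at 0)"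
    using kpoints_smooth_velocity[OF d(2) chartD(4)[OF d(1)]] by auto
  then obtain f where f: "\<And>j. j < n \<Longrightarrow> f j \<in> carrier A"
    "\<And>j c. j < n \<Longrightarrow> curve c \<Longrightarrow> ((\<lambda>t. \<phi> (c t) j) has_field_derivative velocity c (f j)) (at 0)"
    by (metis lessThan_iff)
  let ?G = "\<lambda>u. g (inv_into U \<phi> u)"
  obtain h where h: "h \<in> carrier A" "\<And>c. curve c \<Longrightarrow> velocity c h =
      (\<Sum>j<n. partial_deriv j ?G (\<phi> e) * velocity c (f j))"
    using regular_combination[OF f(1), of n] by meson
  have "((\<lambda>t. g (c t)) has_field_derivative velocity c h) (at 0)" if c: "curve c" for c
  proof -
    have c0: "c 0 = e" using c by (simp add: curve_def)
    have U: "eventually (\<lambda>t. c t \<in> U) (nhds 0)" by (rule curve_eventually_in[OF c chartD(1)[OF d(1)] d(2)])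
    have der: "((\<lambda>t. ?G (\<phi> (c t))) has_field_derivative
        (\<Sum>j<n. partial_deriv j ?G (\<phi> (c 0)) * velocity c (f j))) (at 0)"
    proof (rule chain_rule[OF chart_open[OF d(1) UW] smooth_on_kspaceD[OF smooth[OF d(1)]]])
      show "eventually (\<lambda>t. \<phi> (c t) \<in> kspace n) (nhds 0)"
        using U by (rule eventually_mono) (rule chartD(7)[OF d(1)])
    qed (use c0 d(2) W(2) f(2)[OF _ c] in auto)
    have ev: "eventually (\<lambda>t. g (c t) = ?G (\<phi> (c t))) (nhds 0)"
      using U by (rule eventually_mono) (use chartD(2)[OF d(1)] in \<open>simp add: inv_into_f_f\<close>)
    show ?thesis using der unfolding field_derivative_cong_near[OF ev] h(2)[OF c] c0 .
  qed
  with h(1) show ?thesis by blast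
qed

lemma tangent_curve:
  assumes X: "X \<in> tangent_space T \<A> e"
  obtains c where "curve c" "\<And>g. g \<in> germs \<Longrightarrow> X g = deriv (\<lambda>t. g (c t)) 0" "X \<in> extensional germs"
proof -
  obtain U \<phi> n v where d: "(U, \<phi>, n) \<in> \<A>" "e \<in> U" and v: "v \<in> kspace n"
    and X: "X = directional_derivative T \<A> U \<phi> e v"
    using X by (auto simp: tangent_space_def)
  let ?\<gamma> = "\<lambda>t i. \<phi> e i + t * v i"
  define c where "c t = inv_into U \<phi> (?\<gamma> t)" for t
  have phi_e: "\<phi> e \<in> kspace n" by (rule chartD(7)[OF d])
  have \<gamma>: "?\<gamma> t \<in> kspace n" for t using v phi_e by (auto simp: kspace_def)
  have \<gamma>0: "?\<gamma> 0 = \<phi> e" by simp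
  have der: "((\<lambda>t. ?\<gamma> t j) has_field_derivative v j) (at 0)" for j
    by (auto intro!: derivative_eq_intros)
  have im: "\<phi> e \<in> \<phi> ` U" using d(2) by blast
  obtain r where r: "r > 0" "\<And>u. u \<in> kspace n \<Longrightarrow> (\<And>i. i < n \<Longrightarrow> dist (u i) (\<phi> e i) < r) \<Longrightarrow> u \<in> \<phi> ` U"
    using openin_kspace_box[OF chartD(3)[OF d(1)] im] by metis
  have "eventually (\<lambda>t. dist (?\<gamma> t i) (\<phi> e i) < r) (nhds 0)" for i
  proof -
    have "eventually (\<lambda>t. dist (?\<gamma> t i) (?\<gamma> 0 i) < r) (at 0)"
      using DERIV_isCont[OF der[of i]] r(1) unfolding isCont_def by (rule tendstoD)
    then show ?thesis using r(1) by (simp add: eventually_nhds_conv_at)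
  qed
  then have "eventually (\<lambda>t. \<forall>i\<in>{..<n}. dist (?\<gamma> t i) (\<phi> e i) < r) (nhds 0)"
    by (intro eventually_ball_finite) auto
  then have in_U: "eventually (\<lambda>t. c t \<in> U) (nhds 0)"
  proof (rule eventually_mono)
    fix t assume "\<forall>i\<in>{..<n}. dist (?\<gamma> t i) (\<phi> e i) < r"
    then have "?\<gamma> t \<in> \<phi> ` U" by (intro r(2) \<gamma>) auto
    then show "c t \<in> U" unfolding c_def by (rule inv_into_into)
  qed
  have c0: "c 0 = e" unfolding c_def \<gamma>0 by (rule inv_into_f_f[OF chartD(2)[OF d(1)] d(2)])
  have "(\<lambda>t. c t f) field_differentiable at 0" if f: "f \<in> carrier A" for f
  proof -
    have "((\<lambda>t. inv_into U \<phi> (?\<gamma> t) f) has_field_derivative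
        (\<Sum>j<n. partial_deriv j (\<lambda>u. inv_into U \<phi> u f) (?\<gamma> 0) * v j)) (at 0)"
      by (rule chain_rule[OF chartD(3)[OF d(1)] smooth_on_kspaceD[OF chartD(5)[OF d(1) f]]])
         (use \<gamma> im der in auto)
    then show ?thesis by (auto simp: c_def field_differentiable_def)
  qed
  then have "curve c"
    using c0 in_U chartD(6)[OF d(1)] by (auto simp: curve_def elim: eventually_mono)
  moreover have "X g = deriv (\<lambda>t. g (c t)) 0" if "g \<in> germs" for g
    using that by (simp add: X directional_derivative_def c_def)
  moreover have "X \<in> extensional germs" by (simp add: X directional_derivative_def)
  ultimately show ?thesis by (rule that)
qed

abbreviation "tangents \<equiv> tangent_space T \<A> e"

lemma tangent_cong:
  assumes X: "X \<in> tangents" and eq: "\<And>p. p \<in> P \<Longrightarrow> g p = g' p"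
  shows "X g = X g'"
proof -
  obtain c where c: "curve c" "\<And>g. g \<in> germs \<Longrightarrow> X g = deriv (\<lambda>t. g (c t)) 0" "X \<in> extensional germs"
    using tangent_curve[OF X] by metis
  show ?thesis
  proof (cases "g \<in> germs")
    case True
    then have "g' \<in> germs" using smooth_near_cong[of g g'] eq by blast
    moreover have "eventually (\<lambda>t. g (c t) = g' (c t)) (nhds 0)"
      using c(1) eq by (auto simp: curve_def elim: eventually_mono)
    ultimately show ?thesis using True c(2) deriv_cong_ev by metis
  next
    case False
    then have "g' \<notin> germs" using smooth_near_cong[of g' g] eq by metis
    from extensional_arb[OF c(3) False] extensional_arb[OF c(3) this] show ?thesis by (simp only:)
  qed
qed

text \<open>The regular functions span the cotangent space: on tangent vectors at \<open>e\<close> the germ \<open>g\<close>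
  cannot be told from a single regular function, even after composition with a regular self-map
  fixing \<open>e\<close>.\<close>

lemma germ_regular:
  assumes g: "g \<in> germs"
  obtains f where "f \<in> carrier A"
    "\<And>X L. X \<in> tangents \<Longrightarrow> regular_map L \<Longrightarrow> L e = e \<Longrightarrow> X (\<lambda>p. g (L p)) = X (\<lambda>p. L p f)"
    "\<And>X. X \<in> tangents \<Longrightarrow> X g = X (regular f)"
proof -
  obtain f where f: "f \<in> carrier A" "\<And>c. curve c \<Longrightarrow> ((\<lambda>t. g (c t)) has_field_derivative velocity c f) (at 0)"
    using germ_velocity[OF g] by blast
  have main: "X (\<lambda>p. g (L p)) = X (\<lambda>p. L p f)"
    if X: "X \<in> tangents" and L: "regular_map L" "L e = e" for X L
  proof -
    obtain c where c: "curve c" "\<And>g. g \<in> germs \<Longrightarrow> X g = deriv (\<lambda>t. g (c t)) 0"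
      using tangent_curve[OF X] by metis
    have "(\<lambda>p. g (L p)) \<in> germs" "(\<lambda>p. L p f) \<in> germs"
      using smooth_near_regular_map[OF L(1) e, of g] smooth_near_regular_map[OF L(1) e, of "regular f"]
        regular_smooth_near[OF f(1) e] g L(2) by simp_all
    then show ?thesis
      using c(2) DERIV_imp_deriv[OF f(2)[OF curve_regular_map[OF c(1) L]]] by simp
  qed
  show ?thesis
  proof (rule that[OF f(1)])
    show "X (\<lambda>p. g (L p)) = X (\<lambda>p. L p f)" if "X \<in> tangents" "regular_map L" "L e = e" for X L
      by (rule main[OF that])
    show "X g = X (regular f)" if "X \<in> tangents" for X
      using main[OF that regular_map_id] by simp
  qed
qed

lemma tangents_eqI:
  assumes "X \<in> tangents" "Y \<in> extensional germs" "\<And>g. g \<in> germs \<Longrightarrow> Y g = X g"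
  shows "Y = X"
proof -
  have "X \<in> extensional germs" using tangent_curve[OF assms(1)] by blast
  then show ?thesis using assms by (intro extensionalityI[of _ germs]) auto
qed

end

section \<open>The Leibniz algebra of the Lie rack of rational points\<close>

lemma left_leibniz_transfer:
  fixes L :: "('k::field, 'v) bracket_module" and M :: "('k, 'w) bracket_module"
  assumes L: "Module.module base_field L"
    and closed: "\<And>x y. x \<in> carrier L \<Longrightarrow> y \<in> carrier L \<Longrightarrow> bracket L x y \<in> carrier L"
    and h: "h \<in> leibniz_hom L M" and inj: "inj_on h (carrier L)" and M: "left_leibniz M"
  shows "left_leibniz L"
proof -
  interpret L: Module.module base_field L by (rule L)
  note hD = leibniz_homD[OF h]
  have eqI: "x = y" if "x \<in> carrier L" "y \<in> carrier L" "h x = h y" for x y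
    using inj_onD[OF inj that(3,1,2)] .
  have smult: "c \<odot>\<^bsub>L\<^esub> x \<in> carrier L" if "x \<in> carrier L" for c x using that by simp
  note cl = closed smult L.M.a_closed
  have lin: "\<And>x y z. x \<in> carrier M \<Longrightarrow> y \<in> carrier M \<Longrightarrow> z \<in> carrier M \<Longrightarrow>
        bracket M (x \<oplus>\<^bsub>M\<^esub> y) z = bracket M x z \<oplus>\<^bsub>M\<^esub> bracket M y z"
    "\<And>x y z. x \<in> carrier M \<Longrightarrow> y \<in> carrier M \<Longrightarrow> z \<in> carrier M \<Longrightarrow>
        bracket M x (y \<oplus>\<^bsub>M\<^esub> z) = bracket M x y \<oplus>\<^bsub>M\<^esub> bracket M x z"
    "\<And>c x y. x \<in> carrier M \<Longrightarrow> y \<in> carrier M \<Longrightarrow> bracket M (c \<odot>\<^bsub>M\<^esub> x) y = c \<odot>\<^bsub>M\<^esub> bracket M x y"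
    "\<And>c x y. x \<in> carrier M \<Longrightarrow> y \<in> carrier M \<Longrightarrow> bracket M x (c \<odot>\<^bsub>M\<^esub> y) = c \<odot>\<^bsub>M\<^esub> bracket M x y"
    using M unfolding left_leibniz_def bilinear_bracket_def by blast+
  have jacobi: "bracket M x (bracket M y z) = bracket M (bracket M x y) z \<oplus>\<^bsub>M\<^esub> bracket M y (bracket M x z)"
    if "x \<in> carrier M" "y \<in> carrier M" "z \<in> carrier M" for x y z
    using M that unfolding left_leibniz_def by blast
  have add: "bracket L (x \<oplus>\<^bsub>L\<^esub> y) z = bracket L x z \<oplus>\<^bsub>L\<^esub> bracket L y z"
    "bracket L x (y \<oplus>\<^bsub>L\<^esub> z) = bracket L x y \<oplus>\<^bsub>L\<^esub> bracket L x z"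
    if "x \<in> carrier L" "y \<in> carrier L" "z \<in> carrier L" for x y z
    by (rule eqI; simp only: that cl hD lin)+
  have scale: "bracket L (c \<odot>\<^bsub>L\<^esub> x) y = c \<odot>\<^bsub>L\<^esub> bracket L x y"
    "bracket L x (c \<odot>\<^bsub>L\<^esub> y) = c \<odot>\<^bsub>L\<^esub> bracket L x y"
    if "x \<in> carrier L" "y \<in> carrier L" for c x y
    by (rule eqI; simp only: that cl hD lin)+
  have jacobi_L: "bracket L x (bracket L y z) = bracket L (bracket L x y) z \<oplus>\<^bsub>L\<^esub> bracket L y (bracket L x z)"
    if "x \<in> carrier L" "y \<in> carrier L" "z \<in> carrier L" for x y z
  proof (rule eqI)
    show "h (bracket L x (bracket L y z)) = h (bracket L (bracket L x y) z \<oplus>\<^bsub>L\<^esub> bracket L y (bracket L x z))"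
      by (simp only: that cl hD) (rule jacobi[OF hD(1)[OF that(1)] hD(1)[OF that(2)] hD(1)[OF that(3)]])
  qed (simp_all only: that cl)
  show ?thesis
    unfolding left_leibniz_def bilinear_bracket_def
    by (intro conjI ballI allI L closed add scale jacobi_L; assumption)
qed

locale kpoints_rack = affine_rack_scheme Q for Q :: "('k::real_normed_field, 'a) rack_scheme" +
  assumes lie: "kpoints_lie_rack Q" and identified: "kpoints_tangent_identified Q"
begin

abbreviation "act \<equiv> point_op A k m"

lemma pointed_rack_points: "pointed_rack (kpoints A) act (point_op A k mi) \<epsilon>"
  and manifold_points: "manifold (kpoints_topology A) (kpoints_atlas A)"
  using lie by (auto simp: kpoints_lie_rack_def Let_def lie_rack_def kpoints_topology_def)

sublocale M: point_manifold A \<epsilon>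
  using pointed_rack_points manifold_points A by unfold_locales (auto simp: pointed_rack_def)

abbreviation "\<mu> \<equiv> kpoints_tangent_map Q"

lemma bij_tangent_map: "bij_betw \<mu> M.tangents (derivations A \<epsilon>)"
  using identified by (simp add: kpoints_tangent_identified_def)

lemma tangent_map_apply: "X \<in> M.tangents \<Longrightarrow> f \<in> carrier A \<Longrightarrow> \<mu> X f = X (M.regular f)"
  by (simp add: kpoints_tangent_map_def)

lemma tangent_map_derivation: "X \<in> M.tangents \<Longrightarrow> \<mu> X \<in> derivations A \<epsilon>"
  using bij_tangent_map by (auto simp: bij_betw_def)

lemma act_apply:
  assumes f: "f \<in> carrier A"
  shows "act x y f = pairing x y (m f)"
  using f by (simp add: point_op_def compose_def)

text \<open>Left translation by a point \<open>x\<close> sends the regular function \<open>f\<close> to \<open>(x \<otimes> id) (\<nabla> f)\<close>.\<close>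

lemma act_contract:
  assumes x: "x \<in> M.P" and f: "f \<in> carrier A"
  obtains f' where "f' \<in> carrier A" "\<And>D. D \<in> linear_maps A k \<Longrightarrow> D f' = pairing x D (m f)"
proof -
  note x' = alg_hom_linear[OF M.pointD[OF x]]
  have "tensor_map A A A (point_unit A A x) (\<lambda>a\<in>carrier A. a) (m f) \<in> carrier A"
    by (rule linear_mapsD(1)[OF tensor_map_linear[OF A A A point_unit_linear[OF A x'] alg_hom_linear[OF identity_alg_hom[OF A]]]
        alg_homD(1)[OF m f]])
  then show ?thesis using that contract_left[OF x' _ alg_homD(1)[OF m f]] by blast
qed

lemma act_regular_map:
  assumes x: "x \<in> M.P"
  shows "M.regular_map (act x)"
  unfolding M.regular_map_def
proof (intro conjI ballI)
  show "act x p \<in> M.P" if "p \<in> M.P" for p using pointed_rack_points x that by (auto simp: pointed_rack_def)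
  fix f assume f: "f \<in> carrier A"
  obtain f' where "f' \<in> carrier A" "\<And>D. D \<in> linear_maps A k \<Longrightarrow> D f' = pairing x D (m f)"
    by (rule act_contract[OF x f]) (rule that)
  then show "\<exists>f'\<in>carrier A. \<forall>p\<in>M.P. act x p f = p f'"
    using f alg_hom_linear[OF M.pointD] by (auto simp: act_apply)
qed

lemma act_unit: "x \<in> M.P \<Longrightarrow> act x \<epsilon> = \<epsilon>"
  using pointed_rack_points by (auto simp: pointed_rack_def)

lemma germ_tangent_map:
  assumes "g \<in> M.germs"
  obtains f where "f \<in> carrier A" "\<And>X. X \<in> M.tangents \<Longrightarrow> X g = \<mu> X f"
    "\<And>X L. X \<in> M.tangents \<Longrightarrow> M.regular_map L \<Longrightarrow> L \<epsilon> = \<epsilon> \<Longrightarrow> X (\<lambda>p. g (L p)) = X (\<lambda>p. L p f)"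
proof (rule M.germ_regular[OF assms])
  fix f assume f: "f \<in> carrier A"
    "\<And>X L. X \<in> M.tangents \<Longrightarrow> M.regular_map L \<Longrightarrow> L \<epsilon> = \<epsilon> \<Longrightarrow> X (\<lambda>p. g (L p)) = X (\<lambda>p. L p f)"
    "\<And>X. X \<in> M.tangents \<Longrightarrow> X g = X (M.regular f)"
  show thesis
  proof (rule that[OF f(1)])
    show "X g = \<mu> X f" if "X \<in> M.tangents" for X
      using f(3)[OF that] tangent_map_apply[OF that f(1)] by simp
    show "X (\<lambda>p. g (L p)) = X (\<lambda>p. L p f)" if "X \<in> M.tangents" "M.regular_map L" "L \<epsilon> = \<epsilon>" for X L
      by (rule f(2)[OF that])
  qed
qed

text \<open>An operator on germs whose values are those of a derivation on representing regular
  functions is a tangent vector: by the identification of tangent vectors with derivations some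
  tangent vector induces the derivation, and by the hypothesis the two agree on all germs.\<close>

lemma tangent_lift:
  assumes D: "D \<in> derivations A \<epsilon>" and Y: "Y \<in> extensional M.germs"
    and g: "\<And>g. g \<in> M.germs \<Longrightarrow> \<exists>f\<in>carrier A. (\<forall>X\<in>M.tangents. X g = \<mu> X f) \<and> Y g = D f"
  shows "Y \<in> M.tangents" "\<mu> Y = D"
proof -
  have "D \<in> \<mu> ` M.tangents" using D bij_betw_imp_surj_on[OF bij_tangent_map] by simp
  then obtain Z where Z: "Z \<in> M.tangents" "\<mu> Z = D" by (elim imageE) simp
  have "Y = Z"
  proof (rule M.tangents_eqI[OF Z(1) Y])
    show "Y h = Z h" if "h \<in> M.germs" for h
      using g[OF that] Z by auto
  qed
  with Z show "Y \<in> M.tangents" "\<mu> Y = D" by simp_all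
qed

abbreviation "ad \<equiv> lie_rack_ad M.T M.\<A> act \<epsilon>"

text \<open>For \<open>f\<close> representing the germ \<open>g\<close>, the law \<open>x \<triangleright> e = e\<close> makes left translation by \<open>x\<close> fix
  \<open>e\<close>, so \<open>Ad\<^sub>x Y g = Y (f \<circ> L\<^sub>x) = (x \<otimes> Y) (\<nabla> f)\<close>. As a function of \<open>x\<close> this is the regular
  function \<open>h = (id \<otimes> Y) (\<nabla> f)\<close>, on which \<open>X\<close> takes the value \<open>(X \<otimes> Y) (\<nabla> f)\<close>.\<close>

lemma ad_tangent_map:
  assumes X: "X \<in> M.tangents" and Y: "Y \<in> M.tangents"
  shows "ad X Y \<in> M.tangents" "\<mu> (ad X Y) = convolution m (\<mu> X) (\<mu> Y)"
proof -
  note DX = tangent_map_derivation[OF X] and DY = tangent_map_derivation[OF Y]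
  note lX = derivations_linear[OF DX] and lY = derivations_linear[OF DY]
  have "\<exists>f\<in>carrier A. (\<forall>Z\<in>M.tangents. Z g = \<mu> Z f) \<and> ad X Y g = convolution m (\<mu> X) (\<mu> Y) f"
    if g: "g \<in> M.germs" for g
  proof -
    obtain f where f: "f \<in> carrier A" "\<And>X. X \<in> M.tangents \<Longrightarrow> X g = \<mu> X f"
      "\<And>X L. X \<in> M.tangents \<Longrightarrow> M.regular_map L \<Longrightarrow> L \<epsilon> = \<epsilon> \<Longrightarrow> X (\<lambda>p. g (L p)) = X (\<lambda>p. L p f)"
      by (rule germ_tangent_map[OF g]) (rule that)
    have mf: "m f \<in> carrier A2" by (rule alg_homD(1)[OF m f(1)])
    define h where "h = tensor_map A A A (\<lambda>a\<in>carrier A. a) (point_unit A A (\<mu> Y)) (m f)"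
    have h: "h \<in> carrier A"
      unfolding h_def
      by (rule linear_mapsD(1)[OF tensor_map_linear[OF A A A alg_hom_linear[OF identity_alg_hom[OF A]] point_unit_linear[OF A lY]] mf])
    have Dh: "D h = pairing D (\<mu> Y) (m f)" if "D \<in> linear_maps A k" for D
      unfolding h_def by (rule contract_right[OF lY that mf])
    have Ad: "lie_rack_Ad M.T M.\<A> act \<epsilon> x Y g = x h" if x: "x \<in> M.P" for x
    proof -
      obtain f' where f': "f' \<in> carrier A" "\<And>D. D \<in> linear_maps A k \<Longrightarrow> D f' = pairing x D (m f)"
        by (rule act_contract[OF x f(1)]) (rule that)
      have "lie_rack_Ad M.T M.\<A> act \<epsilon> x Y g = Y (\<lambda>p. g (act x p))"
        using g by (simp add: lie_rack_Ad_def manifold_differential_def act_unit[OF x] comp_def)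
      also have "\<dots> = Y (\<lambda>p. act x p f)" by (rule f(3)[OF Y act_regular_map[OF x] act_unit[OF x]])
      also have "\<dots> = Y (M.regular f')"
        using f' alg_hom_linear[OF M.pointD] by (intro M.tangent_cong[OF Y]) (simp add: act_apply f(1))
      also have "\<dots> = \<mu> Y f'" using tangent_map_apply[OF Y f'(1)] by simp
      also have "\<dots> = pairing x (\<mu> Y) (m f)" by (rule f'(2)[OF lY])
      also have "\<dots> = x h" using Dh[OF alg_hom_linear[OF M.pointD[OF x]]] by simp
      finally show ?thesis .
    qed
    have "ad X Y g = X (\<lambda>x. lie_rack_Ad M.T M.\<A> act \<epsilon> x Y g)"
      using g by (simp add: lie_rack_ad_def)
    also have "\<dots> = X (M.regular h)" by (rule M.tangent_cong[OF X Ad])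
    also have "\<dots> = \<mu> X h" using tangent_map_apply[OF X h] by simp
    also have "\<dots> = convolution m (\<mu> X) (\<mu> Y) f" using Dh[OF lX] f(1) by (simp add: compose_eq)
    finally show ?thesis using f(1,2) by blast
  qed
  moreover have "ad X Y \<in> extensional M.germs" by (simp add: lie_rack_ad_def)
  ultimately show "ad X Y \<in> M.tangents" "\<mu> (ad X Y) = convolution m (\<mu> X) (\<mu> Y)"
    using tangent_lift[OF bracket_closed(1)[OF DX DY], of "ad X Y"] by blast+
qed

text \<open>Two tangent vectors may come from different charts, so their sum is obtained from the sum of
  the corresponding derivations.\<close>

lemma tangent_operations:
  "(\<lambda>g\<in>M.germs. 0) \<in> M.tangents"
  "X \<in> M.tangents \<Longrightarrow> Y \<in> M.tangents \<Longrightarrow> (\<lambda>g\<in>M.germs. X g + Y g) \<in> M.tangents"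
  "X \<in> M.tangents \<Longrightarrow> Y \<in> M.tangents \<Longrightarrow> \<mu> (\<lambda>g\<in>M.germs. X g + Y g) = (\<lambda>f\<in>carrier A. \<mu> X f + \<mu> Y f)"
  "X \<in> M.tangents \<Longrightarrow> (\<lambda>g\<in>M.germs. c * X g) \<in> M.tangents"
  "X \<in> M.tangents \<Longrightarrow> \<mu> (\<lambda>g\<in>M.germs. c * X g) = (\<lambda>f\<in>carrier A. c * \<mu> X f)"
proof -
  note S = functional_space_derivations[OF A, of \<epsilon>]
  have lift: "(\<lambda>g\<in>M.germs. \<Phi> g) \<in> M.tangents \<and> \<mu> (\<lambda>g\<in>M.germs. \<Phi> g) = (\<lambda>f\<in>carrier A. \<Psi> f)"
    if \<Psi>: "(\<lambda>f\<in>carrier A. \<Psi> f) \<in> derivations A \<epsilon>"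
      and eq: "\<And>g f. (\<And>X. X \<in> M.tangents \<Longrightarrow> X g = \<mu> X f) \<Longrightarrow> \<Phi> g = \<Psi> f" for \<Phi> \<Psi>
  proof -
    have "\<exists>f\<in>carrier A. (\<forall>X\<in>M.tangents. X g = \<mu> X f) \<and> (\<lambda>g\<in>M.germs. \<Phi> g) g = (\<lambda>f\<in>carrier A. \<Psi> f) f"
      if g: "g \<in> M.germs" for g
    proof -
      obtain f where "f \<in> carrier A" "\<And>X. X \<in> M.tangents \<Longrightarrow> X g = \<mu> X f"
        by (rule germ_tangent_map[OF g]) (rule that)
      then show ?thesis using eq[of g f] g by (intro bexI[of _ f]) auto
    qed
    then show ?thesis using tangent_lift[OF \<Psi>, of "\<lambda>g\<in>M.germs. \<Phi> g"] by simp
  qed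
  show "(\<lambda>g\<in>M.germs. 0) \<in> M.tangents"
    using lift[of "\<lambda>_. 0" "\<lambda>_. 0"] S by (simp add: functional_space_def)
  show "X \<in> M.tangents \<Longrightarrow> Y \<in> M.tangents \<Longrightarrow> (\<lambda>g\<in>M.germs. X g + Y g) \<in> M.tangents"
    "X \<in> M.tangents \<Longrightarrow> Y \<in> M.tangents \<Longrightarrow> \<mu> (\<lambda>g\<in>M.germs. X g + Y g) = (\<lambda>f\<in>carrier A. \<mu> X f + \<mu> Y f)"
    using lift[of "\<lambda>f. \<mu> X f + \<mu> Y f" "\<lambda>g. X g + Y g"] S tangent_map_derivation
    by (simp_all add: functional_space_def)
  show "X \<in> M.tangents \<Longrightarrow> (\<lambda>g\<in>M.germs. c * X g) \<in> M.tangents"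
    "X \<in> M.tangents \<Longrightarrow> \<mu> (\<lambda>g\<in>M.germs. c * X g) = (\<lambda>f\<in>carrier A. c * \<mu> X f)"
    using lift[of "\<lambda>f. c * \<mu> X f" "\<lambda>g. c * X g"] S tangent_map_derivation
    by (simp_all add: functional_space_def)
qed

lemma kpoints_leibniz_eq: "kpoints_leibniz Q = functional_algebra M.germs M.tangents ad"
  by (simp add: kpoints_leibniz_def Let_def lie_rack_leibniz_def)

lemma left_tangent_eq: "left_tangent Q = functional_algebra (carrier A) (derivations A \<epsilon>) (convolution m)"
  by (simp add: left_tangent_def Let_def)

theorem tangent_map_iso: "\<mu> \<in> leibniz_iso (kpoints_leibniz Q) (left_tangent Q)"
proof -
  have "\<mu> \<in> extensional M.tangents" by (simp add: kpoints_tangent_map_def)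
  then show ?thesis
    unfolding leibniz_iso_def leibniz_hom_def kpoints_leibniz_eq left_tangent_eq
    using bij_tangent_map tangent_map_derivation
    by (simp add: PiE_def tangent_operations ad_tangent_map)
qed

theorem left_leibniz_kpoints: "left_leibniz (kpoints_leibniz Q)"
proof (rule left_leibniz_transfer)
  show "\<mu> \<in> leibniz_hom (kpoints_leibniz Q) (left_tangent Q)" "inj_on \<mu> (carrier (kpoints_leibniz Q))"
    using tangent_map_iso by (auto simp: leibniz_iso_def bij_betw_def)
  show "left_leibniz (left_tangent Q)" by (rule left_leibniz_left_tangent)
  have "M.tangents \<subseteq> extensional M.germs"
    using M.tangent_curve by blast
  then have "functional_space M.germs M.tangents"
    by (simp add: functional_space_def tangent_operations)
  then show "Module.module base_field (kpoints_leibniz Q)"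
    unfolding kpoints_leibniz_eq by (rule module_functional_algebra)
qed (simp add: kpoints_leibniz_eq ad_tangent_map)

end

lemma kpoints_leibniz_iso:
  assumes "affine_rack Q" "kpoints_lie_rack Q" "kpoints_tangent_identified Q"
  shows "left_leibniz (kpoints_leibniz Q)"
    and "kpoints_tangent_map Q \<in> leibniz_iso (kpoints_leibniz Q) (left_tangent Q)"
proof -
  interpret kpoints_rack Q using assms by (simp add: kpoints_rack_def kpoints_rack_axioms_def affine_rack_scheme_def)
  show "left_leibniz (kpoints_leibniz Q)" by (rule left_leibniz_kpoints)
  show "kpoints_tangent_map Q \<in> leibniz_iso (kpoints_leibniz Q) (left_tangent Q)" by (rule tangent_map_iso)
qed

theorem theorem1p1:
  fixes Q :: "('k::field, 'a) rack_scheme"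
    and G :: "('k, 'a) group_scheme"
    and Q\<^sub>R :: "(real, 'b) rack_scheme"
    and Q\<^sub>C :: "(complex, 'c) rack_scheme"
  shows "(affine_rack Q \<longrightarrow> left_leibniz (left_tangent Q) \<and> right_leibniz (right_tangent Q)) \<and>
    is_functor (rack_category :: (('k, 'a) rack_scheme, 'a \<Rightarrow> 'a) cat) left_leibniz_category
      left_tangent differential_at_unit \<and>
    is_functor (rack_category :: (('k, 'a) rack_scheme, 'a \<Rightarrow> 'a) cat) right_leibniz_category
      right_tangent differential_at_unit \<and>
    (affine_group G \<longrightarrow> affine_rack (Conj G) \<and> left_tangent (Conj G) = lie_algebra_of G) \<and>
    (affine_rack Q\<^sub>R \<and> kpoints_lie_rack Q\<^sub>R \<and> kpoints_tangent_identified Q\<^sub>R \<longrightarrow>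
      left_leibniz (kpoints_leibniz Q\<^sub>R) \<and>
      kpoints_tangent_map Q\<^sub>R \<in> leibniz_iso (kpoints_leibniz Q\<^sub>R) (left_tangent Q\<^sub>R)) \<and>
    (affine_rack Q\<^sub>C \<and> kpoints_lie_rack Q\<^sub>C \<and> kpoints_tangent_identified Q\<^sub>C \<longrightarrow>
      left_leibniz (kpoints_leibniz Q\<^sub>C) \<and>
      kpoints_tangent_map Q\<^sub>C \<in> leibniz_iso (kpoints_leibniz Q\<^sub>C) (left_tangent Q\<^sub>C))"
  by (intro conjI impI; (elim conjE)?;
      rule affine_rack_scheme.left_leibniz_left_tangent affine_rack_scheme.right_leibniz_right_tangent
        is_functor_left_tangent is_functor_right_tangent affine_group_scheme.affine_rack_Conj
        affine_group_scheme.left_tangent_Conj kpoints_leibniz_iso;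
      (assumption | rule affine_rack_scheme.intro affine_group_scheme.intro; assumption)?)

end
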